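(* Let $\varphi\colon G\times M\to M$ be a left action of a Lie group $G$ on an analytic manifold $M$ (continuous in $G$) that is sated and analytic in $M$. Let $I$ be an open interval and $\gamma\colon I\to M$ a free analytic immersion that is negative, with $A$-decomposition $(\{a_n\}_{n\in\mathfrak n},\{[g_n]\}_{n\in\mathfrak n})$ ($A\subseteq I$ a compact maximal interval). Let $\sigma\colon\mathbb{Z}_{\ne0}\to\{-1,1\}$, $\sigma(n)=(-1)^{n-1}$ for $n>0$ and $\sigma(n)=(-1)^n$ for $n<0$. 1) The intervals $A_n$ ($\mathfrak n_-\le n\le\mathfrak n_+$, including $n=0$) are maximal, and they are the only maximal intervals. 2) For each $n\in\mathfrak n$: $g_n\cdot\gamma|_A\leadsto_+\gamma|_{A_n}$ if $|n|$ is even and $g_n\cdot\gamma|_A\leadsto_-\gamma|_{A_n}$ if $|n|$ is odd, and $$[g_n]=[g_{\sigma(1\cdot\mathrm{sgn}(n))}\cdot g_{\sigma(2\cdot\mathrm{sgn}(n))}\cdot\ldots\cdot g_{\sigma(|n|\cdot\mathrm{sgn}(n))}].$$ 3) $[g_{\pm1}]\subseteq G_{\gamma(a_{\pm1})}\setminus G_\gamma$ and $[g_{\pm1}^{-1}]=[g_{\pm1}]$.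
   Context: Intervals are connected subsets of $\mathbb{R}$ with non-empty interior. $M$ is a finite-dimensional Hausdorff real-analytic manifold without boundary (second countability not assumed); $G$ is a Lie group (same conventions); $\varphi$, $(g,x)\mapsto g\cdot x$, is a left action with $g\mapsto g\cdot x$ continuous for each $x\in M$. $\varphi$ is analytic in $M$ if $x\mapsto g\cdot x$ is analytic for each $g\in G$. $\varphi$ is sated if for mutually different $x,y,z\in M$ there is no sequence $\{g_n\}\subseteq G$ with $\lim_n g_n\cdot y=x=\lim_n g_n\cdot z$. $G_x$ is the stabilizer of $x\in M$. A curve $\gamma\colon D\to M$ on an interval is an analytic immersion (embedding) if it is the restriction of an analytic immersion (analytic immersion that is a homeomorphism onto its image) on an open interval containing $D$. An analytic diffeomorphism between intervals is a bijection that extends to an analytic diffeomorphism between open intervals. $(g\cdot\gamma)(t)=g\cdot\gamma(t)$, $G_\gamma=\{g: g\cdot\gamma=\gamma\}$, $[g]=gG_\gamma\in G/G_\gamma$ (also viewed as a subset of $G$). For analytic immersions, $\gamma\sim_\circ\gamma'$ means $\gamma(J)=\gamma'(J')$ for non-empty open intervals $J\subseteq\mathrm{dom}[\gamma]$, $J'\subseteq\mathrm{dom}[\gamma']$ on which $\gamma,\gamma'$ are embeddings. An analytic immersion $\delta$ is a free segment if for all $g\in G$: $g\cdot\delta\sim_\circ\delta$ implies $g\in G_\delta$. $\gamma$ is free if its restriction to some interval is a free segment. An interval $A\subseteq I$ is free if $\gamma|_A$ is a free segment; maximal if free and not properly contained in a free interval $A'\subseteq I$. Let $\tilde\gamma\colon\tilde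 D\to M$, $\gamma\colon D\to M$ be analytic immersions with $\tilde D$ compact. $\tilde\gamma\leadsto\gamma$ w.r.t. $\mu$ means: $\mu\colon\tilde D\supseteq\mathrm{dom}[\mu]\to D$ is an analytic diffeomorphism between intervals (onto $D$) with $\tilde\gamma|_{\mathrm{dom}[\mu]}=\gamma\circ\mu$, and either $\mathrm{dom}[\mu]=\tilde D$ and $D$ is compact, or $\mathrm{dom}[\mu]$ and $D$ are half-open and $\mathrm{dom}[\mu]$ contains an endpoint of $\tilde D$. Write $\leadsto_+$ (resp. $\leadsto_-$) if $\mu$ is increasing (resp. decreasing). Let $I=(i',i)$ and $A\subseteq I$ a compact free interval. An $A$-decomposition of $\gamma$ is a pair $(\{a_n\}_{n\in\mathfrak n},\{[g_n]\}_{n\in\mathfrak n})$ with $\mathfrak n=\{n\in\mathbb{Z}_{\ne0}:\mathfrak n_-\le n\le\mathfrak n_+\}$, $-\infty\le\mathfrak n_-<0<\mathfrak n_+\le\infty$, $a_n\in I$ strictly increasing in $n$, $g_n\in G$, $[g_{\pm1}]\ne[e]$, such that with $A_0=[a_{-1},a_1]$, $A_n=[a_{n-1},a_n]$ for $\mathfrak n_-<n\le-1$, $A_n=[a_n,a_{n+1}]$ for $1\le n<\mathfrak n_+$, $A_{\mathfrak n_-}=(i',a_{\mathfrak n_-}]$ if $\mathfrak n_-\neq-\infty$, $A_{\mathfrak n_+}=[a_{\mathfrak n_+},i)$ if $\mathfrak n_+\ne\infty$, one has $A_0=A$ and $g_n\cdot\gamma|_A\leadsto\gamma|_{A_n}$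 for all $n\in\mathfrak n$. ($n$ always ranges over integers. If $\varphi$ is sated and analytic in $M$, every compact maximal interval $A$ admits exactly one $A$-decomposition.) A compact maximal interval $A$ is positive (negative) if in its $A$-decomposition both $g_{1}\cdot\gamma|_A\leadsto_+\gamma|_{A_{1}}$ and $g_{-1}\cdot\gamma|_A\leadsto_+\gamma|_{A_{-1}}$ (resp. both with $\leadsto_-$). $\gamma$ is negative if it admits a negative compact maximal interval (then every compact maximal interval is negative). *)

theory Defs
  imports
    "HOL-Analysis.Analysis"
    "HOL-Analysis.Abstract_Euclidean_Space"
    "HOL-Analysis.FPS_Convergence"
    "HOL-Algebra.Group_Action"
    "HOL-Library.Extended"
begin

text \<open>
  Coordinate space is the library's \<open>Euclidean_space n\<close>, i.e. sequences vanishing from index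
  \<open>n\<close> on, so that the dimension is a natural number and may be \<open>0\<close> (discrete Lie groups).
  Multi-indices are likewise functions vanishing from index \<open>n\<close> on.
\<close>

definition real_analytic_on :: "nat \<Rightarrow> (nat \<Rightarrow> real) set \<Rightarrow> ((nat \<Rightarrow> real) \<Rightarrow> real) \<Rightarrow> bool"
  where "real_analytic_on n W f \<longleftrightarrow>
    (\<forall>a\<in>W. \<exists>r>0. \<exists>c :: (nat \<Rightarrow> nat) \<Rightarrow> real.
      \<forall>x\<in>W. (\<forall>i<n. \<bar>x i - a i\<bar> < r) \<longrightarrow>
        ((\<lambda>\<alpha>. c \<alpha> * (\<Prod>i<n. (x i - a i) ^ \<alpha> i)) has_sum f x) {\<alpha>. \<forall>i\<ge>n. \<alpha> i = 0})"

record 'a chart_structure =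
  mtop :: "'a topology"
  mdim :: nat
  matlas :: "('a set \<times> ('a \<Rightarrow> nat \<Rightarrow> real)) set"

definition is_chart :: "'a topology \<Rightarrow> nat \<Rightarrow> 'a set \<Rightarrow> ('a \<Rightarrow> nat \<Rightarrow> real) \<Rightarrow> bool"
  where "is_chart T n U \<psi> \<longleftrightarrow>
    openin T U \<and> openin (Euclidean_space n) (\<psi> ` U) \<and>
    homeomorphic_map (subtopology T U) (subtopology (Euclidean_space n) (\<psi> ` U)) \<psi>"

definition analytic_manifold :: "'a chart_structure \<Rightarrow> bool"
  where "analytic_manifold M \<longleftrightarrow>
    Hausdorff_space (mtop M) \<and>
    (\<forall>(U, \<psi>) \<in> matlas M. is_chart (mtop M) (mdim M) U \<psi>) \<and>
    (\<Union>(U, \<psi>) \<in> matlas M. U) = topspace (mtop M) \<and>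
    (\<forall>(U, \<psi>) \<in> matlas M. \<forall>(V, \<eta>) \<in> matlas M. \<forall>i < mdim M.
      real_analytic_on (mdim M) (\<psi> ` (U \<inter> V)) (\<lambda>y. \<eta> (inv_into U \<psi> y) i))"

definition analytic_map :: "'a chart_structure \<Rightarrow> 'b chart_structure \<Rightarrow> ('a \<Rightarrow> 'b) \<Rightarrow> bool"
  where "analytic_map M N f \<longleftrightarrow>
    continuous_map (mtop M) (mtop N) f \<and>
    (\<forall>(U, \<psi>) \<in> matlas M. \<forall>(V, \<eta>) \<in> matlas N. \<forall>i < mdim N.
      real_analytic_on (mdim M) (\<psi> ` {p \<in> U. f p \<in> V}) (\<lambda>y. \<eta> (f (inv_into U \<psi> y)) i))"

definition prod_structure ::
    "'a chart_structure \<Rightarrow> 'b chart_structure \<Rightarrow> ('a \<times> 'b) chart_structure"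
  where "prod_structure M N =
    \<lparr>mtop = prod_topology (mtop M) (mtop N),
     mdim = mdim M + mdim N,
     matlas = {(U \<times> V, \<lambda>(p, q) i. if i < mdim M then \<psi> p i else \<eta> q (i - mdim M)) | U \<psi> V \<eta>.
                 (U, \<psi>) \<in> matlas M \<and> (V, \<eta>) \<in> matlas N}\<rparr>"

definition lie_group :: "('g, 'z) monoid_scheme \<Rightarrow> 'g chart_structure \<Rightarrow> bool"
  where "lie_group G L \<longleftrightarrow>
    group G \<and> analytic_manifold L \<and> topspace (mtop L) = carrier G \<and>
    analytic_map (prod_structure L L) L (\<lambda>(g, h). g \<otimes>\<^bsub>G\<^esub> h) \<and>
    analytic_map L L (\<lambda>g. inv\<^bsub>G\<^esub> g)"

definition continuous_in_group ::
    "'g chart_structure \<Rightarrow> 'm chart_structure \<Rightarrow> ('g \<Rightarrow> 'm \<Rightarrow> 'm) \<Rightarrow> bool"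
  where "continuous_in_group L M \<phi> \<longleftrightarrow>
    (\<forall>x \<in> topspace (mtop M). continuous_map (mtop L) (mtop M) (\<lambda>g. \<phi> g x))"

definition analytic_in_space ::
    "('g, 'z) monoid_scheme \<Rightarrow> 'm chart_structure \<Rightarrow> ('g \<Rightarrow> 'm \<Rightarrow> 'm) \<Rightarrow> bool"
  where "analytic_in_space G M \<phi> \<longleftrightarrow> (\<forall>g \<in> carrier G. analytic_map M M (\<phi> g))"

definition sated ::
    "('g, 'z) monoid_scheme \<Rightarrow> 'm chart_structure \<Rightarrow> ('g \<Rightarrow> 'm \<Rightarrow> 'm) \<Rightarrow> bool"
  where "sated G M \<phi> \<longleftrightarrow>
    (\<forall>x \<in> topspace (mtop M). \<forall>y \<in> topspace (mtop M). \<forall>z \<in> topspace (mtop M).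
      x \<noteq> y \<and> y \<noteq> z \<and> x \<noteq> z \<longrightarrow>
      \<not> (\<exists>h :: nat \<Rightarrow> 'g. range h \<subseteq> carrier G \<and>
            limitin (mtop M) (\<lambda>n. \<phi> (h n) y) x sequentially \<and>
            limitin (mtop M) (\<lambda>n. \<phi> (h n) z) x sequentially))"

text \<open>
  A curve is given by its domain \<open>D\<close> and a total function; only its values on \<open>D\<close> matter.
\<close>

definition nondeg_interval :: "real set \<Rightarrow> bool"
  where "nondeg_interval D \<longleftrightarrow> connected D \<and> interior D \<noteq> {}"

text \<open>Intervals \<open>[a, \<infinity>)\<close> and \<open>(-\<infinity>, a]\<close> count as half-open.\<close>

definition half_open :: "real set \<Rightarrow> bool"
  where "half_open D \<longleftrightarrow>
    (\<exists>a. D = {a..} \<or> D = {..a} \<or> (\<exists>b>a. D = {a..<b} \<or> D = {a<..b}))"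

definition real_analytic_at :: "(real \<Rightarrow> real) \<Rightarrow> real \<Rightarrow> bool"
  where "real_analytic_at f t \<longleftrightarrow> (\<exists>F. (\<lambda>h. f (t + h)) has_fps_expansion F)"

definition open_immersion :: "'m chart_structure \<Rightarrow> real set \<Rightarrow> (real \<Rightarrow> 'm) \<Rightarrow> bool"
  where "open_immersion M J \<delta> \<longleftrightarrow>
    nondeg_interval J \<and> open J \<and>
    continuous_map (top_of_set J) (mtop M) \<delta> \<and>
    (\<forall>t\<in>J. \<forall>(U, \<psi>) \<in> matlas M. \<delta> t \<in> U \<longrightarrow>
      (\<forall>i < mdim M. real_analytic_at (\<lambda>s. \<psi> (\<delta> s) i) t) \<and>
      (\<exists>i < mdim M. deriv (\<lambda>s. \<psi> (\<delta> s) i) t \<noteq> 0))"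

definition analytic_immersion :: "'m chart_structure \<Rightarrow> real set \<Rightarrow> (real \<Rightarrow> 'm) \<Rightarrow> bool"
  where "analytic_immersion M D \<gamma> \<longleftrightarrow>
    nondeg_interval D \<and>
    (\<exists>J \<delta>. D \<subseteq> J \<and> open_immersion M J \<delta> \<and> (\<forall>t\<in>D. \<gamma> t = \<delta> t))"

definition analytic_embedding :: "'m chart_structure \<Rightarrow> real set \<Rightarrow> (real \<Rightarrow> 'm) \<Rightarrow> bool"
  where "analytic_embedding M D \<gamma> \<longleftrightarrow>
    nondeg_interval D \<and>
    (\<exists>J \<delta>. D \<subseteq> J \<and> open_immersion M J \<delta> \<and>
       embedding_map (top_of_set J) (mtop M) \<delta> \<and> (\<forall>t\<in>D. \<gamma> t = \<delta> t))"

definition open_interval_diffeo :: "real set \<Rightarrow> real set \<Rightarrow> (real \<Rightarrow> real) \<Rightarrow> bool"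
  where "open_interval_diffeo J J' \<nu> \<longleftrightarrow>
    nondeg_interval J \<and> open J \<and> nondeg_interval J' \<and> open J' \<and> bij_betw \<nu> J J' \<and>
    (\<forall>t\<in>J. real_analytic_at \<nu> t) \<and> (\<forall>s\<in>J'. real_analytic_at (inv_into J \<nu>) s)"

definition analytic_interval_diffeo :: "real set \<Rightarrow> real set \<Rightarrow> (real \<Rightarrow> real) \<Rightarrow> bool"
  where "analytic_interval_diffeo D D' \<mu> \<longleftrightarrow>
    nondeg_interval D \<and> nondeg_interval D' \<and> bij_betw \<mu> D D' \<and>
    (\<exists>J J' \<nu>. D \<subseteq> J \<and> D' \<subseteq> J' \<and> open_interval_diffeo J J' \<nu> \<and> (\<forall>t\<in>D. \<mu> t = \<nu> t))"

text \<open>The relation \<open>(D, \<gamma>) \<sim>\<^sub>\<circ> (D', \<gamma>')\<close>.\<close>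

definition locally_overlap ::
    "'m chart_structure \<Rightarrow> real set \<Rightarrow> (real \<Rightarrow> 'm) \<Rightarrow> real set \<Rightarrow> (real \<Rightarrow> 'm) \<Rightarrow> bool"
  where "locally_overlap M D \<gamma> D' \<gamma>' \<longleftrightarrow>
    (\<exists>J J'. nondeg_interval J \<and> open J \<and> J \<subseteq> D \<and> nondeg_interval J' \<and> open J' \<and> J' \<subseteq> D' \<and>
       analytic_embedding M J \<gamma> \<and> analytic_embedding M J' \<gamma>' \<and> \<gamma> ` J = \<gamma>' ` J')"

text \<open>The relation \<open>(D', \<gamma>') \<leadsto> (D, \<gamma>)\<close> with respect to \<open>\<mu> : E \<rightarrow> D\<close>.\<close>

definition leads_to_via ::
    "'m chart_structure \<Rightarrow> real set \<Rightarrow> (real \<Rightarrow> 'm) \<Rightarrow> real set \<Rightarrow> (real \<Rightarrow> 'm) \<Rightarrow>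
      real set \<Rightarrow> (real \<Rightarrow> real) \<Rightarrow> bool"
  where "leads_to_via M D' \<gamma>' D \<gamma> E \<mu> \<longleftrightarrow>
    compact D' \<and> analytic_immersion M D' \<gamma>' \<and> analytic_immersion M D \<gamma> \<and>
    E \<subseteq> D' \<and> analytic_interval_diffeo E D \<mu> \<and> (\<forall>t\<in>E. \<gamma>' t = \<gamma> (\<mu> t)) \<and>
    (E = D' \<and> compact D \<or>
     half_open E \<and> half_open D \<and> (Inf D' \<in> E \<or> Sup D' \<in> E))"

definition leads_to ::
    "'m chart_structure \<Rightarrow> real set \<Rightarrow> (real \<Rightarrow> 'm) \<Rightarrow> real set \<Rightarrow> (real \<Rightarrow> 'm) \<Rightarrow> bool"
  where "leads_to M D' \<gamma>' D \<gamma> \<longleftrightarrow> (\<exists>E \<mu>. leads_to_via M D' \<gamma>' D \<gamma> E \<mu>)"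

definition leads_to_pos ::
    "'m chart_structure \<Rightarrow> real set \<Rightarrow> (real \<Rightarrow> 'm) \<Rightarrow> real set \<Rightarrow> (real \<Rightarrow> 'm) \<Rightarrow> bool"
  where "leads_to_pos M D' \<gamma>' D \<gamma> \<longleftrightarrow>
    (\<exists>E \<mu>. leads_to_via M D' \<gamma>' D \<gamma> E \<mu> \<and> strict_mono_on E \<mu>)"

definition leads_to_neg ::
    "'m chart_structure \<Rightarrow> real set \<Rightarrow> (real \<Rightarrow> 'm) \<Rightarrow> real set \<Rightarrow> (real \<Rightarrow> 'm) \<Rightarrow> bool"
  where "leads_to_neg M D' \<gamma>' D \<gamma> \<longleftrightarrow>
    (\<exists>E \<mu>. leads_to_via M D' \<gamma>' D \<gamma> E \<mu> \<and> strict_antimono_on E \<mu>)"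

definition curve_stabilizer ::
    "('g, 'z) monoid_scheme \<Rightarrow> ('g \<Rightarrow> 'm \<Rightarrow> 'm) \<Rightarrow> real set \<Rightarrow> (real \<Rightarrow> 'm) \<Rightarrow> 'g set"
  where "curve_stabilizer G \<phi> D \<gamma> = {g \<in> carrier G. \<forall>t\<in>D. \<phi> g (\<gamma> t) = \<gamma> t}"

definition free_segment ::
    "('g, 'z) monoid_scheme \<Rightarrow> 'm chart_structure \<Rightarrow> ('g \<Rightarrow> 'm \<Rightarrow> 'm) \<Rightarrow>
      real set \<Rightarrow> (real \<Rightarrow> 'm) \<Rightarrow> bool"
  where "free_segment G M \<phi> D \<delta> \<longleftrightarrow>
    analytic_immersion M D \<delta> \<and>
    (\<forall>g \<in> carrier G. locally_overlap M D (\<phi> g \<circ> \<delta>) D \<delta> \<longrightarrow> g \<in> curve_stabilizer G \<phi> D \<delta>)"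

definition free_interval ::
    "('g, 'z) monoid_scheme \<Rightarrow> 'm chart_structure \<Rightarrow> ('g \<Rightarrow> 'm \<Rightarrow> 'm) \<Rightarrow>
      real set \<Rightarrow> (real \<Rightarrow> 'm) \<Rightarrow> real set \<Rightarrow> bool"
  where "free_interval G M \<phi> I \<gamma> A \<longleftrightarrow>
    nondeg_interval A \<and> A \<subseteq> I \<and> free_segment G M \<phi> A \<gamma>"

definition free_curve ::
    "('g, 'z) monoid_scheme \<Rightarrow> 'm chart_structure \<Rightarrow> ('g \<Rightarrow> 'm \<Rightarrow> 'm) \<Rightarrow>
      real set \<Rightarrow> (real \<Rightarrow> 'm) \<Rightarrow> bool"
  where "free_curve G M \<phi> I \<gamma> \<longleftrightarrow> (\<exists>A. free_interval G M \<phi> I \<gamma> A)"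

definition maximal_interval ::
    "('g, 'z) monoid_scheme \<Rightarrow> 'm chart_structure \<Rightarrow> ('g \<Rightarrow> 'm \<Rightarrow> 'm) \<Rightarrow>
      real set \<Rightarrow> (real \<Rightarrow> 'm) \<Rightarrow> real set \<Rightarrow> bool"
  where "maximal_interval G M \<phi> I \<gamma> A \<longleftrightarrow>
    free_interval G M \<phi> I \<gamma> A \<and> \<not> (\<exists>A'. free_interval G M \<phi> I \<gamma> A' \<and> A \<subset> A')"

text \<open>
  The bounds \<open>n\<^sub>-\<close>, \<open>n\<^sub>+\<close> of the index set are extended integers \<open>nm\<close>, \<open>np\<close>;
  \<open>[g]\<close> is the left coset \<open>g <# curve_stabilizer G \<phi> I \<gamma>\<close>, and families of cosets are given
  by arbitrary representatives.
\<close>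

definition decomp_index :: "int extended \<Rightarrow> int extended \<Rightarrow> int set"
  where "decomp_index nm np = {n. n \<noteq> 0 \<and> nm \<le> Fin n \<and> Fin n \<le> np}"

definition decomp_interval ::
    "real set \<Rightarrow> int extended \<Rightarrow> int extended \<Rightarrow> (int \<Rightarrow> real) \<Rightarrow> int \<Rightarrow> real set"
  where "decomp_interval I nm np a n =
    (if n = 0 then {a (-1)..a 1}
     else if n < 0 then (if nm = Fin n then {t \<in> I. t \<le> a n} else {a (n - 1)..a n})
     else (if np = Fin n then {t \<in> I. a n \<le> t} else {a n..a (n + 1)}))"

definition A_decomposition ::
    "('g, 'z) monoid_scheme \<Rightarrow> 'm chart_structure \<Rightarrow> ('g \<Rightarrow> 'm \<Rightarrow> 'm) \<Rightarrow>
      real set \<Rightarrow> (real \<Rightarrow> 'm) \<Rightarrow> real set \<Rightarrow>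
      int extended \<Rightarrow> int extended \<Rightarrow> (int \<Rightarrow> real) \<Rightarrow> (int \<Rightarrow> 'g) \<Rightarrow> bool"
  where "A_decomposition G M \<phi> I \<gamma> A nm np a g \<longleftrightarrow>
    nm < 0 \<and> 0 < np \<and>
    (\<forall>n \<in> decomp_index nm np. a n \<in> I \<and> g n \<in> carrier G) \<and>
    strict_mono_on (decomp_index nm np) a \<and>
    (\<forall>n \<in> {-1, 1}. g n <#\<^bsub>G\<^esub> curve_stabilizer G \<phi> I \<gamma> \<noteq> \<one>\<^bsub>G\<^esub> <#\<^bsub>G\<^esub> curve_stabilizer G \<phi> I \<gamma>) \<and>
    decomp_interval I nm np a 0 = A \<and>
    (\<forall>n \<in> decomp_index nm np.
      leads_to M A (\<phi> (g n) \<circ> \<gamma>) (decomp_interval I nm np a n) \<gamma>)"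

definition negative_interval ::
    "('g, 'z) monoid_scheme \<Rightarrow> 'm chart_structure \<Rightarrow> ('g \<Rightarrow> 'm \<Rightarrow> 'm) \<Rightarrow>
      real set \<Rightarrow> (real \<Rightarrow> 'm) \<Rightarrow> real set \<Rightarrow> bool"
  where "negative_interval G M \<phi> I \<gamma> A \<longleftrightarrow>
    compact A \<and> maximal_interval G M \<phi> I \<gamma> A \<and>
    (\<exists>nm np a g. A_decomposition G M \<phi> I \<gamma> A nm np a g \<and>
      (\<forall>n \<in> {-1, 1}. leads_to_neg M A (\<phi> (g n) \<circ> \<gamma>) (decomp_interval I nm np a n) \<gamma>))"

definition negative_curve ::
    "('g, 'z) monoid_scheme \<Rightarrow> 'm chart_structure \<Rightarrow> ('g \<Rightarrow> 'm \<Rightarrow> 'm) \<Rightarrow>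
      real set \<Rightarrow> (real \<Rightarrow> 'm) \<Rightarrow> bool"
  where "negative_curve G M \<phi> I \<gamma> \<longleftrightarrow> (\<exists>A. negative_interval G M \<phi> I \<gamma> A)"

definition alt_sign :: "int \<Rightarrow> int"
  where "alt_sign n = (if n > 0 then (-1) ^ nat (n - 1) else (-1) ^ nat (- n))"

text \<open>\<open>g (\<sigma> (1 * sgn n)) \<otimes> g (\<sigma> (2 * sgn n)) \<otimes> \<dots> \<otimes> g (\<sigma> (\<bar>n\<bar> * sgn n))\<close> for \<open>\<sigma> = alt_sign\<close>.\<close>

definition alternating_product :: "('g, 'z) monoid_scheme \<Rightarrow> (int \<Rightarrow> 'g) \<Rightarrow> int \<Rightarrow> 'g"
  where "alternating_product G g n =
    foldr (\<lambda>k h. g (alt_sign (k * sgn n)) \<otimes>\<^bsub>G\<^esub> h) [1..\<bar>n\<bar>] \<one>\<^bsub>G\<^esub>"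

end

theory Submission
  imports Defs "HOL-Complex_Analysis.Complex_Analysis"
begin

text \<open>
  Write \<open>S\<close> for the stabilizer of \<open>\<gamma>\<close>. If a translate of \<open>\<gamma>\<close> meets \<open>\<gamma>\<close> in points that
  accumulate at parameters \<open>s\<close> and \<open>t\<close>, then near \<open>s\<close> it is \<open>\<gamma>\<close> after an analytic change of
  parameter \<open>\<nu>\<close> with \<open>\<nu> s = t\<close> (\<open>open_immersion_germ_match\<close>). The relation \<open>match h s t \<sigma>\<close>
  records this for the translate by \<open>h\<close>, with \<open>\<sigma> = 1\<close> for increasing and \<open>\<sigma> = -1\<close> for
  decreasing \<open>\<nu>\<close>. Matches can be composed and inverted, and an interval is free exactly when every
  element matching two of its interior points lies in \<open>S\<close> (\<open>free_interval_iff\<close>). The manifold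
  enters only through these facts, through the identity theorem, and through the fact that an
  immersed analytic curve never runs back along itself (\<open>no_reversal\<close>): the distance between two
  parameters that the identity matches in reverse direction could be decreased to \<open>0\<close>,
  against local injectivity.

  Negativity means that \<open>g 1\<close> and \<open>g (-1)\<close> match \<open>a 1\<close> and \<open>a (-1)\<close> with themselves and reverse
  the direction there: they are reflections at the two ends of \<open>A\<close>. Reflections propagate
  outwards. Suppose that a product \<open>h\<close> of reflections carries \<open>A\<close> onto the piece number \<open>n\<close>, and
  let \<open>r\<close> be the reflection at the end of \<open>A\<close> that \<open>h\<close> sends to the far end of that piece. Then
  \<open>h r h\<^sup>-\<^sup>1\<close> is a reflection at this far end, and \<open>h r\<close> carries \<open>A\<close> across it, in the opposite
  direction. As \<open>h r\<close> and the given element \<open>g (n + 1)\<close> both send an arc of \<open>A\<close> into the piece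
  \<open>n + 1\<close>, the element \<open>g (n + 1)\<^sup>-\<^sup>1 h r\<close> matches two interior points of \<open>A\<close>, so it lies in \<open>S\<close>
  because \<open>A\<close> is free, and the directions agree because \<open>\<gamma>\<close> never runs back
  (\<open>leads_to_via_determined\<close>). The reflections used are alternately those at the two ends of \<open>A\<close>,
  which gives the alternating products and the alternating signs (\<open>propagation\<close>).

  No free interval has one of the points \<open>a n\<close> in its interior, because the reflection at \<open>a n\<close>
  would then belong to \<open>S\<close>. Every free interval therefore lies inside one piece, provided that the
  pieces cover \<open>I\<close>. Here satedness is used: if the \<open>a n\<close> accumulated at a point \<open>x\<close> of \<open>I\<close>, the
  translates by the \<open>g n\<close> would contract all of \<open>\<gamma> A\<close> to \<open>\<gamma> x\<close> (\<open>D_cover\<close>). The pieces are free,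
  being images of \<open>A\<close>, so they are precisely the maximal intervals.

  The argument needs reflections at the ends of the given \<open>A\<close>, while negativity is known only for
  some compact maximal interval \<open>B\<close>. But applied to \<open>B\<close> it shows that \<open>A\<close> is one of the
  pieces belonging to \<open>B\<close>, and all their endpoints carry reflections. So it applies to \<open>A\<close>.
\<close>

section \<open>Real-analytic functions of one variable\<close>

text \<open>
  The coefficients are the real parts of the complex ones. A holomorphic local inverse of an analytic
  function is known to be real only on the image of real points, and this criterion covers it.
\<close>

lemma real_analytic_at_Re_holomorphic:
  assumes hol: "F holomorphic_on ball (complex_of_real t) r" and "r > 0"
    and f: "\<And>s. \<bar>s - t\<bar> < r \<Longrightarrow> f s = Re (F (of_real s))"
  shows "real_analytic_at f t"
proof -
  define c where "c n = Re ((deriv ^^ n) F (of_real t) / fact n)" for n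
  have sums: "(\<lambda>n. c n * h ^ n) sums f (t + h)" if "\<bar>h\<bar> < r" for h
  proof -
    have "(\<lambda>n. (deriv ^^ n) F (of_real t) / fact n * (of_real (t + h) - of_real t) ^ n)
            sums F (of_real (t + h))"
      by (rule holomorphic_power_series[OF hol]) (use that in \<open>auto simp: dist_norm\<close>)
    then have "(\<lambda>n. Re ((deriv ^^ n) F (of_real t) / fact n * (of_real (t + h) - of_real t) ^ n))
            sums Re (F (of_real (t + h)))"
      by (rule sums_Re)
    moreover have "Re ((deriv ^^ n) F (of_real t) / fact n * (of_real (t + h) - of_real t) ^ n) = c n * h ^ n" for n
    proof -
      have Re_mult: "Re (z * complex_of_real y) = Re z * y" for z y by simp
      have "(complex_of_real (t + h) - of_real t) ^ n = of_real (h ^ n)" by simp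
      then show ?thesis unfolding c_def using Re_mult[of _ "h ^ n"] by metis
    qed
    ultimately show ?thesis using f[of "t + h"] that by simp
  qed
  have "(\<lambda>h. f (t + h)) has_fps_expansion Abs_fps c"
  proof (rule has_fps_expansionI)
    show "eventually (\<lambda>u. (\<lambda>n. fps_nth (Abs_fps c) n * u ^ n) sums f (t + u)) (nhds 0)"
      unfolding eventually_nhds_metric dist_real_def using \<open>r > 0\<close> sums by auto
  qed
  then show ?thesis by (auto simp: real_analytic_at_def)
qed

text \<open>
  Passing to holomorphic extensions makes complex analysis available: composition, the identity
  theorem, the inverse function theorem and uniform limits.
\<close>

lemma real_analytic_at_iff_holomorphic:
  "real_analytic_at f t \<longleftrightarrow>
     (\<exists>r>0. \<exists>F. F holomorphic_on ball (complex_of_real t) r \<and>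
        (\<forall>s. \<bar>s - t\<bar> < r \<longrightarrow> F (of_real s) = of_real (f s)))"
  (is "?L \<longleftrightarrow> ?R")
proof
  assume ?L
  then obtain P where "(\<lambda>h. f (t + h)) has_fps_expansion P"
    by (auto simp: real_analytic_at_def)
  then have rad: "fps_conv_radius P > 0"
    and ev: "eventually (\<lambda>h. eval_fps P h = f (t + h)) (nhds 0)"
    by (auto simp: has_fps_expansion_def)
  define C :: "complex fps" where "C = Abs_fps (\<lambda>n. of_real (fps_nth P n))"
  have radC: "fps_conv_radius C = fps_conv_radius P"
    by (simp add: fps_conv_radius_def conv_radius_def C_def)
  have evalC: "eval_fps C (of_real h) = of_real (eval_fps P h)"
    if "ereal (norm h) < fps_conv_radius P" for h
  proof -
    have "(\<lambda>n. fps_nth P n * h ^ n) sums eval_fps P h"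
      by (rule sums_eval_fps) fact
    then have "(\<lambda>n. complex_of_real (fps_nth P n * h ^ n)) sums of_real (eval_fps P h)"
      by (subst sums_of_real_iff)
    then show ?thesis
      by (simp add: eval_fps_def C_def sums_iff)
  qed
  obtain r1 where r1: "r1 > 0" "ereal r1 \<le> fps_conv_radius P"
    using rad by (metis ereal_dense2 ereal_less(2) less_imp_le)
  obtain r2 where r2: "r2 > 0" "\<And>h. \<bar>h\<bar> < r2 \<Longrightarrow> eval_fps P h = f (t + h)"
    using ev by (auto simp: eventually_nhds_metric dist_real_def)
  define r where "r = min r1 r2"
  have "(\<lambda>z. z - of_real t) ` ball (complex_of_real t) r \<subseteq> eball 0 (fps_conv_radius C)"
  proof (rule image_subsetI)
    fix z assume "z \<in> ball (complex_of_real t) r"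
    then have "norm (z - of_real t) < r1"
      by (auto simp: r_def dist_norm norm_minus_commute)
    then have "ereal (norm (z - of_real t)) < fps_conv_radius C"
      using r1 radC by (metis ereal_less_eq(3) less_ereal.simps(1) order_less_le_trans)
    then show "z - of_real t \<in> eball 0 (fps_conv_radius C)"
      by (simp add: in_eball_iff)
  qed
  then have "(eval_fps C \<circ> (\<lambda>z. z - of_real t)) holomorphic_on ball (of_real t) r"
    by (intro holomorphic_on_compose_gen[of _ _ _ "eball 0 (fps_conv_radius C)"] holomorphic_intros) auto
  then have "(\<lambda>z. eval_fps C (z - of_real t)) holomorphic_on ball (of_real t) r"
    by (simp add: o_def)
  moreover have "eval_fps C (of_real s - of_real t) = of_real (f s)" if "\<bar>s - t\<bar> < r" for s
  proof -
    have "ereal (norm (s - t)) < fps_conv_radius P"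
      using that r1 by (metis ereal_less_eq(3) less_ereal.simps(1) min_less_iff_conj order_less_le_trans r_def real_norm_def)
    from evalC[OF this] r2(2)[of "s - t"] that show ?thesis
      by (simp add: r_def)
  qed
  moreover have "r > 0" using r1 r2 by (simp add: r_def)
  ultimately show ?R by blast
next
  assume ?R
  then obtain r F where r: "r > 0" and hol: "F holomorphic_on ball (complex_of_real t) r"
    and F: "\<And>s. \<bar>s - t\<bar> < r \<Longrightarrow> F (of_real s) = of_real (f s)" by blast
  from hol r show ?L
    by (rule real_analytic_at_Re_holomorphic) (simp add: F)
qed

lemma real_analytic_at_cong:
  assumes "eventually (\<lambda>s. f s = g s) (nhds t)"
  shows "real_analytic_at f t \<longleftrightarrow> real_analytic_at g t"
proof -
  have *: "real_analytic_at g t" if H: "real_analytic_at f t" "eventually (\<lambda>s. f s = g s) (nhds t)" for f g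
  proof -
    obtain r F where r: "r > 0" "F holomorphic_on ball (complex_of_real t) r"
      "\<And>s. \<bar>s - t\<bar> < r \<Longrightarrow> F (of_real s) = of_real (f s)"
      using H(1) by (auto simp: real_analytic_at_iff_holomorphic)
    obtain e where e: "e > 0" "\<And>s. \<bar>s - t\<bar> < e \<Longrightarrow> f s = g s"
      using H(2) by (auto simp: eventually_nhds_metric dist_real_def)
    show ?thesis
      unfolding real_analytic_at_iff_holomorphic
    proof (intro exI[of _ "min r e"] conjI exI[of _ F])
      show "F holomorphic_on ball (of_real t) (min r e)"
        using r(2) by (rule holomorphic_on_subset) auto
    qed (use r e in auto)
  qed
  show ?thesis
    using *[of f g] *[of g f] assms by (auto simp: eq_commute elim: eventually_mono)
qed

lemma real_analytic_at_imp_eventually: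
  assumes "real_analytic_at f t"
  shows "\<exists>r>0. \<forall>s. \<bar>s - t\<bar> < r \<longrightarrow> real_analytic_at f s"
proof -
  obtain r F where r: "r > 0" and hol: "F holomorphic_on ball (complex_of_real t) r"
    and F: "\<And>s. \<bar>s - t\<bar> < r \<Longrightarrow> F (of_real s) = of_real (f s)"
    using assms by (auto simp: real_analytic_at_iff_holomorphic)
  have "real_analytic_at f s" if s: "\<bar>s - t\<bar> < r" for s
  proof (rule real_analytic_at_Re_holomorphic)
    have "ball (complex_of_real s) (r - \<bar>s - t\<bar>) \<subseteq> ball (of_real t) r"
    proof
      fix z assume "z \<in> ball (complex_of_real s) (r - \<bar>s - t\<bar>)"
      moreover have "dist (complex_of_real t) z \<le> dist (complex_of_real t) (of_real s) + dist (of_real s) z"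
        by (rule dist_triangle)
      moreover have "dist (complex_of_real t) (of_real s) = \<bar>s - t\<bar>"
        by (metis abs_minus_commute dist_of_real dist_real_def)
      ultimately show "z \<in> ball (of_real t) r" by simp
    qed
    with hol show "F holomorphic_on ball (of_real s) (r - \<bar>s - t\<bar>)"
      by (rule holomorphic_on_subset)
    show "r - \<bar>s - t\<bar> > 0" using s by simp
    show "f u = Re (F (of_real u))" if "\<bar>u - s\<bar> < r - \<bar>s - t\<bar>" for u
      using F[of u] that by simp
  qed
  with r show ?thesis by blast
qed

lemma holomorphic_extension_deriv:
  assumes r: "r > 0" and hol: "F holomorphic_on ball (complex_of_real t) r"
    and F: "\<And>s. \<bar>s - t\<bar> < r \<Longrightarrow> F (of_real s) = of_real (f s)"
  shows "(f has_field_derivative Re (deriv F (of_real t))) (at t)"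
proof -
  have "(F has_field_derivative deriv F (of_real t)) (at (of_real t))"
    using hol by (rule holomorphic_derivI) (use r in auto)
  then have "((\<lambda>x. F (of_real x)) has_vector_derivative deriv F (of_real t)) (at t)"
    by (rule has_vector_derivative_real_field)
  then have "((\<lambda>x. Re (F (of_real x))) has_field_derivative Re (deriv F (of_real t))) (at t)"
    by (rule has_field_derivative_Re)
  moreover have "eventually (\<lambda>x. Re (F (of_real x)) = f x) (nhds t)"
    unfolding eventually_nhds_metric dist_real_def using r F by auto
  ultimately show ?thesis
    by (subst (asm) DERIV_cong_ev) auto
qed

lemma real_analytic_at_imp_DERIV:
  assumes "real_analytic_at f t"
  shows "(f has_field_derivative deriv f t) (at t)"
proof -
  obtain D where "(f has_field_derivative D) (at t)"
    using assms holomorphic_extension_deriv by (auto simp: real_analytic_at_iff_holomorphic) blast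
  then show ?thesis by (metis DERIV_imp_deriv)
qed

lemma real_analytic_at_imp_isCont: "real_analytic_at f t \<Longrightarrow> isCont f t"
  by (blast intro: DERIV_isCont real_analytic_at_imp_DERIV)

lemma real_analytic_at_compose:
  assumes "real_analytic_at f (k t)" "real_analytic_at k t"
  shows "real_analytic_at (\<lambda>s. f (k s)) t"
proof -
  obtain r F where r: "r > 0" and hol: "F holomorphic_on ball (complex_of_real (k t)) r"
    and F: "\<And>s. \<bar>s - k t\<bar> < r \<Longrightarrow> F (of_real s) = of_real (f s)"
    using assms(1) by (auto simp: real_analytic_at_iff_holomorphic)
  obtain q K where q: "q > 0" and holK: "K holomorphic_on ball (complex_of_real t) q"
    and K: "\<And>s. \<bar>s - t\<bar> < q \<Longrightarrow> K (of_real s) = of_real (k s)"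
    using assms(2) by (auto simp: real_analytic_at_iff_holomorphic)
  have "isCont K (of_real t)"
    using holK q by (metis centre_in_ball continuous_on_interior holomorphic_on_imp_continuous_on interior_open open_ball)
  then obtain d where d: "d > 0" "\<And>z. dist z (of_real t) < d \<Longrightarrow> dist (K z) (of_real (k t)) < r"
    using r q K[of t] unfolding continuous_at_eps_delta by auto
  define e where "e = min q d"
  have img: "K ` ball (of_real t) e \<subseteq> ball (of_real (k t)) r"
    using d by (auto simp: e_def dist_commute)
  have "(F \<circ> K) holomorphic_on ball (of_real t) e"
    using holK by (intro holomorphic_on_compose_gen[OF _ hol img]) (auto simp: e_def elim: holomorphic_on_subset)
  then show ?thesis
  proof (rule real_analytic_at_Re_holomorphic)
    show "e > 0" using q d by (simp add: e_def)
    fix s assume s: "\<bar>s - t\<bar> < e"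
    then have "complex_of_real s \<in> ball (of_real t) e"
      by (simp add: dist_commute flip: dist_real_def)
    then have "K (of_real s) \<in> ball (of_real (k t)) r" using img by blast
    then have "\<bar>k s - k t\<bar> < r"
      using s K[of s] by (auto simp: e_def dist_commute simp flip: dist_real_def)
    then show "f (k s) = Re ((F \<circ> K) (of_real s))"
      using s K[of s] F[of "k s"] by (simp add: e_def)
  qed
qed

lemma real_analytic_at_identity:
  assumes "real_analytic_at f t" "real_analytic_at g t" "\<exists>\<^sub>F s in at t. f s = g s"
  shows "\<forall>\<^sub>F s in nhds t. f s = g s"
proof -
  obtain r F where r: "r > 0" and hol: "F holomorphic_on ball (complex_of_real t) r"
    and F: "\<And>s. \<bar>s - t\<bar> < r \<Longrightarrow> F (of_real s) = of_real (f s)"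
    using assms(1) by (auto simp: real_analytic_at_iff_holomorphic)
  obtain q K where q: "q > 0" and holK: "K holomorphic_on ball (complex_of_real t) q"
    and K: "\<And>s. \<bar>s - t\<bar> < q \<Longrightarrow> K (of_real s) = of_real (g s)"
    using assms(2) by (auto simp: real_analytic_at_iff_holomorphic)
  define e where "e = min r q"
  have e: "e > 0" using r q by (simp add: e_def)
  define U where "U = complex_of_real ` {s. \<bar>s - t\<bar> < e \<and> f s = g s}"
  have zero: "F z - K z = 0" if "z \<in> ball (of_real t) e" for z
  proof (rule analytic_continuation[of "\<lambda>z. F z - K z" "ball (of_real t) e" U "of_real t"])
    show "(\<lambda>z. F z - K z) holomorphic_on ball (of_real t) e"
      by (intro holomorphic_intros holomorphic_on_subset[OF hol] holomorphic_on_subset[OF holK])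
         (auto simp: e_def)
    show "U \<subseteq> ball (of_real t) e"
      by (auto simp: U_def dist_commute simp flip: dist_real_def)
    show "F z - K z = 0" if "z \<in> U" for z
      using that F K by (auto simp: U_def e_def)
    show "of_real t islimpt U"
      unfolding islimpt_approachable
    proof (intro allI impI)
      fix d :: real assume "d > 0"
      have "eventually (\<lambda>s. s \<noteq> t \<and> \<bar>s - t\<bar> < min d e) (at t)"
        unfolding eventually_at dist_real_def using \<open>d > 0\<close> e by (intro exI[of _ "min d e"]) auto
      then have "\<exists>\<^sub>F s in at t. f s = g s \<and> s \<noteq> t \<and> \<bar>s - t\<bar> < min d e"
        by (intro frequently_rev_mp[OF assms(3)]) (auto elim: eventually_mono)
      then obtain s where "f s = g s" "s \<noteq> t" "\<bar>s - t\<bar> < min d e"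
        by (auto dest: frequently_ex)
      then show "\<exists>z\<in>U. z \<noteq> complex_of_real t \<and> dist z (complex_of_real t) < d"
        by (intro bexI[of _ "of_real s"]) (auto simp: U_def dist_real_def)
    qed
  qed (use that e in auto)
  show ?thesis
    unfolding eventually_nhds_metric dist_real_def
  proof (intro exI[of _ e] conjI allI impI)
    fix s assume s: "\<bar>s - t\<bar> < e"
    then have "complex_of_real s \<in> ball (of_real t) e"
      by (simp add: dist_commute flip: dist_real_def)
    from zero[OF this] F[of s] K[of s] s show "f s = g s" by (simp add: e_def)
  qed (use e in auto)
qed

text \<open>
  Only the left inverse on a neighbourhood of \<open>t\<close> is recorded. It is what is needed to recover the
  parameter of an immersed curve from one of its coordinates.
\<close>

lemma real_analytic_local_inverse:
  assumes "real_analytic_at f t" "deriv f t \<noteq> 0"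
  obtains r k where "r > 0" "\<And>s. \<bar>s - t\<bar> < r \<Longrightarrow> k (f s) = s" "real_analytic_at k (f t)"
proof -
  obtain r F where r: "r > 0" and hol: "F holomorphic_on ball (complex_of_real t) r"
    and F: "\<And>s. \<bar>s - t\<bar> < r \<Longrightarrow> F (of_real s) = of_real (f s)"
    using assms(1) by (auto simp: real_analytic_at_iff_holomorphic)
  have "deriv F (of_real t) \<noteq> 0"
    using holomorphic_extension_deriv[OF r hol F] assms(2) DERIV_imp_deriv by force
  then obtain e where e: "e > 0" "ball (complex_of_real t) e \<subseteq> ball (of_real t) r"
    "inj_on F (ball (of_real t) e)"
    using has_complex_derivative_locally_injective[OF hol, of "of_real t"] r by auto
  have hol': "F holomorphic_on ball (of_real t) e" using hol e(2) by (rule holomorphic_on_subset)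
  obtain K where K: "K holomorphic_on (F ` ball (of_real t) e)"
    "\<And>z. z \<in> ball (of_real t) e \<Longrightarrow> K (F z) = z"
    using holomorphic_has_inverse[OF hol' open_ball e(3)] by metis
  have "open (F ` ball (of_real t) e)"
    using open_mapping_thm3[OF hol' open_ball e(3)] .
  moreover have "of_real (f t) \<in> F ` ball (of_real t) e"
    using F[of t] r e(1) by (intro image_eqI[of _ _ "of_real t"]) auto
  ultimately obtain q where q: "q > 0" "ball (of_real (f t)) q \<subseteq> F ` ball (of_real t) e"
    by (meson open_contains_ball)
  define k where "k u = Re (K (of_real u))" for u
  have "real_analytic_at k (f t)"
    using holomorphic_on_subset[OF K(1) q(2)] q(1)
    by (rule real_analytic_at_Re_holomorphic) (simp add: k_def)
  moreover have "k (f s) = s" if "\<bar>s - t\<bar> < min r e" for s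
  proof -
    have "complex_of_real s \<in> ball (of_real t) e"
      using that by (simp add: dist_commute flip: dist_real_def)
    then have "K (F (of_real s)) = of_real s" by (rule K(2))
    then show ?thesis using F[of s] that by (simp add: k_def)
  qed
  ultimately show thesis using r e(1) by (intro that[of "min r e" k]) auto
qed

text \<open>
  An expansion valid at the diagonal point \<open>a + (\<rho>, \<dots>, \<rho>)\<close> converges absolutely there, and
  its terms dominate those at all points whose coordinates differ from \<open>a\<close> by at most \<open>\<rho>\<close>.
\<close>

section \<open>Power series in several variables along a curve\<close>

lemma real_analytic_on_majorant:
  assumes f: "real_analytic_on n W f" and a: "a \<in> W"
    and diag: "\<And>r. r > 0 \<Longrightarrow> \<exists>\<rho>. 0 < \<rho> \<and> \<rho> < r \<and> (\<lambda>i. if i < n then a i + \<rho> else a i) \<in> W"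
  obtains \<rho> :: real and c where "\<rho> > 0"
    "(\<lambda>\<alpha>. \<bar>c \<alpha>\<bar> * (\<Prod>i<n. \<rho> ^ \<alpha> i)) summable_on {\<alpha>. \<forall>i\<ge>n. \<alpha> i = 0}"
    "\<And>x. x \<in> W \<Longrightarrow> (\<And>i. i < n \<Longrightarrow> \<bar>x i - a i\<bar> \<le> \<rho>) \<Longrightarrow>
        ((\<lambda>\<alpha>. c \<alpha> * (\<Prod>i<n. (x i - a i) ^ \<alpha> i)) has_sum f x) {\<alpha>. \<forall>i\<ge>n. \<alpha> i = 0}"
proof -
  obtain r c where r: "r > 0" and c: "\<And>x. x \<in> W \<Longrightarrow> (\<And>i. i < n \<Longrightarrow> \<bar>x i - a i\<bar> < r) \<Longrightarrow>
        ((\<lambda>\<alpha>. c \<alpha> * (\<Prod>i<n. (x i - a i) ^ \<alpha> i)) has_sum f x) {\<alpha>. \<forall>i\<ge>n. \<alpha> i = 0}"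
    using f a unfolding real_analytic_on_def by blast
  obtain \<rho> where \<rho>: "0 < \<rho>" "\<rho> < r" "(\<lambda>i. if i < n then a i + \<rho> else a i) \<in> W"
    using diag[OF r] by blast
  have "((\<lambda>\<alpha>. c \<alpha> * (\<Prod>i<n. ((if i < n then a i + \<rho> else a i) - a i) ^ \<alpha> i)) has_sum
          f (\<lambda>i. if i < n then a i + \<rho> else a i)) {\<alpha>. \<forall>i\<ge>n. \<alpha> i = 0}"
    by (rule c[OF \<rho>(3)]) (use \<rho> in auto)
  then have "(\<lambda>\<alpha>. c \<alpha> * (\<Prod>i<n. \<rho> ^ \<alpha> i)) summable_on {\<alpha>. \<forall>i\<ge>n. \<alpha> i = 0}"
    by (simp add: summable_on_def) blast
  then have "(\<lambda>\<alpha>. norm (c \<alpha> * (\<Prod>i<n. \<rho> ^ \<alpha> i))) summable_on {\<alpha>. \<forall>i\<ge>n. \<alpha> i = 0}"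
    by (subst (asm) summable_on_iff_abs_summable_on_real)
  then have "(\<lambda>\<alpha>. \<bar>c \<alpha>\<bar> * (\<Prod>i<n. \<rho> ^ \<alpha> i)) summable_on {\<alpha>. \<forall>i\<ge>n. \<alpha> i = 0}"
    using \<rho>(1) by (simp add: abs_mult abs_prod power_abs)
  with \<rho> c show thesis by (intro that[of \<rho> c]) force+
qed

text \<open>
  Substituting holomorphic extensions of the coordinates of \<open>x\<close> into the series gives, by the
  majorant, a uniformly convergent series of holomorphic functions.
\<close>

lemma real_analytic_on_compose_curve:
  assumes f: "real_analytic_on n W f" and W: "\<forall>\<^sub>F s in nhds t. x s \<in> W"
    and x: "\<And>i. i < n \<Longrightarrow> real_analytic_at (\<lambda>s. x s i) t"
    and diag: "\<And>r. r > 0 \<Longrightarrow> \<exists>\<rho>. 0 < \<rho> \<and> \<rho> < r \<and> (\<lambda>i. if i < n then x t i + \<rho> else x t i) \<in> W"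
  shows "real_analytic_at (\<lambda>s. f (x s)) t"
proof -
  define S :: "(nat \<Rightarrow> nat) set" where "S = {\<alpha>. \<forall>i\<ge>n. \<alpha> i = 0}"
  have xt: "x t \<in> W" using W by (rule eventually_nhds_x_imp_x)
  obtain \<rho> :: real and c where \<rho>: "\<rho> > 0"
    and summable: "(\<lambda>\<alpha>. \<bar>c \<alpha>\<bar> * (\<Prod>i<n. \<rho> ^ \<alpha> i)) summable_on S"
    and sum: "\<And>y. y \<in> W \<Longrightarrow> (\<And>i. i < n \<Longrightarrow> \<bar>y i - x t i\<bar> \<le> \<rho>) \<Longrightarrow>
        ((\<lambda>\<alpha>. c \<alpha> * (\<Prod>i<n. (y i - x t i) ^ \<alpha> i)) has_sum f y) S"
    using real_analytic_on_majorant[OF f xt diag] unfolding S_def by blast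
  have "\<exists>q>0. \<exists>F. F holomorphic_on cball (of_real t) q \<and>
      (\<forall>s. \<bar>s - t\<bar> < q \<longrightarrow> F (of_real s) = of_real (x s i)) \<and>
      (\<forall>z\<in>cball (of_real t) q. norm (F z - of_real (x t i)) \<le> \<rho>)" if i: "i < n" for i
  proof -
    obtain q F where q: "q > 0" and hol: "F holomorphic_on ball (complex_of_real t) q"
      and F: "\<And>s. \<bar>s - t\<bar> < q \<Longrightarrow> F (of_real s) = of_real (x s i)"
      using x[OF i] by (auto simp: real_analytic_at_iff_holomorphic)
    have "isCont F (of_real t)"
      using hol q by (metis centre_in_ball continuous_on_interior holomorphic_on_imp_continuous_on interior_open open_ball)
    then obtain d where d: "d > 0" "\<And>z. dist z (of_real t) < d \<Longrightarrow> dist (F z) (of_real (x t i)) < \<rho>"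
      using \<rho> q F[of t] unfolding continuous_at_eps_delta by auto
    show ?thesis
    proof (intro exI[of _ "min q d / 2"] exI[of _ F] conjI ballI)
      show "F holomorphic_on cball (of_real t) (min q d / 2)"
        using hol q by (rule_tac holomorphic_on_subset) auto
      show "norm (F z - of_real (x t i)) \<le> \<rho>" if "z \<in> cball (of_real t) (min q d / 2)" for z
        using d(2)[of z] that q d(1) by (auto simp: dist_commute simp flip: dist_norm)
    qed (use q d F in auto)
  qed
  then obtain q X where q: "\<And>i. i < n \<Longrightarrow> q i > (0::real)"
    and hol: "\<And>i. i < n \<Longrightarrow> X i holomorphic_on cball (of_real t) (q i)"
    and X: "\<And>i s. i < n \<Longrightarrow> \<bar>s - t\<bar> < q i \<Longrightarrow> X i (of_real s) = of_real (x s i)"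
    and Xle: "\<And>i z. i < n \<Longrightarrow> z \<in> cball (of_real t) (q i) \<Longrightarrow> norm (X i z - of_real (x t i)) \<le> \<rho>"
    by metis
  obtain d where d: "d > 0" "\<And>s. \<bar>s - t\<bar> < d \<Longrightarrow> x s \<in> W"
    using W by (auto simp: eventually_nhds_metric dist_real_def)
  define e where "e = Min (insert d (q ` {..<n}))"
  have e: "e > 0" "e \<le> d" "\<And>i. i < n \<Longrightarrow> e \<le> q i"
    using d q by (auto simp: e_def)
  \<comment> \<open>the terms of the series, with the coordinates of the curve extended to complex parameters\<close>
  define T where "T \<alpha> z = of_real (c \<alpha>) * (\<Prod>i<n. (X i z - of_real (x t i)) ^ \<alpha> i)" for \<alpha> z
  have holT: "T \<alpha> holomorphic_on cball (of_real t) e" for \<alpha>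
    unfolding T_def using hol e(3)
    by (intro holomorphic_intros) (metis cball_subset_cball_iff holomorphic_on_subset lessThan_iff subset_cball)+
  have T_le: "norm (T \<alpha> z) \<le> \<bar>c \<alpha>\<bar> * (\<Prod>i<n. \<rho> ^ \<alpha> i)" if "z \<in> cball (of_real t) e" for \<alpha> z
  proof -
    have "norm (X i z - of_real (x t i)) ^ \<alpha> i \<le> \<rho> ^ \<alpha> i" if "i < n" for i
      using Xle[OF that, of z] e(3)[OF that] \<open>z \<in> _\<close> by (intro power_mono) auto
    then show ?thesis
      unfolding T_def norm_mult norm_of_real by (intro mult_left_mono) (auto simp: norm_power simp flip: prod_norm intro!: prod_mono)
  qed
  define H where "H z = (\<Sum>\<^sub>\<infinity>\<alpha>\<in>S. T \<alpha> z)" for z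
  have ulim: "uniform_limit (cball (of_real t) e) (\<lambda>B z. \<Sum>\<alpha>\<in>B. T \<alpha> z) H (finite_subsets_at_top S)"
    unfolding H_def by (rule Weierstrass_m_test_general[OF T_le summable])
  have "H holomorphic_on ball (of_real t) e"
  proof (rule holomorphic_uniform_limit[OF _ ulim])
    show "\<forall>\<^sub>F B in finite_subsets_at_top S.
        continuous_on (cball (of_real t) e) (\<lambda>z. \<Sum>\<alpha>\<in>B. T \<alpha> z) \<and>
        (\<lambda>z. \<Sum>\<alpha>\<in>B. T \<alpha> z) holomorphic_on ball (of_real t) e"
      using holT by (intro always_eventually allI conjI holomorphic_on_imp_continuous_on holomorphic_intros)
         (auto intro: holomorphic_on_subset[OF holT])
  qed auto
  then show ?thesis
  proof (rule real_analytic_at_Re_holomorphic)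
    fix s assume s: "\<bar>s - t\<bar> < e"
    then have sc: "complex_of_real s \<in> cball (of_real t) e"
      by (simp add: dist_commute less_imp_le flip: dist_real_def)
    have le: "\<bar>x s i - x t i\<bar> \<le> \<rho>" if "i < n" for i
    proof -
      have "norm (complex_of_real (x s i) - of_real (x t i)) \<le> \<rho>"
        using Xle[OF that, of "of_real s"] X[OF that, of s] sc s e(3)[OF that] by auto
      then show ?thesis by (simp flip: of_real_diff)
    qed
    have T_eq: "T \<alpha> (of_real s) = of_real (c \<alpha> * (\<Prod>i<n. (x s i - x t i) ^ \<alpha> i))" for \<alpha>
    proof -
      have "X i (of_real s) = of_real (x s i)" if "i < n" for i
        using X[OF that, of s] e(3)[OF that] s by auto
      then show ?thesis by (simp add: T_def)
    qed
    have "((\<lambda>\<alpha>. c \<alpha> * (\<Prod>i<n. (x s i - x t i) ^ \<alpha> i)) has_sum f (x s)) S"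
      using d(2)[of s] s e(2) le by (intro sum) auto
    then have "((\<lambda>\<alpha>. T \<alpha> (of_real s)) has_sum of_real (f (x s))) S"
      unfolding T_eq by (rule has_sum_of_real)
    then show "f (x s) = Re (H (of_real s))"
      by (simp add: H_def infsumI)
  qed (use e in auto)
qed

text \<open>
  This special case of the chain rule avoids partial derivatives: by the majorant,
  \<open>\<bar>f y - f (x t)\<bar>\<close> is at most a constant times the largest \<open>\<bar>y i - x t i\<bar>\<close>, so \<open>f \<circ> x\<close> is
  stationary wherever all coordinates of \<open>x\<close> are. It suffices to see that invertible analytic maps
  preserve immersions.
\<close>

lemma real_analytic_on_compose_curve_deriv_0:
  assumes f: "real_analytic_on n W f" and W: "\<forall>\<^sub>F s in nhds t. x s \<in> W"
    and x: "\<And>i. i < n \<Longrightarrow> ((\<lambda>s. x s i) has_field_derivative 0) (at t)"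
    and diag: "\<And>r. r > 0 \<Longrightarrow> \<exists>\<rho>. 0 < \<rho> \<and> \<rho> < r \<and> (\<lambda>i. if i < n then x t i + \<rho> else x t i) \<in> W"
  shows "((\<lambda>s. f (x s)) has_field_derivative 0) (at t)"
proof -
  define S :: "(nat \<Rightarrow> nat) set" where "S = {\<alpha>. \<forall>i\<ge>n. \<alpha> i = 0}"
  have xt: "x t \<in> W" using W by (rule eventually_nhds_x_imp_x)
  obtain \<rho> :: real and c where \<rho>: "\<rho> > 0"
    and summable: "(\<lambda>\<alpha>. \<bar>c \<alpha>\<bar> * (\<Prod>i<n. \<rho> ^ \<alpha> i)) summable_on S"
    and sum: "\<And>y. y \<in> W \<Longrightarrow> (\<And>i. i < n \<Longrightarrow> \<bar>y i - x t i\<bar> \<le> \<rho>) \<Longrightarrow>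
        ((\<lambda>\<alpha>. c \<alpha> * (\<Prod>i<n. (y i - x t i) ^ \<alpha> i)) has_sum f y) S"
    using real_analytic_on_majorant[OF f xt diag] unfolding S_def by blast
  define C where "C = (\<Sum>\<^sub>\<infinity>\<alpha>\<in>S. \<bar>c \<alpha>\<bar> * (\<Prod>i<n. \<rho> ^ \<alpha> i))"
  have C: "((\<lambda>\<alpha>. \<bar>c \<alpha>\<bar> * (\<Prod>i<n. \<rho> ^ \<alpha> i)) has_sum C) S"
    unfolding C_def using summable by (rule has_sum_infsum)
  have C0: "C \<ge> 0"
    using C by (rule has_sum_nonneg) (use \<rho> in \<open>auto intro!: mult_nonneg_nonneg prod_nonneg\<close>)
  have lip: "\<bar>f y - f (x t)\<bar> \<le> u * C"
    if y: "y \<in> W" and u: "0 \<le> u" "u \<le> 1" "\<And>i. i < n \<Longrightarrow> \<bar>y i - x t i\<bar> \<le> u * \<rho>" for y u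
  proof -
    have u': "u * \<rho> \<le> \<rho>" using u(1,2) \<rho> by (simp add: mult_left_le_one_le)
    have 1: "((\<lambda>\<alpha>. c \<alpha> * (\<Prod>i<n. (y i - x t i) ^ \<alpha> i) - c \<alpha> * (\<Prod>i<n. (x t i - x t i) ^ \<alpha> i))
         has_sum (f y - f (x t))) S"
      unfolding diff_conv_add_uminus[of "c _ * _"] diff_conv_add_uminus[of "f _"]
      by (intro has_sum_add has_sum_uminusI sum y xt order.trans[OF u(3) u']) (use \<rho> in auto)
    have 2: "((\<lambda>\<alpha>. u * (\<bar>c \<alpha>\<bar> * (\<Prod>i<n. \<rho> ^ \<alpha> i))) has_sum u * C) S"
      using C by (rule has_sum_cmult_right)
    have 3: "\<bar>c \<alpha> * (\<Prod>i<n. (y i - x t i) ^ \<alpha> i) - c \<alpha> * (\<Prod>i<n. (x t i - x t i) ^ \<alpha> i)\<bar>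
              \<le> u * (\<bar>c \<alpha>\<bar> * (\<Prod>i<n. \<rho> ^ \<alpha> i))" for \<alpha>
    proof (cases "\<forall>i<n. \<alpha> i = 0")
      case True
      then show ?thesis using u by (simp add: mult_nonneg_nonneg)
    next
      case False
      then obtain j where j: "j < n" "\<alpha> j \<noteq> 0" by blast
      have 0: "(\<Prod>i<n. (x t i - x t i) ^ \<alpha> i) = 0"
        using j by (intro prod_zero) (auto intro!: bexI[of _ j])
      have "\<bar>\<Prod>i<n. (y i - x t i) ^ \<alpha> i\<bar> = (\<Prod>i<n. \<bar>y i - x t i\<bar> ^ \<alpha> i)"
        by (simp add: abs_prod power_abs)
      also have "\<dots> = \<bar>y j - x t j\<bar> ^ \<alpha> j * (\<Prod>i\<in>{..<n} - {j}. \<bar>y i - x t i\<bar> ^ \<alpha> i)"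
        using j by (intro prod.remove) auto
      also have "\<dots> \<le> (u * \<rho> ^ \<alpha> j) * (\<Prod>i\<in>{..<n} - {j}. \<rho> ^ \<alpha> i)"
      proof (intro mult_mono prod_mono conjI)
        have "\<bar>y j - x t j\<bar> ^ \<alpha> j \<le> (u * \<rho>) ^ \<alpha> j"
          using u(3)[OF j(1)] by (intro power_mono) auto
        also have "\<dots> = u ^ \<alpha> j * \<rho> ^ \<alpha> j" by (rule power_mult_distrib)
        also have "\<dots> \<le> u * \<rho> ^ \<alpha> j"
        proof (rule mult_right_mono)
          show "u ^ \<alpha> j \<le> u"
            using j(2) u(1,2) by (cases "\<alpha> j") (auto simp: mult_left_le power_le_one)
        qed (use \<rho> in auto)
        finally show "\<bar>y j - x t j\<bar> ^ \<alpha> j \<le> u * \<rho> ^ \<alpha> j" .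
        show "\<bar>y i - x t i\<bar> ^ \<alpha> i \<le> \<rho> ^ \<alpha> i" if "i \<in> {..<n} - {j}" for i
          using order.trans[OF u(3) u', of i] that by (intro power_mono) auto
      qed (use \<rho> u in \<open>auto intro!: prod_nonneg\<close>)
      also have "\<dots> = u * (\<Prod>i<n. \<rho> ^ \<alpha> i)"
        using j by (subst prod.remove[of _ j]) auto
      finally have "\<bar>c \<alpha>\<bar> * \<bar>\<Prod>i<n. (y i - x t i) ^ \<alpha> i\<bar> \<le> \<bar>c \<alpha>\<bar> * (u * (\<Prod>i<n. \<rho> ^ \<alpha> i))"
        by (rule mult_left_mono) simp
      then show ?thesis unfolding 0 mult_zero_right diff_zero abs_mult by (simp add: mult_ac)
    qed
    have "f y - f (x t) \<le> u * C"
      using 1 2 by (rule has_sum_mono) (use 3 abs_le_D1 in blast)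
    moreover have "- (f y - f (x t)) \<le> u * C"
      using has_sum_uminusI[OF 1] 2 by (rule has_sum_mono) (use 3 abs_le_D2 in blast)
    ultimately show ?thesis by linarith
  qed
  have quot: "((\<lambda>s. (x s i - x t i) / (s - t)) \<longlongrightarrow> 0) (at t)" if "i < n" for i
    using x[OF that] by (simp add: has_field_derivative_iff)
  define u where "u s = (\<Sum>i<n. \<bar>x s i - x t i\<bar>) / \<rho>" for s
  have uq: "((\<lambda>s. u s / \<bar>s - t\<bar>) \<longlongrightarrow> 0) (at t)"
  proof -
    have "((\<lambda>s. (\<Sum>i<n. \<bar>(x s i - x t i) / (s - t)\<bar>) / \<rho>) \<longlongrightarrow> (\<Sum>i<n. \<bar>0\<bar>) / \<rho>) (at t)"
      using \<rho> quot by (intro tendsto_intros) auto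
    then show ?thesis by (simp add: u_def sum_divide_distrib mult.commute)
  qed
  have "(u \<longlongrightarrow> 0) (at t)"
  proof -
    have "((\<lambda>s. u s / \<bar>s - t\<bar> * \<bar>s - t\<bar>) \<longlongrightarrow> 0 * \<bar>t - t\<bar>) (at t)"
      by (intro tendsto_intros uq)
    moreover have "\<forall>\<^sub>F s in at t. u s / \<bar>s - t\<bar> * \<bar>s - t\<bar> = u s"
      by (auto simp: eventually_at_filter)
    ultimately show ?thesis by (simp add: tendsto_cong)
  qed
  then have u1: "\<forall>\<^sub>F s in at t. u s < 1" by (rule order_tendstoD) simp
  have Wat: "\<forall>\<^sub>F s in at t. x s \<in> W"
    using W by (auto simp: eventually_at_filter elim: eventually_mono)
  have bound: "\<forall>\<^sub>F s in at t. norm ((f (x s) - f (x t)) / (s - t)) \<le> u s / \<bar>s - t\<bar> * C"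
    using u1 Wat
  proof eventually_elim
    case (elim s)
    have "\<bar>f (x s) - f (x t)\<bar> \<le> u s * C"
    proof (rule lip[OF elim(2)])
      show "0 \<le> u s" using \<rho> by (auto simp: u_def intro!: divide_nonneg_pos sum_nonneg)
      show "\<bar>x s i - x t i\<bar> \<le> u s * \<rho>" if "i < n" for i
        using \<rho> that by (auto simp: u_def intro!: member_le_sum)
    qed (use elim in auto)
    then show ?case by (simp add: divide_right_mono)
  qed
  have "((\<lambda>s. (f (x s) - f (x t)) / (s - t)) \<longlongrightarrow> 0) (at t)"
    by (rule Lim_null_comparison[OF bound]) (use tendsto_mult_right[OF uq, of C] in \<open>simp add: mult.commute\<close>)
  then show ?thesis by (simp add: has_field_derivative_iff)
qed

section \<open>Charts and analytic immersions\<close>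

lemma chart_openin: "analytic_manifold M \<Longrightarrow> (U, \<psi>) \<in> matlas M \<Longrightarrow> openin (mtop M) U"
  by (auto simp: analytic_manifold_def is_chart_def)

lemma chart_inj_on:
  assumes "analytic_manifold M" "(U, \<psi>) \<in> matlas M"
  shows "inj_on \<psi> U"
proof -
  have "homeomorphic_map (subtopology (mtop M) U) (subtopology (Euclidean_space (mdim M)) (\<psi> ` U)) \<psi>"
    using assms by (auto simp: analytic_manifold_def is_chart_def)
  then have "inj_on \<psi> (topspace (subtopology (mtop M) U))"
    by (simp add: homeomorphic_map_def)
  then show ?thesis
    using openin_subset[OF chart_openin[OF assms]] by (simp add: Int_absorb1)
qed

lemma chart_coordinate_0:
  assumes "analytic_manifold M" "(U, \<psi>) \<in> matlas M" "p \<in> U" "mdim M \<le> i"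
  shows "\<psi> p i = 0"
proof -
  have "openin (Euclidean_space (mdim M)) (\<psi> ` U)"
    using assms by (auto simp: analytic_manifold_def is_chart_def)
  then have "\<psi> ` U \<subseteq> {x. \<forall>i\<ge>mdim M. x i = 0}"
    by (metis openin_subset topspace_Euclidean_space)
  with assms show ?thesis by auto
qed

lemma chart_eqI:
  assumes "analytic_manifold M" "(U, \<psi>) \<in> matlas M" "p \<in> U" "q \<in> U"
    and "\<And>i. i < mdim M \<Longrightarrow> \<psi> p i = \<psi> q i"
  shows "p = q"
proof -
  have "\<psi> p i = \<psi> q i" for i
    using assms chart_coordinate_0[OF assms(1,2)] by (cases "i < mdim M") auto
  then show ?thesis
    using inj_onD[OF chart_inj_on[OF assms(1,2)]] assms(3,4) by blast
qed

lemma chart_coordinate_continuous: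
  assumes "analytic_manifold M" "(U, \<psi>) \<in> matlas M"
  shows "continuous_map (subtopology (mtop M) U) euclideanreal (\<lambda>p. \<psi> p i)"
proof -
  have "homeomorphic_map (subtopology (mtop M) U) (subtopology (Euclidean_space (mdim M)) (\<psi> ` U)) \<psi>"
    using assms by (auto simp: analytic_manifold_def is_chart_def)
  then have "continuous_map (subtopology (mtop M) U) (powertop_real UNIV) \<psi>"
    by (auto dest!: homeomorphic_imp_continuous_map
        simp: Euclidean_space_def continuous_map_in_subtopology)
  then show ?thesis by (simp add: continuous_map_componentwise_UNIV)
qed

text \<open>
  The image of an open set under a chart is open in coordinate space, so it contains a short diagonal
  segment from each of its points. This provides the point at which the majorant is formed.
\<close>

lemma chart_contains_diagonal:
  assumes M: "analytic_manifold M" "(U, \<psi>) \<in> matlas M"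
    and V: "openin (mtop M) V" "V \<subseteq> U" "p \<in> V" and r: "r > 0"
  shows "\<exists>\<rho>. 0 < \<rho> \<and> \<rho> < r \<and>
           (\<lambda>i. if i < mdim M then \<psi> p i + \<rho> else \<psi> p i) \<in> \<psi> ` V"
proof -
  let ?E = "Euclidean_space (mdim M)"
  have hom: "homeomorphic_map (subtopology (mtop M) U) (subtopology ?E (\<psi> ` U)) \<psi>"
    and oU: "openin ?E (\<psi> ` U)"
    using M by (auto simp: analytic_manifold_def is_chart_def)
  have "openin (subtopology (mtop M) U) V"
    using V chart_openin[OF M] by (simp add: openin_open_subtopology)
  then have "openin (subtopology ?E (\<psi> ` U)) (\<psi> ` V)"
    using homeomorphic_imp_open_map[OF hom] by (simp add: open_map_def)
  then have oV: "openin ?E (\<psi> ` V)"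
    using oU by (rule openin_trans_full)
  define c where "c \<rho> = (\<lambda>i. if i < mdim M then \<psi> p i + \<rho> else \<psi> p i)" for \<rho> :: real
  have c0: "\<psi> p i = 0" if "i \<ge> mdim M" for i
    using chart_coordinate_0[OF M _ that] V by blast
  have "continuous_map euclideanreal ?E c"
    unfolding Euclidean_space_def continuous_map_in_subtopology continuous_map_componentwise_UNIV c_def
    by (auto simp: c0 intro!: continuous_intros)
  then have "open {\<rho>. c \<rho> \<in> \<psi> ` V}"
    using openin_continuous_map_preimage[OF _ oV] by fastforce
  moreover have "c 0 \<in> \<psi> ` V"
    using V(3) unfolding c_def by (intro image_eqI[of _ _ p]) auto
  ultimately obtain e where e: "e > 0" "\<And>\<rho>. \<bar>\<rho>\<bar> < e \<Longrightarrow> c \<rho> \<in> \<psi> ` V"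
    unfolding open_dist dist_real_def by (metis (mono_tags, lifting) diff_zero mem_Collect_eq)
  show ?thesis
    using e(2)[of "min e r / 2"] e(1) r by (intro exI[of _ "min e r / 2"]) (auto simp: c_def)
qed

lemma open_immersionD:
  assumes "open_immersion M J \<delta>"
  shows "nondeg_interval J" "open J" "connected J" "continuous_map (top_of_set J) (mtop M) \<delta>"
  using assms unfolding open_immersion_def nondeg_interval_def by simp_all

lemma open_immersion_topspace:
  "open_immersion M J \<delta> \<Longrightarrow> t \<in> J \<Longrightarrow> \<delta> t \<in> topspace (mtop M)"
  by (drule open_immersionD(4)) (auto simp: continuous_map_def)

lemma open_immersion_eventually_in:
  assumes "open_immersion M J \<delta>" "t \<in> J" "openin (mtop M) V" "\<delta> t \<in> V"
  shows "\<forall>\<^sub>F s in nhds t. s \<in> J \<and> \<delta> s \<in> V"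
proof -
  have "continuous_map (top_of_set J) (mtop M) \<delta>" "open J"
    using open_immersionD[OF assms(1)] by auto
  then have "open {s \<in> J. \<delta> s \<in> V}"
    using openin_continuous_map_preimage[OF _ assms(3)] by (fastforce simp: openin_open_eq)
  then show ?thesis
    using assms(2,4) by (auto dest: eventually_nhds_in_open)
qed

lemma open_immersion_chart:
  assumes "analytic_manifold M" "open_immersion M J \<delta>" "t \<in> J"
  obtains U \<psi> where "(U, \<psi>) \<in> matlas M" "\<delta> t \<in> U"
  using assms open_immersion_topspace[OF assms(2,3)] unfolding analytic_manifold_def by blast

lemma open_immersionI:
  assumes "nondeg_interval J" "open J" "continuous_map (top_of_set J) (mtop M) \<delta>"
    and co: "\<And>t U \<psi>. t \<in> J \<Longrightarrow> (U, \<psi>) \<in> matlas M \<Longrightarrow> \<delta> t \<in> U \<Longrightarrow>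
      (\<forall>i < mdim M. real_analytic_at (\<lambda>s. \<psi> (\<delta> s) i) t) \<and>
      (\<exists>i < mdim M. deriv (\<lambda>s. \<psi> (\<delta> s) i) t \<noteq> 0)"
  shows "open_immersion M J \<delta>"
  unfolding open_immersion_def
proof (intro conjI ballI)
  fix t C assume "t \<in> J" "C \<in> matlas M"
  then show "case C of (U, \<psi>) \<Rightarrow> \<delta> t \<in> U \<longrightarrow>
      (\<forall>i < mdim M. real_analytic_at (\<lambda>s. \<psi> (\<delta> s) i) t) \<and>
      (\<exists>i < mdim M. deriv (\<lambda>s. \<psi> (\<delta> s) i) t \<noteq> 0)"
    using co[of t "fst C" "snd C"] by (simp add: case_prod_beta)
qed (fact assms)+

lemma open_immersion_coordinates:
  assumes "open_immersion M J \<delta>" "t \<in> J" "(U, \<psi>) \<in> matlas M" "\<delta> t \<in> U"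
  shows "i < mdim M \<Longrightarrow> real_analytic_at (\<lambda>s. \<psi> (\<delta> s) i) t"
    and "\<exists>i < mdim M. deriv (\<lambda>s. \<psi> (\<delta> s) i) t \<noteq> 0"
proof -
  have "\<forall>C\<in>matlas M. case C of (U, \<psi>) \<Rightarrow> \<delta> t \<in> U \<longrightarrow>
      (\<forall>i < mdim M. real_analytic_at (\<lambda>s. \<psi> (\<delta> s) i) t) \<and>
      (\<exists>i < mdim M. deriv (\<lambda>s. \<psi> (\<delta> s) i) t \<noteq> 0)"
    using assms(1,2) by (simp add: open_immersion_def)
  from bspec[OF this assms(3)] assms(4)
  show "i < mdim M \<Longrightarrow> real_analytic_at (\<lambda>s. \<psi> (\<delta> s) i) t"
    and "\<exists>i < mdim M. deriv (\<lambda>s. \<psi> (\<delta> s) i) t \<noteq> 0"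
    by simp_all
qed

lemma open_immersion_subset:
  assumes \<delta>: "open_immersion M J \<delta>" and K: "K \<subseteq> J" "open K" "nondeg_interval K"
  shows "open_immersion M K \<delta>"
proof -
  have "continuous_map (top_of_set K) (mtop M) \<delta>"
    using continuous_map_from_subtopology_mono[OF open_immersionD(4)[OF \<delta>] K(1)] .
  then show ?thesis
    using K open_immersion_coordinates[OF \<delta> subsetD[OF K(1)]] by (intro open_immersionI) auto
qed

lemma open_immersion_cong:
  assumes \<delta>: "open_immersion M J \<delta>" and eq: "\<And>t. t \<in> J \<Longrightarrow> \<delta> t = \<gamma> t"
  shows "open_immersion M J \<gamma>"
proof -
  have J: "open J" "nondeg_interval J" using open_immersionD[OF \<delta>] by auto
  have ev: "\<forall>\<^sub>F s in nhds t. \<psi> (\<delta> s) i = \<psi> (\<gamma> s) i" if "t \<in> J" for t i and \<psi> :: "'a \<Rightarrow> nat \<Rightarrow> real"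
    using eventually_nhds_in_open[OF J(1) that] by eventually_elim (simp add: eq)
  have "continuous_map (top_of_set J) (mtop M) \<gamma>"
    using open_immersionD(4)[OF \<delta>] eq by (auto intro: continuous_map_eq)
  moreover have "(\<forall>i < mdim M. real_analytic_at (\<lambda>s. \<psi> (\<gamma> s) i) t) \<and>
      (\<exists>i < mdim M. deriv (\<lambda>s. \<psi> (\<gamma> s) i) t \<noteq> 0)"
    if "t \<in> J" "(U, \<psi>) \<in> matlas M" "\<gamma> t \<in> U" for t U \<psi>
  proof -
    have "(\<forall>i < mdim M. real_analytic_at (\<lambda>s. \<psi> (\<delta> s) i) t) \<and>
      (\<exists>i < mdim M. deriv (\<lambda>s. \<psi> (\<delta> s) i) t \<noteq> 0)"
      using open_immersion_coordinates[OF \<delta> that(1,2)] that(3) eq[OF that(1)] by auto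
    then show ?thesis
      using real_analytic_at_cong[OF ev[OF that(1)]] deriv_cong_ev[OF ev[OF that(1)] refl] by metis
  qed
  ultimately show ?thesis
    using J by (intro open_immersionI)
qed

lemma analytic_immersion_open:
  assumes "analytic_immersion M J \<gamma>" "open J"
  shows "open_immersion M J \<gamma>"
proof -
  obtain K \<delta> where "J \<subseteq> K" "open_immersion M K \<delta>" "\<And>t. t \<in> J \<Longrightarrow> \<gamma> t = \<delta> t" "nondeg_interval J"
    using assms by (auto simp: analytic_immersion_def)
  then show ?thesis
    by (metis assms(2) open_immersion_cong open_immersion_subset)
qed

lemma analytic_map_curve_coordinates:
  assumes M: "analytic_manifold M" and f: "analytic_map M M f"
    and U: "(U, \<psi>) \<in> matlas M" and V: "(V, \<eta>) \<in> matlas M"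
    and ev: "\<forall>\<^sub>F s in nhds t. \<delta> s \<in> U \<and> f (\<delta> s) \<in> V" and j: "j < mdim M"
  shows "(\<And>i. i < mdim M \<Longrightarrow> real_analytic_at (\<lambda>s. \<psi> (\<delta> s) i) t) \<Longrightarrow>
           real_analytic_at (\<lambda>s. \<eta> (f (\<delta> s)) j) t"
    and "(\<And>i. i < mdim M \<Longrightarrow> ((\<lambda>s. \<psi> (\<delta> s) i) has_field_derivative 0) (at t)) \<Longrightarrow>
           ((\<lambda>s. \<eta> (f (\<delta> s)) j) has_field_derivative 0) (at t)"
proof -
  define V' where "V' = {p \<in> U. f p \<in> V}"
  define F where "F y = \<eta> (f (inv_into U \<psi> y)) j" for y
  have F: "real_analytic_on (mdim M) (\<psi> ` V') F"
    using f U V j unfolding analytic_map_def V'_def F_def by fast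
  have "V' = {p \<in> topspace (mtop M). f p \<in> V} \<inter> U"
    using openin_subset[OF chart_openin[OF M U]] by (auto simp: V'_def)
  then have oV': "openin (mtop M) V'"
    using f chart_openin[OF M U] chart_openin[OF M V]
    by (auto simp: analytic_map_def intro: openin_continuous_map_preimage)
  have tV': "\<delta> t \<in> V'"
    using eventually_nhds_x_imp_x[OF ev] by (simp add: V'_def)
  have diag: "\<exists>\<rho>. 0 < \<rho> \<and> \<rho> < r \<and>
           (\<lambda>i. if i < mdim M then \<psi> (\<delta> t) i + \<rho> else \<psi> (\<delta> t) i) \<in> \<psi> ` V'" if "r > 0" for r
    by (rule chart_contains_diagonal[OF M U oV' _ tV' that]) (auto simp: V'_def)
  have W: "\<forall>\<^sub>F s in nhds t. \<psi> (\<delta> s) \<in> \<psi> ` V'"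
    using ev by eventually_elim (auto simp: V'_def)
  have eq: "\<forall>\<^sub>F s in nhds t. F (\<psi> (\<delta> s)) = \<eta> (f (\<delta> s)) j"
    using ev by eventually_elim (simp add: F_def inv_into_f_f[OF chart_inj_on[OF M U]])
  show "real_analytic_at (\<lambda>s. \<eta> (f (\<delta> s)) j) t"
    if "\<And>i. i < mdim M \<Longrightarrow> real_analytic_at (\<lambda>s. \<psi> (\<delta> s) i) t"
    using real_analytic_on_compose_curve[OF F W that diag] real_analytic_at_cong[OF eq] by simp
  show "((\<lambda>s. \<eta> (f (\<delta> s)) j) has_field_derivative 0) (at t)"
    if "\<And>i. i < mdim M \<Longrightarrow> ((\<lambda>s. \<psi> (\<delta> s) i) has_field_derivative 0) (at t)"
    using real_analytic_on_compose_curve_deriv_0[OF F W that diag] DERIV_cong_ev[OF refl eq refl] by simp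
qed

text \<open>
  If all coordinates of \<open>f \<circ> \<delta>\<close> were stationary at some parameter, those of
  \<open>f' \<circ> (f \<circ> \<delta>) = \<delta>\<close> would be as well.
\<close>

lemma open_immersion_compose:
  assumes M: "analytic_manifold M" and f: "analytic_map M M f" "analytic_map M M f'"
    and retract: "\<And>p. p \<in> topspace (mtop M) \<Longrightarrow> f' (f p) = p"
    and \<delta>: "open_immersion M J \<delta>"
  shows "open_immersion M J (f \<circ> \<delta>)"
proof -
  have J: "open J" "nondeg_interval J" and cont: "continuous_map (top_of_set J) (mtop M) \<delta>"
    using open_immersionD[OF \<delta>] by auto
  have cont': "continuous_map (top_of_set J) (mtop M) (f \<circ> \<delta>)"
    using cont f(1) by (auto simp: analytic_map_def intro: continuous_map_compose)
  have "(\<forall>i < mdim M. real_analytic_at (\<lambda>s. \<eta> ((f \<circ> \<delta>) s) i) t) \<and>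
      (\<exists>i < mdim M. deriv (\<lambda>s. \<eta> ((f \<circ> \<delta>) s) i) t \<noteq> 0)"
    if t: "t \<in> J" and V: "(V, \<eta>) \<in> matlas M" "(f \<circ> \<delta>) t \<in> V" for t V \<eta>
  proof -
    obtain U \<psi> where U: "(U, \<psi>) \<in> matlas M" "\<delta> t \<in> U"
      using open_immersion_chart[OF M \<delta> t] .
    have an: "\<And>i. i < mdim M \<Longrightarrow> real_analytic_at (\<lambda>s. \<psi> (\<delta> s) i) t"
      and ne: "\<exists>i < mdim M. deriv (\<lambda>s. \<psi> (\<delta> s) i) t \<noteq> 0"
      using open_immersion_coordinates[OF \<delta> t U] by blast+
    have "{s \<in> J. (f \<circ> \<delta>) s \<in> V} = {s \<in> topspace (top_of_set J). (f \<circ> \<delta>) s \<in> V}" by simp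
    then have "open {s \<in> J. (f \<circ> \<delta>) s \<in> V}"
      using openin_continuous_map_preimage[OF cont' chart_openin[OF M V(1)]] J(1)
      by (simp add: openin_open_eq)
    then have "\<forall>\<^sub>F s in nhds t. s \<in> J \<and> f (\<delta> s) \<in> V"
      using t V(2) by (auto dest: eventually_nhds_in_open)
    then have ev: "\<forall>\<^sub>F s in nhds t. \<delta> s \<in> U \<and> f (\<delta> s) \<in> V"
      using open_immersion_eventually_in[OF \<delta> t chart_openin[OF M U(1)] U(2)] by eventually_elim simp
    have an': "real_analytic_at (\<lambda>s. \<eta> (f (\<delta> s)) j) t" if "j < mdim M" for j
      by (rule analytic_map_curve_coordinates(1)[OF M f(1) U(1) V(1) ev that an])
    have "\<exists>j < mdim M. deriv (\<lambda>s. \<eta> (f (\<delta> s)) j) t \<noteq> 0"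
    proof (rule ccontr)
      assume "\<not> ?thesis"
      then have D0: "((\<lambda>s. \<eta> (f (\<delta> s)) j) has_field_derivative 0) (at t)" if "j < mdim M" for j
        using real_analytic_at_imp_DERIV[OF an'[OF that]] that by auto
      have "\<forall>\<^sub>F s in nhds t. s \<in> J"
        using J(1) t by (rule eventually_nhds_in_open)
      then have f'f: "\<forall>\<^sub>F s in nhds t. f' (f (\<delta> s)) = \<delta> s"
        by eventually_elim (simp add: retract open_immersion_topspace[OF \<delta>])
      then have "\<forall>\<^sub>F s in nhds t. f (\<delta> s) \<in> V \<and> f' (f (\<delta> s)) \<in> U"
        using ev by eventually_elim simp
      then have "((\<lambda>s. \<psi> (f' (f (\<delta> s))) i) has_field_derivative 0) (at t)" if "i < mdim M" for i
        by (rule analytic_map_curve_coordinates(2)[OF M f(2) V(1) U(1) _ that D0])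
      moreover have "\<forall>\<^sub>F s in nhds t. \<psi> (f' (f (\<delta> s))) i = \<psi> (\<delta> s) i" for i
        using f'f by eventually_elim simp
      ultimately have "((\<lambda>s. \<psi> (\<delta> s) i) has_field_derivative 0) (at t)" if "i < mdim M" for i
        using DERIV_cong_ev[of t t "\<lambda>s. \<psi> (f' (f (\<delta> s))) i" "\<lambda>s. \<psi> (\<delta> s) i" 0 0] that by auto
      then show False using ne DERIV_imp_deriv by blast
    qed
    with an' show ?thesis by (simp add: o_def)
  qed
  then show ?thesis
    using J cont' by (intro open_immersionI)
qed

text \<open>
  A coordinate with non-zero derivative has an analytic local inverse \<open>k\<close>, so the parameter is an
  analytic function of the position on the curve. Local injectivity, local embeddings and the
  comparison of overlapping curves all come from this.
\<close>

lemma open_immersion_local_parameter: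
  assumes M: "analytic_manifold M" and \<delta>: "open_immersion M J \<delta>" and t: "t \<in> J"
    and U: "(U, \<psi>) \<in> matlas M" "\<delta> t \<in> U"
  obtains i k r where "i < mdim M" "r > 0" "real_analytic_at k (\<psi> (\<delta> t) i)"
    "\<And>s. \<bar>s - t\<bar> < r \<Longrightarrow> s \<in> J \<and> \<delta> s \<in> U \<and> k (\<psi> (\<delta> s) i) = s"
proof -
  obtain i where i: "i < mdim M" "deriv (\<lambda>s. \<psi> (\<delta> s) i) t \<noteq> 0"
    and an: "real_analytic_at (\<lambda>s. \<psi> (\<delta> s) i) t"
    using open_immersion_coordinates[OF \<delta> t U] by blast
  obtain r k where r: "r > 0" "\<And>s. \<bar>s - t\<bar> < r \<Longrightarrow> k (\<psi> (\<delta> s) i) = s"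
    and k: "real_analytic_at k (\<psi> (\<delta> t) i)"
    using real_analytic_local_inverse[OF an i(2)] by metis
  obtain d where "d > 0" "\<And>s. \<bar>s - t\<bar> < d \<Longrightarrow> s \<in> J \<and> \<delta> s \<in> U"
    using open_immersion_eventually_in[OF \<delta> t chart_openin[OF M U(1)] U(2)]
    by (auto simp: eventually_nhds_metric dist_real_def)
  with i r k show thesis by (intro that[of i "min d r" k]) auto
qed

lemma open_immersion_locally_inj:
  assumes M: "analytic_manifold M" and \<delta>: "open_immersion M J \<delta>" and t: "t \<in> J"
  shows "\<exists>r>0. {t - r<..<t + r} \<subseteq> J \<and> inj_on \<delta> {t - r<..<t + r}"
proof -
  obtain U \<psi> where U: "(U, \<psi>) \<in> matlas M" "\<delta> t \<in> U"
    using open_immersion_chart[OF M \<delta> t] .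
  obtain i k r where "r > 0" and k: "\<And>s. \<bar>s - t\<bar> < r \<Longrightarrow> s \<in> J \<and> \<delta> s \<in> U \<and> k (\<psi> (\<delta> s) i) = s"
    using open_immersion_local_parameter[OF M \<delta> t U] by metis
  moreover have "\<bar>s - t\<bar> < r" if "s \<in> {t - r<..<t + r}" for s using that by auto
  ultimately show ?thesis
    by (intro exI[of _ r]) (metis (mono_tags, lifting) inj_onI subsetI)
qed

lemma open_immersion_locally_embedding:
  assumes M: "analytic_manifold M" and \<delta>: "open_immersion M J \<delta>" and t: "t \<in> J"
  shows "\<exists>r>0. \<forall>K. open K \<longrightarrow> nondeg_interval K \<longrightarrow> K \<subseteq> {t - r<..<t + r} \<longrightarrow> analytic_embedding M K \<delta>"
proof -
  obtain U \<psi> where U: "(U, \<psi>) \<in> matlas M" "\<delta> t \<in> U"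
    using open_immersion_chart[OF M \<delta> t] .
  obtain i k r where i: "i < mdim M" and r: "r > 0" and an: "real_analytic_at k (\<psi> (\<delta> t) i)"
    and k: "\<And>s. \<bar>s - t\<bar> < r \<Longrightarrow> s \<in> J \<and> \<delta> s \<in> U \<and> k (\<psi> (\<delta> s) i) = s"
    using open_immersion_local_parameter[OF M \<delta> t U] by metis
  obtain e where e: "e > 0" "\<And>u. \<bar>u - \<psi> (\<delta> t) i\<bar> < e \<Longrightarrow> isCont k u"
    using real_analytic_at_imp_eventually[OF an] real_analytic_at_imp_isCont by metis
  have "isCont (\<lambda>s. \<psi> (\<delta> s) i) t"
    using open_immersion_coordinates(1)[OF \<delta> t U i] by (rule real_analytic_at_imp_isCont)
  then obtain d where d: "d > 0" "\<And>s. \<bar>s - t\<bar> < d \<Longrightarrow> \<bar>\<psi> (\<delta> s) i - \<psi> (\<delta> t) i\<bar> < e"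
    using e(1) unfolding continuous_at_eps_delta dist_real_def by metis
  define q where "q = min r d"
  have "analytic_embedding M K \<delta>" if K: "open K" "nondeg_interval K" "K \<subseteq> {t - q<..<t + q}" for K
  proof -
    have Kq: "\<bar>s - t\<bar> < r" "\<bar>s - t\<bar> < d" if "s \<in> K" for s
      using K(3) that by (auto simp: q_def subset_iff)
    have KJ: "K \<subseteq> J" using k Kq by blast
    have imm: "open_immersion M K \<delta>"
      using open_immersion_subset[OF \<delta> KJ K(1,2)] .
    have KU: "\<delta> ` K \<subseteq> U" using k Kq by blast
    let ?S = "subtopology (mtop M) (\<delta> ` K)"
    let ?B = "{u. \<bar>u - \<psi> (\<delta> t) i\<bar> < e}"
    have "continuous_map ?S (top_of_set ?B) (\<lambda>p. \<psi> p i)"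
      using continuous_map_from_subtopology_mono[OF chart_coordinate_continuous[OF M U(1)] KU] d Kq
      by (intro continuous_map_into_subtopology) auto
    moreover have "continuous_map (top_of_set ?B) euclideanreal k"
      using e(2) by (auto intro: continuous_at_imp_continuous_on)
    ultimately have "continuous_map ?S euclideanreal (k \<circ> (\<lambda>p. \<psi> p i))"
      by (rule continuous_map_compose)
    then have c: "continuous_map ?S (top_of_set K) (k \<circ> (\<lambda>p. \<psi> p i))"
      using k Kq by (intro continuous_map_into_subtopology) auto
    have "continuous_map (top_of_set K) ?S \<delta>"
      using open_immersionD(4)[OF imm] by (intro continuous_map_into_subtopology) auto
    then have "homeomorphic_maps (top_of_set K) ?S \<delta> (k \<circ> (\<lambda>p. \<psi> p i))"
      unfolding homeomorphic_maps_def using c k Kq by auto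
    then have "embedding_map (top_of_set K) (mtop M) \<delta>"
      unfolding embedding_map_def by (auto simp: homeomorphic_map_maps)
    then show ?thesis
      unfolding analytic_embedding_def using imm K(2) by blast
  qed
  moreover have "q > 0" using r d by (simp add: q_def)
  ultimately show ?thesis by blast
qed

text \<open>
  The map \<open>\<nu>\<close> is \<open>\<delta>\<close> followed by the inverse of the embedding \<open>\<gamma>\<close>.
\<close>

lemma analytic_embedding_match:
  assumes \<delta>: "analytic_embedding M K \<delta>" and \<gamma>: "analytic_embedding M K' \<gamma>"
    and K: "open K" and im: "\<delta> ` K = \<gamma> ` K'"
  obtains \<nu> where "continuous_on K \<nu>" "inj_on \<nu> K" "\<nu> ` K \<subseteq> K'" "\<And>x. x \<in> K \<Longrightarrow> \<delta> x = \<gamma> (\<nu> x)"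
proof -
  have emb: "embedding_map (top_of_set K) (mtop M) \<delta>" if "analytic_embedding M K \<delta>" for K \<delta>
  proof -
    obtain J \<delta>' where J: "K \<subseteq> J" "embedding_map (top_of_set J) (mtop M) \<delta>'" "\<And>t. t \<in> K \<Longrightarrow> \<delta> t = \<delta>' t"
      using \<open>analytic_embedding M K \<delta>\<close> unfolding analytic_embedding_def by blast
    obtain k where k: "homeomorphic_maps (top_of_set J) (subtopology (mtop M) (\<delta>' ` J)) \<delta>' k"
      using J(2) by (auto simp: embedding_map_def homeomorphic_map_maps)
    have "continuous_map (top_of_set K) (subtopology (mtop M) (\<delta>' ` K)) \<delta>'"
      using k J(1) continuous_map_from_subtopology_mono[OF _ J(1)]
      by (auto simp: homeomorphic_maps_def continuous_map_in_subtopology)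
    moreover have "continuous_map (subtopology (mtop M) (\<delta>' ` K)) (top_of_set K) k"
      using k J(1) continuous_map_from_subtopology_mono[OF _ image_mono[OF J(1)], of "mtop M" \<delta>' _ k]
      by (auto simp: homeomorphic_maps_def continuous_map_in_subtopology)
    ultimately have "homeomorphic_maps (top_of_set K) (subtopology (mtop M) (\<delta>' ` K)) \<delta>' k"
      using k J(1) by (auto simp: homeomorphic_maps_def)
    then have "embedding_map (top_of_set K) (mtop M) \<delta>'"
      by (auto simp: embedding_map_def homeomorphic_map_maps)
    then show ?thesis
      by (rule embedding_map_eq) (simp add: J(3))
  qed
  have \<delta>i: "inj_on \<delta> K" and \<delta>c: "continuous_map (top_of_set K) (mtop M) \<delta>"
    using emb[OF \<delta>] unfolding embedding_map_def homeomorphic_eq_everything_map continuous_map_in_subtopology by auto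
  obtain k where k: "homeomorphic_maps (top_of_set K') (subtopology (mtop M) (\<gamma> ` K')) \<gamma> k"
    using emb[OF \<gamma>] unfolding embedding_map_def by (auto simp: homeomorphic_map_maps)
  have "continuous_map (top_of_set K) (subtopology (mtop M) (\<gamma> ` K')) \<delta>"
    using \<delta>c im by (intro continuous_map_into_subtopology) auto
  then have "continuous_map (top_of_set K) (top_of_set K') (k \<circ> \<delta>)"
    using k unfolding homeomorphic_maps_def by (blast intro: continuous_map_compose)
  then have c: "continuous_on K (k \<circ> \<delta>)" "(k \<circ> \<delta>) ` K \<subseteq> K'" by auto
  have k1: "k (\<gamma> y) = y" if "y \<in> K'" for y using k that by (simp add: homeomorphic_maps_def)
  have eq: "\<delta> x = \<gamma> ((k \<circ> \<delta>) x)" if x: "x \<in> K" for x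
  proof -
    obtain y where "y \<in> K'" "\<delta> x = \<gamma> y" using im x by blast
    then show ?thesis using k1 by simp
  qed
  moreover have "inj_on (k \<circ> \<delta>) K"
    using eq \<delta>i by (metis inj_on_def)
  ultimately show thesis using c that by blast
qed

text \<open>
  The Hausdorff property gives \<open>\<delta> t = \<gamma> t\<close>, so one chart contains both curves near \<open>t\<close>, and the
  identity theorem applies to each coordinate.
\<close>

lemma open_immersion_identity_local:
  assumes M: "analytic_manifold M" and \<delta>: "open_immersion M J \<delta>" and \<gamma>: "open_immersion M J \<gamma>"
    and t: "t \<in> J" and freq: "\<exists>\<^sub>F s in at t. \<delta> s = \<gamma> s"
  shows "\<forall>\<^sub>F s in nhds t. \<delta> s = \<gamma> s"
proof -
  have eqt: "\<delta> t = \<gamma> t"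
  proof (rule ccontr)
    assume "\<delta> t \<noteq> \<gamma> t"
    then obtain V W where VW: "openin (mtop M) V" "openin (mtop M) W" "\<delta> t \<in> V" "\<gamma> t \<in> W" "disjnt V W"
      using M open_immersion_topspace[OF \<delta> t] open_immersion_topspace[OF \<gamma> t]
      unfolding analytic_manifold_def Hausdorff_space_def by metis
    have "\<forall>\<^sub>F s in nhds t. \<delta> s \<noteq> \<gamma> s"
      using open_immersion_eventually_in[OF \<delta> t VW(1,3)] open_immersion_eventually_in[OF \<gamma> t VW(2,4)]
      by eventually_elim (use VW(5) in \<open>auto simp: disjnt_iff\<close>)
    then have "\<forall>\<^sub>F s in at t. \<delta> s \<noteq> \<gamma> s"
      by (auto simp: eventually_at_filter elim: eventually_mono)
    with freq show False by (simp add: frequently_def)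
  qed
  obtain U \<psi> where U: "(U, \<psi>) \<in> matlas M" "\<delta> t \<in> U"
    using open_immersion_chart[OF M \<delta> t] .
  have "\<forall>\<^sub>F s in nhds t. \<psi> (\<delta> s) i = \<psi> (\<gamma> s) i" if "i < mdim M" for i
  proof (rule real_analytic_at_identity)
    show "real_analytic_at (\<lambda>s. \<psi> (\<delta> s) i) t" "real_analytic_at (\<lambda>s. \<psi> (\<gamma> s) i) t"
      using open_immersion_coordinates(1)[OF \<delta> t U that]
        open_immersion_coordinates(1)[OF \<gamma> t U(1) _ that] U(2) eqt by auto
    show "\<exists>\<^sub>F s in at t. \<psi> (\<delta> s) i = \<psi> (\<gamma> s) i"
      using freq by (rule frequently_elim1) simp
  qed
  then have "\<forall>\<^sub>F s in nhds t. \<forall>i<mdim M. \<psi> (\<delta> s) i = \<psi> (\<gamma> s) i"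
    using eventually_ball_finite[of "{..<mdim M}" "\<lambda>s i. \<psi> (\<delta> s) i = \<psi> (\<gamma> s) i" "nhds t"] by (simp add: Ball_def)
  then show ?thesis
    using open_immersion_eventually_in[OF \<delta> t chart_openin[OF M U(1)] U(2)]
      open_immersion_eventually_in[OF \<gamma> t chart_openin[OF M U(1)] U(2)[unfolded eqt]]
    by eventually_elim (auto intro: chart_eqI[OF M U(1)])
qed

text \<open>
  The parameters near which the curves agree, and those with a punctured neighbourhood on which they
  always differ, form two disjoint open sets that cover \<open>J\<close>.
\<close>

lemma open_immersion_identity:
  assumes M: "analytic_manifold M" and \<delta>: "open_immersion M J \<delta>" and \<gamma>: "open_immersion M J \<gamma>"
    and t: "t \<in> J" and freq: "\<exists>\<^sub>F s in at t. \<delta> s = \<gamma> s" and s: "s \<in> J"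
  shows "\<delta> s = \<gamma> s"
proof -
  have J: "open J" "connected J"
    using open_immersionD[OF \<delta>] by auto
  define S where "S = {x \<in> J. \<forall>\<^sub>F y in nhds x. \<delta> y = \<gamma> y}"
  define T where "T = {x \<in> J. \<forall>\<^sub>F y in at x. \<delta> y \<noteq> \<gamma> y}"
  have "open S"
    unfolding open_subopen[of S]
  proof
    fix x assume x: "x \<in> S"
    then obtain V where "open V" "x \<in> V" "\<And>y. y \<in> V \<Longrightarrow> \<delta> y = \<gamma> y"
      by (auto simp: S_def eventually_nhds)
    then show "\<exists>V. open V \<and> x \<in> V \<and> V \<subseteq> S"
      using x J(1) by (intro exI[of _ "V \<inter> J"]) (auto simp: S_def eventually_nhds)
  qed
  moreover have "open T"
    unfolding open_subopen[of T]
  proof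
    fix x assume x: "x \<in> T"
    then obtain V where V: "open V" "x \<in> V" "\<And>y. y \<in> V \<Longrightarrow> y \<noteq> x \<Longrightarrow> \<delta> y \<noteq> \<gamma> y"
      by (auto simp: T_def eventually_at_filter eventually_nhds)
    have "V \<inter> J \<subseteq> T"
    proof
      fix z assume z: "z \<in> V \<inter> J"
      have "\<forall>\<^sub>F y in at z. \<delta> y \<noteq> \<gamma> y"
      proof (cases "z = x")
        case False
        then have "open (V - {x})" "z \<in> V - {x}" using V z by auto
        then have "\<forall>\<^sub>F y in nhds z. y \<in> V - {x}" by (rule eventually_nhds_in_open)
        then show ?thesis using V(3) by (auto simp: eventually_at_filter elim: eventually_mono)
      qed (use x in \<open>simp add: T_def\<close>)
      with z show "z \<in> T" by (simp add: T_def)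
    qed
    then show "\<exists>V. open V \<and> x \<in> V \<and> V \<subseteq> T"
      using V x J(1) by (intro exI[of _ "V \<inter> J"]) (auto simp: T_def)
  qed
  moreover have "J \<subseteq> S \<union> T"
    using open_immersion_identity_local[OF M \<delta> \<gamma>] by (auto simp: S_def T_def frequently_def)
  moreover have "S \<inter> T \<inter> J = {}"
  proof -
    have False if "x \<in> S" "x \<in> T" for x
    proof -
      have "\<forall>\<^sub>F y in at x. \<delta> y = \<gamma> y" "\<forall>\<^sub>F y in at x. \<delta> y \<noteq> \<gamma> y"
        using that by (auto simp: S_def T_def eventually_at_filter elim: eventually_mono)
      then have "\<forall>\<^sub>F y in at x. False" by eventually_elim simp
      then show False by simp
    qed
    then show ?thesis by blast
  qed
  moreover have "t \<in> S"
    using t open_immersion_identity_local[OF M \<delta> \<gamma> t freq] by (simp add: S_def)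
  ultimately have "T \<inter> J = {}"
    using connectedD[OF J(2), of S T] t by blast
  with \<open>J \<subseteq> S \<union> T\<close> s show ?thesis
    by (auto simp: S_def dest: eventually_nhds_x_imp_x)
qed

text \<open>
  Only continuity and strict monotonicity of the change of parameter are recorded: this is enough for
  all later arguments and is easily preserved by composition and inversion. The sign \<open>\<sigma>\<close> tells
  whether \<open>\<nu>\<close> is increasing or decreasing.
\<close>

section \<open>Overlapping analytic curves\<close>

definition germ_match ::
    "real set \<Rightarrow> (real \<Rightarrow> 'm) \<Rightarrow> (real \<Rightarrow> 'm) \<Rightarrow> real \<Rightarrow> real \<Rightarrow> real \<Rightarrow> bool"
  where "germ_match J \<delta> \<gamma> s t \<sigma> \<longleftrightarrow>
    (\<exists>U \<nu>. open U \<and> s \<in> U \<and> U \<subseteq> J \<and> \<nu> ` U \<subseteq> J \<and> continuous_on U \<nu> \<and>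
       strict_mono_on U (\<lambda>x. \<sigma> * \<nu> x) \<and> \<nu> s = t \<and> (\<forall>x\<in>U. \<delta> x = \<gamma> (\<nu> x)))"

lemma inj_on_interval_sign:
  fixes \<nu> :: "real \<Rightarrow> real"
  assumes "connected U" "continuous_on U \<nu>" "inj_on \<nu> U"
  shows "\<exists>\<sigma>\<in>{1, -1}. strict_mono_on U (\<lambda>x. \<sigma> * \<nu> x)"
proof -
  have "strict_mono_on U \<nu> \<or> strict_antimono_on U \<nu>"
    using assms by (simp add: injective_eq_monotone_map is_interval_connected_1)
  then show ?thesis
    by (auto simp: monotone_on_def)
qed

text \<open>
  If \<open>k\<close> recovers the parameter of \<open>\<gamma>\<close> near \<open>t\<close> from a coordinate, then \<open>\<nu>\<close> can only be \<open>k\<close>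
  applied to that coordinate of \<open>\<delta>\<close>. The curves \<open>\<gamma> \<circ> \<nu>\<close> and \<open>\<delta>\<close> agree at the given parameters
  accumulating at \<open>s\<close>, hence near \<open>s\<close> by the identity theorem.
\<close>

lemma open_immersion_germ_match:
  assumes M: "analytic_manifold M" and \<delta>: "open_immersion M J \<delta>" and \<gamma>: "open_immersion M J \<gamma>"
    and s: "s \<in> J" and t: "t \<in> J"
    and approx: "\<And>e. e > 0 \<Longrightarrow> \<exists>x y. x \<noteq> s \<and> \<bar>x - s\<bar> < e \<and> \<bar>y - t\<bar> < e \<and> \<delta> x = \<gamma> y"
  shows "\<exists>\<sigma>\<in>{1, -1}. germ_match J \<delta> \<gamma> s t \<sigma>"
proof -
  have eq: "\<delta> s = \<gamma> t"
  proof (rule ccontr)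
    assume "\<delta> s \<noteq> \<gamma> t"
    then obtain V W where VW: "openin (mtop M) V" "openin (mtop M) W" "\<delta> s \<in> V" "\<gamma> t \<in> W" "disjnt V W"
      using M open_immersion_topspace[OF \<delta> s] open_immersion_topspace[OF \<gamma> t]
      unfolding analytic_manifold_def Hausdorff_space_def by metis
    obtain d where d: "d > 0" "\<And>x. \<bar>x - s\<bar> < d \<Longrightarrow> \<delta> x \<in> V"
      using open_immersion_eventually_in[OF \<delta> s VW(1,3)] by (auto simp: eventually_nhds_metric dist_real_def)
    obtain e where e: "e > 0" "\<And>y. \<bar>y - t\<bar> < e \<Longrightarrow> \<gamma> y \<in> W"
      using open_immersion_eventually_in[OF \<gamma> t VW(2,4)] by (auto simp: eventually_nhds_metric dist_real_def)
    obtain x y where "\<bar>x - s\<bar> < min d e" "\<bar>y - t\<bar> < min d e" "\<delta> x = \<gamma> y"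
      using approx[of "min d e"] d(1) e(1) by auto
    with d(2)[of x] e(2)[of y] VW(5) show False by (auto simp: disjnt_iff)
  qed
  obtain U \<psi> where U: "(U, \<psi>) \<in> matlas M" "\<gamma> t \<in> U"
    using open_immersion_chart[OF M \<gamma> t] .
  have U': "\<delta> s \<in> U" using U(2) eq by simp
  obtain i k r where i: "i < mdim M" and r: "r > 0" and k: "real_analytic_at k (\<psi> (\<gamma> t) i)"
    and kr: "\<And>y. \<bar>y - t\<bar> < r \<Longrightarrow> y \<in> J \<and> \<gamma> y \<in> U \<and> k (\<psi> (\<gamma> y) i) = y"
    using open_immersion_local_parameter[OF M \<gamma> t U] by metis
  define \<nu> where "\<nu> x = k (\<psi> (\<delta> x) i)" for x
  have \<nu>s: "\<nu> s = t" using kr[of t] r by (simp add: \<nu>_def eq)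
  have an\<nu>: "real_analytic_at \<nu> s"
    unfolding \<nu>_def
    by (rule real_analytic_at_compose[where f = k])
       (use k eq open_immersion_coordinates(1)[OF \<delta> s U(1) U' i] in auto)
  have "\<forall>\<^sub>F x in nhds s. \<psi> (\<gamma> (\<nu> x)) j = \<psi> (\<delta> x) j" if j: "j < mdim M" for j
  proof (rule real_analytic_at_identity)
    show "real_analytic_at (\<lambda>x. \<psi> (\<gamma> (\<nu> x)) j) s"
      by (rule real_analytic_at_compose[where f = "\<lambda>y. \<psi> (\<gamma> y) j"])
         (use an\<nu> \<nu>s open_immersion_coordinates(1)[OF \<gamma> t U j] in auto)
    show "real_analytic_at (\<lambda>x. \<psi> (\<delta> x) j) s"
      by (rule open_immersion_coordinates(1)[OF \<delta> s U(1) U' j])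
    show "\<exists>\<^sub>F x in at s. \<psi> (\<gamma> (\<nu> x)) j = \<psi> (\<delta> x) j"
      unfolding frequently_def
    proof
      assume "\<forall>\<^sub>F x in at s. \<not> \<psi> (\<gamma> (\<nu> x)) j = \<psi> (\<delta> x) j"
      then obtain d where d: "d > 0" "\<And>x. x \<noteq> s \<Longrightarrow> \<bar>x - s\<bar> < d \<Longrightarrow> \<psi> (\<gamma> (\<nu> x)) j \<noteq> \<psi> (\<delta> x) j"
        by (auto simp: eventually_at dist_real_def)
      obtain x y where xy: "x \<noteq> s" "\<bar>x - s\<bar> < min d r" "\<bar>y - t\<bar> < min d r" "\<delta> x = \<gamma> y"
        using approx[of "min d r"] d(1) r by auto
      then have "\<nu> x = y" using kr[of y] by (simp add: \<nu>_def)
      with d(2)[of x] xy show False by simp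
    qed
  qed
  then have coords: "\<forall>\<^sub>F x in nhds s. \<forall>j<mdim M. \<psi> (\<gamma> (\<nu> x)) j = \<psi> (\<delta> x) j"
    using eventually_ball_finite[of "{..<mdim M}" "\<lambda>x j. \<psi> (\<gamma> (\<nu> x)) j = \<psi> (\<delta> x) j" "nhds s"]
    by (simp add: Ball_def)
  have "\<forall>\<^sub>F x in nhds s. \<nu> x \<in> J \<and> \<gamma> (\<nu> x) \<in> U"
  proof -
    have "(\<nu> \<longlongrightarrow> t) (nhds s)"
      using real_analytic_at_imp_isCont[OF an\<nu>] \<nu>s
      using tendsto_at_iff_tendsto_nhds[of \<nu> s] by (simp add: isCont_def)
    with open_immersion_eventually_in[OF \<gamma> t chart_openin[OF M U(1)] U(2)]
    show ?thesis by (rule eventually_compose_filterlim)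
  qed
  with coords open_immersion_eventually_in[OF \<delta> s chart_openin[OF M U(1)] U']
  have "\<forall>\<^sub>F x in nhds s. x \<in> J \<and> \<nu> x \<in> J \<and> \<delta> x = \<gamma> (\<nu> x)"
    by eventually_elim (auto intro: chart_eqI[OF M U(1)])
  then obtain d where d: "d > 0" "\<And>x. \<bar>x - s\<bar> < d \<Longrightarrow> x \<in> J \<and> \<nu> x \<in> J \<and> \<delta> x = \<gamma> (\<nu> x)"
    by (auto simp: eventually_nhds_metric dist_real_def)
  obtain e where e: "e > 0" "\<And>x. \<bar>x - s\<bar> < e \<Longrightarrow> isCont \<nu> x"
    using real_analytic_at_imp_eventually[OF an\<nu>] real_analytic_at_imp_isCont by metis
  obtain q where q: "q > 0" "inj_on \<delta> {s - q<..<s + q}"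
    using open_immersion_locally_inj[OF M \<delta> s] by blast
  define m where "m = min (min d e) q"
  define V where "V = {s - m<..<s + m}"
  have V: "\<bar>x - s\<bar> < d" "\<bar>x - s\<bar> < e" "x \<in> {s - q<..<s + q}" if "x \<in> V" for x
    using that by (auto simp: V_def m_def)
  have cont: "continuous_on V \<nu>"
    using V(2) e(2) by (intro continuous_at_imp_continuous_on) auto
  have "connected V" by (simp add: V_def)
  moreover have "inj_on \<nu> V"
    by (rule inj_onI) (metis V(1,3) d(2) inj_onD q(2))
  ultimately obtain \<sigma> where \<sigma>: "\<sigma> \<in> {1, -1}" "strict_mono_on V (\<lambda>x. \<sigma> * \<nu> x)"
    using inj_on_interval_sign[OF _ cont] by blast
  have "germ_match J \<delta> \<gamma> s t \<sigma>"
    unfolding germ_match_def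
    using d V(1) cont \<sigma>(2) \<nu>s e(1) q(1)
    by (intro exI[of _ V] exI[of _ \<nu>]) (auto simp: V_def m_def)
  with \<sigma>(1) show ?thesis by blast
qed

section \<open>Matches between a curve and its translates\<close>

text \<open>
  The curve \<open>\<gamma>\<close> is taken on an open interval, so that all translates are immersions of the same
  interval \<open>I\<close>.
\<close>

locale analytic_curve_action =
  fixes G :: "('g, 'z) monoid_scheme" (structure)
    and M :: "'m chart_structure"
    and \<phi> :: "'g \<Rightarrow> 'm \<Rightarrow> 'm"
    and I :: "real set"
    and \<gamma> :: "real \<Rightarrow> 'm"
  assumes manifold: "analytic_manifold M"
    and action: "group_action G (topspace (mtop M)) \<phi>"
    and analytic_action: "analytic_in_space G M \<phi>"
    and immersion: "open_immersion M I \<gamma>"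
begin

sublocale group G
  using action group_action.group_hom group_hom.axioms(1) by blast

lemma I_open: "open I" and I_connected: "connected I"
  using open_immersionD[OF immersion] by auto

lemma I_convex: "s \<in> I \<Longrightarrow> t \<in> I \<Longrightarrow> {s..t} \<subseteq> I"
  using I_connected connected_contains_Icc by blast

lemma point: "t \<in> I \<Longrightarrow> \<gamma> t \<in> topspace (mtop M)"
  using open_immersion_topspace[OF immersion] .

lemma act_point: "h \<in> carrier G \<Longrightarrow> t \<in> I \<Longrightarrow> \<phi> h (\<gamma> t) \<in> topspace (mtop M)"
  using group_action.element_image[OF action] point by metis

lemma act_mult:
  "h \<in> carrier G \<Longrightarrow> k \<in> carrier G \<Longrightarrow> p \<in> topspace (mtop M) \<Longrightarrow> \<phi> (h \<otimes> k) p = \<phi> h (\<phi> k p)"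
  using group_action.composition_rule[OF action] by simp

lemma act_one: "p \<in> topspace (mtop M) \<Longrightarrow> \<phi> \<one> p = p"
  using group_action.id_eq_one[OF action] by (metis restrict_apply')

lemma act_inv: "h \<in> carrier G \<Longrightarrow> p \<in> topspace (mtop M) \<Longrightarrow> \<phi> (inv h) (\<phi> h p) = p"
  using act_mult[of "inv h" h p] act_one by simp

lemma translate_immersion:
  assumes h: "h \<in> carrier G"
  shows "open_immersion M I (\<phi> h \<circ> \<gamma>)"
proof (rule open_immersion_compose[OF manifold _ _ _ immersion])
  show "analytic_map M M (\<phi> h)" "analytic_map M M (\<phi> (inv h))"
    using analytic_action h by (auto simp: analytic_in_space_def)
qed (simp add: act_inv h)

definition match :: "'g \<Rightarrow> real \<Rightarrow> real \<Rightarrow> real \<Rightarrow> bool"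
  where "match h = germ_match I (\<phi> h \<circ> \<gamma>) \<gamma>"

abbreviation "S \<equiv> curve_stabilizer G \<phi> I \<gamma>"

lemma match_in: "match h s t \<sigma> \<Longrightarrow> s \<in> I \<and> t \<in> I"
  by (auto simp: match_def germ_match_def)

lemma match_eq: "match h s t \<sigma> \<Longrightarrow> \<phi> h (\<gamma> s) = \<gamma> t"
  by (auto simp: match_def germ_match_def)

lemma matchI:
  assumes "open U" "s \<in> U" "U \<subseteq> I" "\<nu> ` U \<subseteq> I" "continuous_on U \<nu>"
    "strict_mono_on U (\<lambda>x. \<sigma> * \<nu> x)" "\<nu> s = t" "\<And>x. x \<in> U \<Longrightarrow> \<phi> h (\<gamma> x) = \<gamma> (\<nu> x)"
  shows "match h s t \<sigma>"
  using assms unfolding match_def germ_match_def by (intro exI[of _ U] exI[of _ \<nu>]) auto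

lemma matchE:
  assumes "match h s t \<sigma>"
  obtains U \<nu> where "open U" "s \<in> U" "U \<subseteq> I" "\<nu> ` U \<subseteq> I" "continuous_on U \<nu>"
    "strict_mono_on U (\<lambda>x. \<sigma> * \<nu> x)" "\<nu> s = t" "\<And>x. x \<in> U \<Longrightarrow> \<phi> h (\<gamma> x) = \<gamma> (\<nu> x)"
    "\<And>x. x \<in> U \<Longrightarrow> match h x (\<nu> x) \<sigma>"
proof -
  obtain U \<nu> where U: "open U" "s \<in> U" "U \<subseteq> I" "\<nu> ` U \<subseteq> I" "continuous_on U \<nu>"
    "strict_mono_on U (\<lambda>x. \<sigma> * \<nu> x)" "\<nu> s = t" "\<And>x. x \<in> U \<Longrightarrow> \<phi> h (\<gamma> x) = \<gamma> (\<nu> x)"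
    using assms unfolding match_def germ_match_def o_def by blast
  then have "match h x (\<nu> x) \<sigma>" if "x \<in> U" for x
    using that by (intro matchI[of U _ \<nu>]) auto
  with U that show thesis by blast
qed

lemma match_cong:
  assumes "match h s t \<sigma>" "\<And>x. x \<in> I \<Longrightarrow> \<phi> k (\<gamma> x) = \<phi> h (\<gamma> x)"
  shows "match k s t \<sigma>"
proof -
  from assms(1) obtain U \<nu> where U: "open U" "s \<in> U" "U \<subseteq> I" "\<nu> ` U \<subseteq> I" "continuous_on U \<nu>"
    "strict_mono_on U (\<lambda>x. \<sigma> * \<nu> x)" "\<nu> s = t" "\<And>x. x \<in> U \<Longrightarrow> \<phi> h (\<gamma> x) = \<gamma> (\<nu> x)"
    by (elim matchE) blast
  show ?thesis
    by (rule matchI[OF U(1-7)]) (use U(3,8) assms(2) in auto)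
qed

lemma match_mult:
  assumes h: "h \<in> carrier G" "k \<in> carrier G" and "match h s t \<sigma>" "match k t u \<tau>"
    and \<tau>: "\<tau> \<in> {1, -1}"
  shows "match (k \<otimes> h) s u (\<tau> * \<sigma>)"
proof -
  from assms(3) obtain U \<nu> where U: "open U" "s \<in> U" "U \<subseteq> I" "\<nu> ` U \<subseteq> I" "continuous_on U \<nu>"
    "strict_mono_on U (\<lambda>x. \<sigma> * \<nu> x)" "\<nu> s = t" "\<And>x. x \<in> U \<Longrightarrow> \<phi> h (\<gamma> x) = \<gamma> (\<nu> x)"
    by (elim matchE) blast
  from assms(4) obtain V \<mu> where V: "open V" "t \<in> V" "V \<subseteq> I" "\<mu> ` V \<subseteq> I" "continuous_on V \<mu>"
    "strict_mono_on V (\<lambda>x. \<tau> * \<mu> x)" "\<mu> t = u" "\<And>x. x \<in> V \<Longrightarrow> \<phi> k (\<gamma> x) = \<gamma> (\<mu> x)"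
    by (elim matchE) blast
  define W where "W = U \<inter> \<nu> -` V"
  have W: "x \<in> U" "\<nu> x \<in> V" if "x \<in> W" for x using that by (auto simp: W_def)
  show ?thesis
  proof (rule matchI[of W _ "\<mu> \<circ> \<nu>"])
    show "open W"
      unfolding W_def using continuous_open_preimage[OF U(5,1) V(1)] .
    show "continuous_on W (\<mu> \<circ> \<nu>)"
      by (rule continuous_on_compose) (auto intro: continuous_on_subset[OF U(5)] continuous_on_subset[OF V(5)] W)
    show "strict_mono_on W (\<lambda>x. \<tau> * \<sigma> * (\<mu> \<circ> \<nu>) x)"
    proof (rule strict_mono_onI)
      fix x y assume xy: "x \<in> W" "y \<in> W" "x < y"
      have 1: "\<sigma> * \<nu> x < \<sigma> * \<nu> y"
        using strict_mono_onD[OF U(6)] xy W by blast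
      have 2: "\<tau> * \<mu> a < \<tau> * \<mu> b" if "a < b" "a \<in> V" "b \<in> V" for a b
        using strict_mono_onD[OF V(6)] that by blast
      show "\<tau> * \<sigma> * (\<mu> \<circ> \<nu>) x < \<tau> * \<sigma> * (\<mu> \<circ> \<nu>) y"
      proof (cases "\<nu> x < \<nu> y")
        case True
        then have "\<sigma> > 0" using 1 by (metis linorder_not_less mult_left_mono_neg order_less_imp_le)
        with 2[OF True] W xy show ?thesis
          by (simp add: mult.commute[of \<tau>] mult.assoc)
      next
        case False
        with 1 have "\<nu> y < \<nu> x" by (metis less_irrefl linorder_neqE_linordered_idom)
        moreover from this have "\<sigma> < 0" using 1 by (metis linorder_not_less mult_left_mono order_less_imp_le)
        ultimately show ?thesis using 2[of "\<nu> y" "\<nu> x"] W xy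
          by (simp add: mult.commute[of \<tau>] mult.assoc)
      qed
    qed
    show "\<phi> (k \<otimes> h) (\<gamma> x) = \<gamma> ((\<mu> \<circ> \<nu>) x)" if "x \<in> W" for x
      using that W U V h point by (auto simp: act_mult subset_iff)
  qed (use U V in \<open>auto simp: W_def\<close>)
qed

lemma match_inv:
  assumes h: "h \<in> carrier G" and m: "match h s t \<sigma>" and \<sigma>: "\<sigma> \<in> {1, -1}"
  shows "match (inv h) t s \<sigma>"
proof -
  from m obtain U \<nu> where U: "open U" "s \<in> U" "U \<subseteq> I" "\<nu> ` U \<subseteq> I" "continuous_on U \<nu>"
    "strict_mono_on U (\<lambda>x. \<sigma> * \<nu> x)" "\<nu> s = t" "\<And>x. x \<in> U \<Longrightarrow> \<phi> h (\<gamma> x) = \<gamma> (\<nu> x)"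
    by (elim matchE) blast
  have inj: "inj_on \<nu> U"
    using strict_mono_on_imp_inj_on[OF U(6)] by (auto simp: inj_on_def)
  have iv: "inv_into U \<nu> (\<nu> x) = x" if "x \<in> U" for x using inj that by (rule inv_into_f_f)
  show ?thesis
  proof (rule matchI[of "\<nu> ` U" _ "inv_into U \<nu>"])
    show "open (\<nu> ` U)" using invariance_of_domain[OF U(5,1) inj] .
    show "continuous_on (\<nu> ` U) (inv_into U \<nu>)"
      by (rule continuous_on_inverse_open[OF U(1,5)]) (simp_all add: iv)
    show "strict_mono_on (\<nu> ` U) (\<lambda>x. \<sigma> * inv_into U \<nu> x)"
    proof (rule strict_mono_onI, clarify)
      fix x y assume xy: "x \<in> U" "y \<in> U" "\<nu> x < \<nu> y"
      have "\<sigma> * \<nu> x < \<sigma> * \<nu> y" if "x < y" "x \<in> U" "y \<in> U" for x y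
        using strict_mono_onD[OF U(6)] that by blast
      from this[of x y] this[of y x] xy \<sigma>
      show "\<sigma> * inv_into U \<nu> (\<nu> x) < \<sigma> * inv_into U \<nu> (\<nu> y)"
        by (auto simp: iv) (metis less_irrefl linorder_neqE_linordered_idom order_less_trans)+
    qed
    show "\<phi> (inv h) (\<gamma> x) = \<gamma> (inv_into U \<nu> x)" if "x \<in> \<nu> ` U" for x
      using that U h point act_inv by (auto simp: iv subset_iff simp flip: U(8))
  qed (use U iv in \<open>auto\<close>)
qed

lemma match_of_accumulation:
  assumes h: "h \<in> carrier G" and "s \<in> I" "t \<in> I"
    and "\<And>e. e > 0 \<Longrightarrow> \<exists>x y. x \<noteq> s \<and> \<bar>x - s\<bar> < e \<and> \<bar>y - t\<bar> < e \<and> \<phi> h (\<gamma> x) = \<gamma> y"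
  shows "\<exists>\<sigma>\<in>{1, -1}. match h s t \<sigma>"
  unfolding match_def
  by (rule open_immersion_germ_match[OF manifold translate_immersion[OF h] immersion])
     (use assms in auto)

lemma locally_inj:
  "t \<in> I \<Longrightarrow> \<exists>r>0. {t - r<..<t + r} \<subseteq> I \<and> inj_on \<gamma> {t - r<..<t + r}"
  using open_immersion_locally_inj[OF manifold immersion] .

text \<open>
  The identity theorem: the stabilizer of any arc of \<open>\<gamma>\<close> is the stabilizer \<open>S\<close> of the whole curve.
\<close>

lemma stab_agree:
  assumes h: "h \<in> carrier G" and t: "t \<in> I" and "\<exists>\<^sub>F s in at t. \<phi> h (\<gamma> s) = \<gamma> s"
  shows "h \<in> S"
  using open_immersion_identity[OF manifold translate_immersion[OF h] immersion t] assms
  by (auto simp: curve_stabilizer_def)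

lemma stab_agree_interval:
  assumes h: "h \<in> carrier G" and B: "B \<subseteq> I" "nondeg_interval B"
    and eq: "\<And>s. s \<in> B \<Longrightarrow> \<phi> h (\<gamma> s) = \<gamma> s"
  shows "h \<in> S"
proof -
  obtain t where t: "t \<in> interior B" using B(2) by (auto simp: nondeg_interval_def)
  have "\<forall>\<^sub>F s in nhds t. s \<in> interior B"
    using t by (intro eventually_nhds_in_open) auto
  then have "\<forall>\<^sub>F s in at t. \<phi> h (\<gamma> s) = \<gamma> s"
    using eq interior_subset by (auto simp: eventually_at_filter elim!: eventually_mono)
  then have "\<exists>\<^sub>F s in at t. \<phi> h (\<gamma> s) = \<gamma> s"
    by (rule eventually_frequently[OF trivial_limit_at])
  with h t B(1) interior_subset show ?thesis by (intro stab_agree) auto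
qed

text \<open>
  Near \<open>s\<close> the curve is injective, so a reparametrization \<open>\<nu>\<close> with \<open>\<gamma> \<circ> \<nu> = \<gamma>\<close> and \<open>\<nu> s = s\<close>
  is the identity there.
\<close>

section \<open>Immersed curves do not run back along themselves\<close>

lemma no_fixed_reversal: "\<not> match \<one> s s (-1)"
proof
  assume "match \<one> s s (-1)"
  then obtain U \<nu> where U: "open U" "s \<in> U" "U \<subseteq> I" "\<nu> ` U \<subseteq> I" "continuous_on U \<nu>"
    "strict_mono_on U (\<lambda>x. -1 * \<nu> x)" "\<nu> s = s" "\<And>x. x \<in> U \<Longrightarrow> \<phi> \<one> (\<gamma> x) = \<gamma> (\<nu> x)"
    by (elim matchE) blast
  obtain r where r: "r > 0" "inj_on \<gamma> {s - r<..<s + r}"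
    using locally_inj[of s] U by blast
  define V where "V = U \<inter> \<nu> -` {s - r<..<s + r} \<inter> {s - r<..<s + r}"
  have "open V" "s \<in> V"
    using continuous_open_preimage[OF U(5,1), of "{s - r<..<s + r}"] U r by (auto simp: V_def)
  then obtain e where e: "e > 0" "\<And>x. \<bar>x - s\<bar> < e \<Longrightarrow> x \<in> V"
    unfolding open_dist dist_real_def by metis
  define x where "x = s + e / 2"
  have x: "x \<in> V" "s < x" using e(1) e(2)[of x] by (auto simp: x_def)
  then have "\<gamma> (\<nu> x) = \<gamma> x"
    using U(3) U(8)[of x] act_one point by (auto simp: V_def)
  then have "\<nu> x = x" using r(2) x(1) by (auto simp: V_def dest: inj_onD)
  moreover have "\<nu> x < \<nu> s"
    using strict_mono_onD[OF U(6), of s x] x U(2) by (auto simp: V_def)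
  ultimately show False using x(2) U(7) by simp
qed

text \<open>
  Among all \<open>x \<le> y\<close> in \<open>{s..t}\<close> that the identity matches in reverse direction, one pair has the
  smallest difference \<open>y - x\<close>: the set \<open>K\<close> of such pairs is closed because limits of matches are
  matches, and the limit still reverses the direction since \<open>\<gamma>\<close> is locally injective. Moving \<open>x\<close>
  slightly to the right moves \<open>y\<close> to the left, so the minimum can only be \<open>0\<close>, which contradicts
  local injectivity.
\<close>

lemma no_reversal_le:
  assumes "s \<le> t" shows "\<not> match \<one> s t (-1)"
proof
  assume m: "match \<one> s t (-1)"
  have st: "s \<in> I" "t \<in> I" using match_in[OF m] by auto
  have sub: "{s..t} \<subseteq> I" using I_convex st by blast
  define K where "K = {p \<in> {s..t} \<times> {s..t}. fst p \<le> snd p \<and> match \<one> (fst p) (snd p) (-1)}"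
  have K: "x \<in> I" "y \<in> I" "match \<one> x y (-1)" if "(x, y) \<in> K" for x y
    using that sub by (auto simp: K_def)
  have eqK: "\<gamma> x = \<gamma> y" "\<phi> \<one> (\<gamma> x) = \<gamma> y" if "(x, y) \<in> K" for x y
    using K[OF that] match_eq act_one point by metis+
  have "closed K"
    unfolding closed_limpt islimpt_approachable
  proof (intro allI impI)
    fix p assume lim: "\<forall>e>0. \<exists>q\<in>K. q \<noteq> p \<and> dist q p < e"
    obtain x y where p: "p = (x, y)" by (cases p)
    have approx: "\<exists>x' y'. (x', y') \<in> K \<and> (x', y') \<noteq> (x, y) \<and> \<bar>x' - x\<bar> < e \<and> \<bar>y' - y\<bar> < e" if e: "e > 0" for e
    proof -
      obtain x' y' where "(x', y') \<in> K" "(x', y') \<noteq> (x, y)" "dist (x', y') (x, y) < e"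
        using lim e p by (metis surj_pair)
      moreover from this have "dist x' x < e" "dist y' y < e"
        using dist_fst_le[of "(x', y')" "(x, y)"] dist_snd_le[of "(x', y')" "(x, y)"] by auto
      ultimately show ?thesis by (auto simp: dist_real_def)
    qed
    have "closed {p \<in> {s..t} \<times> {s..t}. fst p \<le> snd p}"
    proof -
      have "closed {p :: real \<times> real. fst p \<le> snd p}"
        by (intro closed_Collect_le continuous_intros)
      then have "closed (({s..t} \<times> {s..t}) \<inter> {p. fst p \<le> snd p})"
        by (intro closed_Int closed_Times closed_atLeastAtMost)
      moreover have "({s..t} \<times> {s..t}) \<inter> {p. fst p \<le> snd p} = {p \<in> {s..t} \<times> {s..t}. fst p \<le> snd p}"
        by blast
      ultimately show ?thesis by simp
    qed
    moreover have "p islimpt {p \<in> {s..t} \<times> {s..t}. fst p \<le> snd p}"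
      unfolding islimpt_approachable
    proof (intro allI impI)
      fix e :: real assume "e > 0"
      then obtain q where "q \<in> K" "q \<noteq> p \<and> dist q p < e" using lim by blast
      moreover from this(1) have "q \<in> {p \<in> {s..t} \<times> {s..t}. fst p \<le> snd p}" by (simp add: K_def)
      ultimately show "\<exists>q\<in>{p \<in> {s..t} \<times> {s..t}. fst p \<le> snd p}. q \<noteq> p \<and> dist q p < e" by blast
    qed
    ultimately have "p \<in> {p \<in> {s..t} \<times> {s..t}. fst p \<le> snd p}"
      unfolding closed_limpt by blast
    then have xy: "x \<in> {s..t}" "y \<in> {s..t}" "x \<le> y" using p by auto
    then have xyI: "x \<in> I" "y \<in> I" using sub by auto
    obtain r where r: "r > 0" "inj_on \<gamma> {y - r<..<y + r}"
      using locally_inj[OF xyI(2)] by blast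
    have "\<exists>\<sigma>\<in>{1, -1}. match \<one> x y \<sigma>"
    proof (rule match_of_accumulation)
      fix e :: real assume e: "e > 0"
      define d where "d = min e r"
      have d: "d > 0" using e r by (simp add: d_def)
      obtain x1 y1 where 1: "(x1, y1) \<in> K" "(x1, y1) \<noteq> (x, y)" "\<bar>x1 - x\<bar> < d" "\<bar>y1 - y\<bar> < d"
        using approx[OF d] by blast
      \<comment> \<open>if the first components were constant, local injectivity would make the second ones constant\<close>
      have "\<exists>x' y'. (x', y') \<in> K \<and> x' \<noteq> x \<and> \<bar>x' - x\<bar> < d \<and> \<bar>y' - y\<bar> < d"
      proof (cases "x1 = x")
        case True
        with 1 have y1: "\<bar>y1 - y\<bar> > 0" by simp
        obtain x2 y2 where 2: "(x2, y2) \<in> K" "(x2, y2) \<noteq> (x, y)"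
          "\<bar>x2 - x\<bar> < min d \<bar>y1 - y\<bar>" "\<bar>y2 - y\<bar> < min d \<bar>y1 - y\<bar>"
          using approx[of "min d \<bar>y1 - y\<bar>"] d y1 by auto
        have "x2 \<noteq> x"
        proof
          assume "x2 = x"
          then have "\<gamma> y2 = \<gamma> y1" using eqK(1)[OF 1(1)] eqK(1)[OF 2(1)] True by simp
          moreover have "y1 \<in> {y - r<..<y + r}" "y2 \<in> {y - r<..<y + r}"
            using 1(4) 2(4) by (auto simp: d_def)
          ultimately have "y2 = y1" using inj_onD[OF r(2)] by blast
          with 2(4) show False by simp
        qed
        with 2 show ?thesis by (intro exI[of _ x2] exI[of _ y2]) auto
      qed (use 1 in blast)
      then obtain x' y' where xy': "(x', y') \<in> K" "x' \<noteq> x" "\<bar>x' - x\<bar> < d" "\<bar>y' - y\<bar> < d" by blast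
      then show "\<exists>x' y'. x' \<noteq> x \<and> \<bar>x' - x\<bar> < e \<and> \<bar>y' - y\<bar> < e \<and> \<phi> \<one> (\<gamma> x') = \<gamma> y'"
        using eqK(2)[OF xy'(1)] by (intro exI[of _ x'] exI[of _ y']) (simp add: d_def)
    qed (use xyI in auto)
    then obtain \<sigma> where \<sigma>: "\<sigma> \<in> {1, -1}" "match \<one> x y \<sigma>" by blast
    \<comment> \<open>an increasing match in the limit would coexist, at a nearby pair, with a decreasing one\<close>
    have "\<sigma> \<noteq> 1"
    proof
      assume "\<sigma> = 1"
      with \<sigma>(2) obtain U \<nu> where U: "open U" "x \<in> U" "U \<subseteq> I" "\<nu> ` U \<subseteq> I" "continuous_on U \<nu>"
        "\<nu> x = y" "\<And>z. z \<in> U \<Longrightarrow> \<phi> \<one> (\<gamma> z) = \<gamma> (\<nu> z)" "\<And>z. z \<in> U \<Longrightarrow> match \<one> z (\<nu> z) 1"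
        by (elim matchE) blast
      define V where "V = U \<inter> \<nu> -` {y - r<..<y + r}"
      have "open V" "x \<in> V"
        using continuous_open_preimage[OF U(5,1), of "{y - r<..<y + r}"] U r by (auto simp: V_def)
      then obtain e where e: "e > 0" "\<And>z. \<bar>z - x\<bar> < e \<Longrightarrow> z \<in> V"
        unfolding open_dist dist_real_def by metis
      obtain x' y' where xy': "(x', y') \<in> K" "\<bar>x' - x\<bar> < min e r" "\<bar>y' - y\<bar> < min e r"
        using approx[of "min e r"] e(1) r(1) by auto
      have x'V: "x' \<in> U" "\<nu> x' \<in> {y - r<..<y + r}" using e(2)[of x'] xy'(2) by (auto simp: V_def)
      have "\<gamma> (\<nu> x') = \<gamma> y'"
        using U(7)[OF x'V(1)] eqK(2)[OF xy'(1)] by simp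
      moreover have "y' \<in> {y - r<..<y + r}" using xy'(3) by auto
      ultimately have "\<nu> x' = y'" using inj_onD[OF r(2)] x'V(2) by blast
      with U(8)[OF x'V(1)] have "match \<one> x' y' 1" by simp
      moreover have "match (inv \<one>) y' x' (-1)"
        using K(3)[OF xy'(1)] by (intro match_inv) auto
      ultimately have "match (\<one> \<otimes> inv \<one>) y' y' (1 * -1)"
        by (intro match_mult) auto
      then show False using no_fixed_reversal by simp
    qed
    with \<sigma> have "match \<one> x y (-1)" by auto
    with xy p show "p \<in> K" by (simp add: K_def)
  qed
  moreover have "bounded K"
    by (rule bounded_subset[of "{s..t} \<times> {s..t}"]) (auto simp: K_def bounded_Times)
  ultimately have "compact K" by (simp add: compact_eq_bounded_closed)
  moreover have "K \<noteq> {}" using m \<open>s \<le> t\<close> by (auto simp: K_def)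
  moreover have "continuous_on K (\<lambda>p. snd p - fst p)" by (intro continuous_intros)
  ultimately obtain p where p: "p \<in> K" "\<And>q. q \<in> K \<Longrightarrow> snd p - fst p \<le> snd q - fst q"
    using continuous_attains_inf[of K "\<lambda>p. snd p - fst p"] by blast
  obtain x y where xy: "p = (x, y)" by (cases p)
  have mxy: "match \<one> x y (-1)" "s \<le> x" "x \<le> y" "y \<le> t" using p(1) by (auto simp: xy K_def)
  have "x \<noteq> y" using no_fixed_reversal mxy(1) by metis
  with mxy have "x < y" by simp
  from mxy(1) obtain U \<nu> where U: "open U" "x \<in> U" "U \<subseteq> I" "\<nu> ` U \<subseteq> I" "continuous_on U \<nu>"
    "strict_mono_on U (\<lambda>z. -1 * \<nu> z)" "\<nu> x = y" "\<And>z. z \<in> U \<Longrightarrow> match \<one> z (\<nu> z) (-1)"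
    by (elim matchE) blast
  define V where "V = U \<inter> \<nu> -` {(x + y) / 2<..} \<inter> {..<(x + y) / 2}"
  have "open V" "x \<in> V"
    using continuous_open_preimage[OF U(5,1), of "{(x + y) / 2<..}"] U \<open>x < y\<close> by (auto simp: V_def)
  then obtain e where e: "e > 0" "\<And>z. \<bar>z - x\<bar> < e \<Longrightarrow> z \<in> V"
    unfolding open_dist dist_real_def by metis
  define z where "z = x + e / 2"
  have z: "z \<in> V" "x < z" using e(1) e(2)[of z] by (auto simp: z_def)
  have "\<nu> z < y"
    using strict_mono_onD[OF U(6), of x z] z U(2,7) by (auto simp: V_def)
  with z U(8)[of z] mxy have "(z, \<nu> z) \<in> K" by (auto simp: K_def V_def)
  from p(2)[OF this] \<open>\<nu> z < y\<close> z(2) xy show False by simp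
qed

lemma no_reversal: "\<not> match \<one> s t (-1)"
proof
  assume m: "match \<one> s t (-1)"
  have "match (inv \<one>) t s (-1)" using m by (rule match_inv[rotated]) auto
  with m no_reversal_le[of s t] no_reversal_le[of t s] show False by (cases "s \<le> t") auto
qed

end

section \<open>Free intervals in terms of matches\<close>

lemma nondeg_interval_Ioo: "r > 0 \<Longrightarrow> nondeg_interval {t - r<..<t + r :: real}"
  by (simp add: nondeg_interval_def)

lemma nondeg_interval_approximable:
  assumes "nondeg_interval E" "x \<in> E" "e > 0"
  shows "\<exists>y\<in>E. y \<noteq> x \<and> \<bar>y - x\<bar> < e"
proof -
  have "connected E" "\<not> (\<exists>a. E = {a})"
    using assms(1) by (auto simp: nondeg_interval_def)
  with assms(2) have "x islimpt E" by (intro connected_imp_perfect) auto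
  with assms(3) show ?thesis by (auto simp: islimpt_approachable dist_real_def)
qed

lemma half_open_no_min_max:
  assumes "half_open E" "m \<in> E" "n \<in> E" "\<And>x. x \<in> E \<Longrightarrow> m \<le> x \<and> x \<le> n"
  shows False
proof -
  obtain a where "E = {a..} \<or> E = {..a} \<or> (\<exists>b>a. E = {a..<b} \<or> E = {a<..b})"
    using assms(1) unfolding half_open_def by blast
  then consider "E = {a..}" | "E = {..a}" | b where "b > a" "E = {a..<b}" | b where "b > a" "E = {a<..b}"
    by blast
  then show False
  proof cases
    case 1 then show False using assms(3) assms(4)[of "n + 1"] by auto
  next
    case 2 then show False using assms(2) assms(4)[of "m - 1"] by auto
  next
    case 3 then show False using assms(3) assms(4)[of "(n + b) / 2"] by auto
  next
    case 4 then show False using assms(2) assms(4)[of "(a + m) / 2"] by auto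
  qed
qed

lemma strict_mono_on_scaled_cancel:
  fixes \<mu> :: "real \<Rightarrow> real"
  assumes "strict_mono_on E (\<lambda>x. \<tau> * \<mu> x)" "x \<in> E" "y \<in> E"
  shows "\<tau> * \<mu> x < \<tau> * \<mu> y \<longleftrightarrow> x < y"
  using strict_mono_on_less[OF assms(1)] assms(2,3) by simp

lemma analytic_interval_diffeoD:
  assumes "analytic_interval_diffeo E D \<mu>"
  shows "nondeg_interval E" "nondeg_interval D" "\<mu> ` E = D" "continuous_on E \<mu>"
    and "\<exists>\<tau>\<in>{1, -1}. strict_mono_on E (\<lambda>x. \<tau> * \<mu> x)"
proof -
  show E: "nondeg_interval E" "nondeg_interval D" "\<mu> ` E = D"
    using assms by (auto simp: analytic_interval_diffeo_def bij_betw_def)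
  obtain J J' \<nu> where J: "E \<subseteq> J" "open_interval_diffeo J J' \<nu>" "\<And>t. t \<in> E \<Longrightarrow> \<mu> t = \<nu> t"
    using assms unfolding analytic_interval_diffeo_def by blast
  have "isCont \<nu> t" if "t \<in> J" for t
    using J(2) that by (intro real_analytic_at_imp_isCont) (auto simp: open_interval_diffeo_def)
  then have "continuous_on E \<nu>"
    using J(1) by (intro continuous_at_imp_continuous_on) auto
  then show c: "continuous_on E \<mu>"
    using J(3) by (simp cong: continuous_on_cong)
  show "\<exists>\<tau>\<in>{1, -1}. strict_mono_on E (\<lambda>x. \<tau> * \<mu> x)"
    using E(1) c assms
    by (intro inj_on_interval_sign) (auto simp: nondeg_interval_def analytic_interval_diffeo_def bij_betw_def)
qed

context analytic_curve_action
begin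

lemma locally_overlap_imp_match:
  assumes h: "h \<in> carrier G" and B: "B \<subseteq> I" and ov: "locally_overlap M B (\<phi> h \<circ> \<gamma>) B \<gamma>"
  shows "\<exists>s\<in>interior B. \<exists>t\<in>interior B. \<exists>\<sigma>\<in>{1, -1}. match h s t \<sigma>"
proof -
  obtain J J' where J: "nondeg_interval J" "open J" "J \<subseteq> B" "open J'" "J' \<subseteq> B"
    "analytic_embedding M J (\<phi> h \<circ> \<gamma>)" "analytic_embedding M J' \<gamma>" "(\<phi> h \<circ> \<gamma>) ` J = \<gamma> ` J'"
    using ov unfolding locally_overlap_def by blast
  obtain \<nu> where \<nu>: "continuous_on J \<nu>" "inj_on \<nu> J" "\<nu> ` J \<subseteq> J'"
    "\<And>x. x \<in> J \<Longrightarrow> (\<phi> h \<circ> \<gamma>) x = \<gamma> (\<nu> x)"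
    using analytic_embedding_match[OF J(6,7,2,8)] by blast
  have "connected J" using J(1) by (simp add: nondeg_interval_def)
  then obtain \<sigma> where \<sigma>: "\<sigma> \<in> {1, -1}" "strict_mono_on J (\<lambda>x. \<sigma> * \<nu> x)"
    using inj_on_interval_sign[OF _ \<nu>(1,2)] by blast
  obtain s where s: "s \<in> J" using J(1) interior_subset by (fastforce simp: nondeg_interval_def)
  have "match h s (\<nu> s) \<sigma>"
    using J \<nu> \<sigma> s B by (intro matchI[of J _ \<nu>]) auto
  moreover have "s \<in> interior B" using s J(2,3) by (meson interiorI)
  moreover have "\<nu> s \<in> interior B" using s \<nu>(3) J(4,5) by (meson image_subset_iff interiorI)
  ultimately show ?thesis using \<sigma>(1) by blast
qed

lemma match_imp_locally_overlap:
  assumes h: "h \<in> carrier G" and m: "match h s t \<sigma>"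
    and s: "s \<in> interior B" and t: "t \<in> interior B"
  shows "locally_overlap M B (\<phi> h \<circ> \<gamma>) B \<gamma>"
proof -
  from m obtain U \<nu> where U: "open U" "s \<in> U" "U \<subseteq> I" "\<nu> ` U \<subseteq> I" "continuous_on U \<nu>"
    "strict_mono_on U (\<lambda>x. \<sigma> * \<nu> x)" "\<nu> s = t" "\<And>x. x \<in> U \<Longrightarrow> \<phi> h (\<gamma> x) = \<gamma> (\<nu> x)"
    by (elim matchE) blast
  have st: "s \<in> I" "t \<in> I" using match_in[OF m] by auto
  obtain q where q: "q > 0"
    "\<And>K. open K \<Longrightarrow> nondeg_interval K \<Longrightarrow> K \<subseteq> {s - q<..<s + q} \<Longrightarrow> analytic_embedding M K (\<phi> h \<circ> \<gamma>)"
    using open_immersion_locally_embedding[OF manifold translate_immersion[OF h] st(1)] by blast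
  obtain r where r: "r > 0"
    "\<And>K. open K \<Longrightarrow> nondeg_interval K \<Longrightarrow> K \<subseteq> {t - r<..<t + r} \<Longrightarrow> analytic_embedding M K \<gamma>"
    using open_immersion_locally_embedding[OF manifold immersion st(2)] by blast
  define V where "V = (U \<inter> \<nu> -` ({t - r<..<t + r} \<inter> interior B)) \<inter> interior B"
  have "open V"
    unfolding V_def by (intro open_Int continuous_open_preimage[OF U(5,1)] open_interior open_greaterThanLessThan)
  moreover have "s \<in> V" using U r s t by (simp add: V_def)
  ultimately obtain e where e: "e > 0" "\<And>x. \<bar>x - s\<bar> < e \<Longrightarrow> x \<in> V"
    unfolding open_dist dist_real_def by metis
  define d where "d = min e q"
  define J where "J = {s - d<..<s + d}"
  have d: "d > 0" using e q by (simp add: d_def)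
  have JV: "J \<subseteq> V" using e(2) by (auto simp: J_def d_def)
  have JU: "J \<subseteq> U" using JV by (auto simp: V_def)
  have J: "open J" "nondeg_interval J" "J \<subseteq> B" "J \<subseteq> {s - q<..<s + q}"
    using JV interior_subset[of B] nondeg_interval_Ioo[OF d] by (auto simp: J_def V_def d_def)
  have inj: "inj_on \<nu> U"
    using strict_mono_on_imp_inj_on[OF U(6)] by (auto simp: inj_on_def)
  have oJ: "open (\<nu> ` J)"
    using invariance_of_domain continuous_on_subset[OF U(5) JU] J(1) inj_on_subset[OF inj JU] by blast
  have cJ: "connected (\<nu> ` J)"
    using continuous_on_subset[OF U(5) JU] by (intro connected_continuous_image) (auto simp: J_def)
  have "s \<in> J" using d by (simp add: J_def)
  then have J': "nondeg_interval (\<nu> ` J)" "\<nu> ` J \<subseteq> B" "\<nu> ` J \<subseteq> {t - r<..<t + r}"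
    using oJ cJ JV interior_subset[of B] by (auto simp: nondeg_interval_def interior_open V_def)
  have "(\<phi> h \<circ> \<gamma>) ` J = \<gamma> ` (\<nu> ` J)"
    using U(8) JU by (auto simp: image_image intro!: image_cong)
  then show ?thesis
    unfolding locally_overlap_def using J J' oJ q(2)[OF J(1,2,4)] r(2)[OF oJ J'(1,3)]
    by (intro exI[of _ J] exI[of _ "\<nu> ` J"] conjI)
qed

lemma curve_stabilizer_subinterval:
  assumes "B \<subseteq> I" "nondeg_interval B"
  shows "curve_stabilizer G \<phi> B \<gamma> = S"
  using stab_agree_interval[OF _ assms] assms(1) by (auto simp: curve_stabilizer_def)

text \<open>
  An overlap on embedded arcs is the same as a match between interior points: in one direction \<open>\<nu>\<close>
  is read off from the embeddings, in the other sufficiently short arcs are embedded. Combined with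
  the identity theorem this removes the manifold from the definition of freeness.
\<close>

lemma free_interval_iff:
  assumes B: "B \<subseteq> I" "nondeg_interval B"
  shows "free_interval G M \<phi> I \<gamma> B \<longleftrightarrow>
    (\<forall>h\<in>carrier G. \<forall>s\<in>interior B. \<forall>t\<in>interior B. \<forall>\<sigma>\<in>{1, -1}. match h s t \<sigma> \<longrightarrow> h \<in> S)"
proof -
  have "analytic_immersion M B \<gamma>"
    unfolding analytic_immersion_def using B immersion by blast
  then have "free_interval G M \<phi> I \<gamma> B \<longleftrightarrow>
      (\<forall>h\<in>carrier G. locally_overlap M B (\<phi> h \<circ> \<gamma>) B \<gamma> \<longrightarrow> h \<in> S)"
    using B by (simp add: free_interval_def free_segment_def curve_stabilizer_subinterval)
  also have "\<dots> \<longleftrightarrow> (\<forall>h\<in>carrier G. \<forall>s\<in>interior B. \<forall>t\<in>interior B. \<forall>\<sigma>\<in>{1, -1}. match h s t \<sigma> \<longrightarrow> h \<in> S)"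
    using locally_overlap_imp_match[OF _ B(1)] match_imp_locally_overlap by meson
  finally show ?thesis .
qed

lemma free_intervalD:
  assumes "free_interval G M \<phi> I \<gamma> B" "h \<in> carrier G" "match h s t \<sigma>" "\<sigma> \<in> {1, -1}"
    "s \<in> interior B" "t \<in> interior B"
  shows "h \<in> S"
  using assms free_interval_iff[of B] by (auto simp: free_interval_def)

lemma stab_carrier: "h \<in> S \<Longrightarrow> h \<in> carrier G"
  and stab_eq: "h \<in> S \<Longrightarrow> x \<in> I \<Longrightarrow> \<phi> h (\<gamma> x) = \<gamma> x"
  by (auto simp: curve_stabilizer_def)

lemma stab_subgroup: "subgroup S G"
proof (rule subgroup.intro)
  show "S \<subseteq> carrier G" using stab_carrier by blast
  show "\<one> \<in> S" using act_one point by (simp add: curve_stabilizer_def)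
  show "h \<otimes> k \<in> S" if "h \<in> S" "k \<in> S" for h k
    using that act_mult point by (simp add: curve_stabilizer_def)
  show "inv h \<in> S" if "h \<in> S" for h
  proof -
    have "\<phi> (inv h) (\<gamma> t) = \<gamma> t" if "t \<in> I" for t
      using act_inv[OF stab_carrier[OF \<open>h \<in> S\<close>] point[OF that]] stab_eq[OF \<open>h \<in> S\<close> that] by simp
    then show ?thesis using stab_carrier[OF that] by (simp add: curve_stabilizer_def)
  qed
qed

lemma same_coset_iff:
  assumes "h \<in> carrier G" "k \<in> carrier G"
  shows "h <# S = k <# S \<longleftrightarrow> inv h \<otimes> k \<in> S"
proof
  assume "h <# S = k <# S"
  then have "k \<in> h <# S"
    using assms(2) subgroup.one_closed[OF stab_subgroup] unfolding l_coset_def by force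
  then obtain x where "x \<in> S" "k = h \<otimes> x" by (auto simp: l_coset_def)
  with assms(1) stab_carrier show "inv h \<otimes> k \<in> S" by (simp add: m_assoc[symmetric])
next
  assume "inv h \<otimes> k \<in> S"
  moreover have "k = h \<otimes> (inv h \<otimes> k)" using assms by (simp add: m_assoc[symmetric])
  ultimately have "k \<in> h <# S" unfolding l_coset_def by blast
  then show "h <# S = k <# S"
    using l_repr_independence[OF _ assms(1) stab_subgroup] by blast
qed

lemma same_coset_act:
  assumes "h \<in> carrier G" "k \<in> carrier G" "inv h \<otimes> k \<in> S" "x \<in> I"
  shows "\<phi> k (\<gamma> x) = \<phi> h (\<gamma> x)"
proof -
  have "k = h \<otimes> (inv h \<otimes> k)" using assms by (simp add: m_assoc[symmetric])
  then have "\<phi> k (\<gamma> x) = \<phi> h (\<phi> (inv h \<otimes> k) (\<gamma> x))"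
    using act_mult[OF assms(1) _ point[OF assms(4)], of "inv h \<otimes> k"] assms(1,2) by simp
  then show ?thesis using stab_eq[OF assms(3,4)] by simp
qed

text \<open>
  At an endpoint of \<open>E\<close> the reparametrization is known on one side only; the resulting match extends
  it across the endpoint.
\<close>

section \<open>Uniqueness of the elements that carry one interval onto another\<close>

lemma match_reparametrization:
  assumes h: "h \<in> carrier G" and E: "nondeg_interval E" "E \<subseteq> I" "\<mu> ` E \<subseteq> I" "continuous_on E \<mu>"
    and \<tau>: "\<tau> \<in> {1, -1}" "strict_mono_on E (\<lambda>x. \<tau> * \<mu> x)"
    and eq: "\<And>x. x \<in> E \<Longrightarrow> \<phi> h (\<gamma> x) = \<gamma> (\<mu> x)" and e: "e \<in> E"
  shows "match h e (\<mu> e) \<tau>"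
proof -
  have near: "\<exists>x\<in>E. x \<noteq> e \<and> \<bar>x - e\<bar> < d \<and> \<bar>\<mu> x - \<mu> e\<bar> < d" if d: "d > 0" for d
  proof -
    obtain c where c: "c > 0" "\<And>x. x \<in> E \<Longrightarrow> \<bar>x - e\<bar> < c \<Longrightarrow> \<bar>\<mu> x - \<mu> e\<bar> < d"
      using E(4) e d unfolding continuous_on_iff dist_real_def by metis
    obtain x where "x \<in> E" "x \<noteq> e" "\<bar>x - e\<bar> < min c d"
      using nondeg_interval_approximable[OF E(1) e, of "min c d"] c(1) d by auto
    with c(2) show ?thesis by auto
  qed
  have eI: "e \<in> I" "\<mu> e \<in> I" using E e by auto
  have "\<exists>\<sigma>\<in>{1, -1}. match h e (\<mu> e) \<sigma>"
    using near eq by (intro match_of_accumulation[OF h eI]) metis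
  then obtain \<sigma> where \<sigma>: "\<sigma> \<in> {1, -1}" "match h e (\<mu> e) \<sigma>" by blast
  from \<sigma>(2) obtain U \<nu> where U: "open U" "e \<in> U" "continuous_on U \<nu>"
    "strict_mono_on U (\<lambda>x. \<sigma> * \<nu> x)" "\<nu> e = \<mu> e" "\<And>x. x \<in> U \<Longrightarrow> \<phi> h (\<gamma> x) = \<gamma> (\<nu> x)"
    by (elim matchE) blast
  obtain r where r: "r > 0" "inj_on \<gamma> {\<mu> e - r<..<\<mu> e + r}"
    using locally_inj[OF eI(2)] by blast
  define V where "V = U \<inter> \<nu> -` {\<mu> e - r<..<\<mu> e + r}"
  have "open V" "e \<in> V"
    using continuous_open_preimage[OF U(3,1), of "{\<mu> e - r<..<\<mu> e + r}"] U r by (auto simp: V_def)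
  then obtain c where c: "c > 0" "\<And>x. \<bar>x - e\<bar> < c \<Longrightarrow> x \<in> V"
    unfolding open_dist dist_real_def by metis
  obtain x where x: "x \<in> E" "x \<noteq> e" "\<bar>x - e\<bar> < min c r" "\<bar>\<mu> x - \<mu> e\<bar> < min c r"
    using near[of "min c r"] c(1) r(1) by auto
  have xV: "x \<in> U" "\<nu> x \<in> {\<mu> e - r<..<\<mu> e + r}" using c(2)[of x] x(3) by (auto simp: V_def)
  have "\<gamma> (\<nu> x) = \<gamma> (\<mu> x)" using U(6)[OF xV(1)] eq[OF x(1)] by simp
  moreover have "\<mu> x \<in> {\<mu> e - r<..<\<mu> e + r}" using x(4) by auto
  ultimately have \<nu>x: "\<nu> x = \<mu> x" using inj_onD[OF r(2)] xV(2) by blast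
  have "\<sigma> = \<tau>"
    using strict_mono_on_scaled_cancel[OF U(4) U(2) xV(1)] strict_mono_on_scaled_cancel[OF U(4) xV(1) U(2)]
      strict_mono_on_scaled_cancel[OF \<tau>(2) e x(1)] strict_mono_on_scaled_cancel[OF \<tau>(2) x(1) e]
      \<sigma>(1) \<tau>(1) \<nu>x U(5) x(2)
    by (cases "x < e") auto
  with \<sigma>(2) show ?thesis by simp
qed

lemma leads_to_viaD:
  assumes "leads_to_via M A (\<phi> h \<circ> \<gamma>) C \<gamma> E \<mu>"
  shows "E \<subseteq> A" "nondeg_interval E" "nondeg_interval C" "\<mu> ` E = C" "continuous_on E \<mu>"
    and "\<And>x. x \<in> E \<Longrightarrow> \<phi> h (\<gamma> x) = \<gamma> (\<mu> x)"
    and "E = A \<and> compact C \<or> half_open E \<and> half_open C \<and> (Inf A \<in> E \<or> Sup A \<in> E)"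
    and "\<exists>\<tau>\<in>{1, -1}. strict_mono_on E (\<lambda>x. \<tau> * \<mu> x)"
  using assms analytic_interval_diffeoD[of E C \<mu>] unfolding leads_to_via_def by auto

lemma leads_to_via_match:
  assumes "leads_to_via M A (\<phi> h \<circ> \<gamma>) C \<gamma> E \<mu>" "h \<in> carrier G" "A \<subseteq> I" "C \<subseteq> I"
    "\<tau> \<in> {1, -1}" "strict_mono_on E (\<lambda>x. \<tau> * \<mu> x)" "e \<in> E"
  shows "match h e (\<mu> e) \<tau>"
  using leads_to_viaD[OF assms(1)] assms(2-) by (intro match_reparametrization[of _ E]) auto

text \<open>
  Let \<open>b\<close> be the end of the target from which the target extends in the direction \<open>\<epsilon>\<close>. As a monotone
  image, \<open>b\<close> comes from an end of \<open>E\<close>. That end is one of \<open>p\<close> and \<open>q\<close>: if \<open>E\<close> is not the whole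
  interval it is half-open, and the only endpoint that it contains is an endpoint of \<open>{p..q}\<close>.
\<close>

lemma leads_to_via_endpoint:
  assumes L: "leads_to_via M {p..q} (\<phi> h \<circ> \<gamma>) C \<gamma> E \<mu>" and pq: "p < q"
    and \<tau>: "\<tau> \<in> {1, -1}" "strict_mono_on E (\<lambda>x. \<tau> * \<mu> x)"
    and \<epsilon>: "\<epsilon> \<in> {1, -1}" and b: "b \<in> C" "\<And>x. x \<in> C \<Longrightarrow> \<epsilon> * b \<le> \<epsilon> * x"
  shows "(if \<tau> = \<epsilon> then p else q) \<in> E" "\<mu> (if \<tau> = \<epsilon> then p else q) = b"
proof -
  note E = leads_to_viaD[OF L]
  obtain e where e: "e \<in> E" "\<mu> e = b" using E(4) b(1) by auto
  have ext: "if \<tau> = \<epsilon> then e \<le> x else x \<le> e" if "x \<in> E" for x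
  proof -
    have "\<mu> x \<in> C" using E(4) that by blast
    then have "\<epsilon> * \<mu> e \<le> \<epsilon> * \<mu> x" using b(2) e(2) by simp
    then show ?thesis
      using strict_mono_on_scaled_cancel[OF \<tau>(2) that e(1)] strict_mono_on_scaled_cancel[OF \<tau>(2) e(1) that]
        \<tau>(1) \<epsilon> by auto
  qed
  have epq: "p \<le> e" "e \<le> q" using e(1) E(1) by auto
  have "e = (if \<tau> = \<epsilon> then p else q)"
  proof (cases "p \<in> E \<and> q \<in> E")
    case True
    with ext[of p] ext[of q] epq show ?thesis by (auto split: if_splits)
  next
    case False
    then have ho: "half_open E" and "p \<in> E \<or> q \<in> E"
      using E(7) pq by auto
    then consider "p \<in> E" "q \<notin> E" | "q \<in> E" "p \<notin> E" using False by blast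
    then show ?thesis
    proof cases
      case 1
      have "\<tau> = \<epsilon>"
      proof (rule ccontr)
        assume "\<tau> \<noteq> \<epsilon>"
        then have "p \<le> x \<and> x \<le> e" if "x \<in> E" for x using ext[OF that] E(1) that by auto
        then show False using half_open_no_min_max[OF ho 1(1) e(1)] by blast
      qed
      with ext[OF 1(1)] epq show ?thesis by auto
    next
      case 2
      have "\<tau> \<noteq> \<epsilon>"
      proof
        assume "\<tau> = \<epsilon>"
        then have "e \<le> x \<and> x \<le> q" if "x \<in> E" for x using ext[OF that] E(1) that by auto
        then show False using half_open_no_min_max[OF ho e(1) 2(1)] by blast
      qed
      with ext[OF 2(1)] epq show ?thesis by auto
    qed
  qed
  with e show "(if \<tau> = \<epsilon> then p else q) \<in> E" "\<mu> (if \<tau> = \<epsilon> then p else q) = b" by auto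
qed

text \<open>
  Both \<open>g\<close> and \<open>h\<close> carry points of the interior of \<open>{p..q}\<close> to points of \<open>C\<close> near \<open>b\<close>. Hence
  \<open>inv g \<otimes> h\<close> matches two interior points of the free interval \<open>{p..q}\<close> and lies in \<open>S\<close>. Then the
  identity matches these points too, with the product of the two signs, which is not \<open>-1\<close>.
\<close>

lemma leads_to_via_determined:
  assumes L: "leads_to_via M {p..q} (\<phi> g \<circ> \<gamma>) C \<gamma> E \<mu>" and pq: "p < q"
    and free: "free_interval G M \<phi> I \<gamma> {p..q}" and CI: "C \<subseteq> I"
    and g: "g \<in> carrier G" and h: "h \<in> carrier G"
    and \<tau>: "\<tau> \<in> {1, -1}" "strict_mono_on E (\<lambda>x. \<tau> * \<mu> x)"
    and \<epsilon>: "\<epsilon> \<in> {1, -1}" and b: "b \<in> C" "\<And>x. x \<in> C \<Longrightarrow> \<epsilon> * b \<le> \<epsilon> * x"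
    and \<sigma>: "\<sigma> \<in> {1, -1}" and m: "match h (if \<sigma> = \<epsilon> then p else q) b \<sigma>"
  shows "inv g \<otimes> h \<in> S" "\<tau> = \<sigma>"
proof -
  note E = leads_to_viaD[OF L]
  define e' where "e' = (if \<tau> = \<epsilon> then p else q)"
  define e where "e = (if \<sigma> = \<epsilon> then p else q)"
  have AI: "{p..q} \<subseteq> I" using free by (simp add: free_interval_def)
  have e': "e' \<in> E" "\<mu> e' = b"
    using leads_to_via_endpoint[OF L pq \<tau> \<epsilon> b] by (auto simp: e'_def)
  \<comment> \<open>staying on the near side of \<open>\<mu> y0\<close> keeps the preimages in the interior of \<open>{p..q}\<close>\<close>
  obtain y0 where y0: "y0 \<in> E" "y0 \<noteq> e'"
    using nondeg_interval_approximable[OF E(2) e'(1), of 1] by auto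
  have muy0: "\<mu> y0 \<in> C" using y0(1) E(4) by blast
  have "\<mu> y0 \<noteq> b"
    using strict_mono_on_scaled_cancel[OF \<tau>(2) y0(1) e'(1)] strict_mono_on_scaled_cancel[OF \<tau>(2) e'(1) y0(1)]
      y0(2) e'(2) by auto
  then have c0: "\<epsilon> * b < \<epsilon> * \<mu> y0" using b(2)[OF muy0] \<epsilon> by auto
  from m obtain U \<nu> where U: "open U" "e \<in> U" "continuous_on U \<nu>"
    "strict_mono_on U (\<lambda>x. \<sigma> * \<nu> x)" "\<nu> e = b" "\<And>x. x \<in> U \<Longrightarrow> match h x (\<nu> x) \<sigma>"
    by (elim matchE) (auto simp: e_def)
  define V where "V = U \<inter> \<nu> -` {y. \<epsilon> * y < \<epsilon> * \<mu> y0}"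
  have "open {y. \<epsilon> * y < \<epsilon> * \<mu> y0}"
    by (intro open_Collect_less continuous_intros)
  then have "open V"
    unfolding V_def by (rule continuous_open_preimage[OF U(3,1)])
  moreover have "e \<in> V" using U(2,5) c0 by (simp add: V_def)
  ultimately obtain d where d: "d > 0" "\<And>x. \<bar>x - e\<bar> < d \<Longrightarrow> x \<in> V"
    unfolding open_dist dist_real_def by metis
  define u where "u = min d (q - p) / 2"
  define x where "x = (if \<sigma> = \<epsilon> then e + u else e - u)"
  have u: "0 < u" "u < d" "u < q - p" using d(1) pq by (auto simp: u_def)
  have xA: "p < x" "x < q" using u by (auto simp: x_def e_def)
  have xV: "x \<in> U" "\<epsilon> * \<nu> x < \<epsilon> * \<mu> y0" using d(2)[of x] u by (auto simp: x_def V_def)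
  have bx: "\<epsilon> * b < \<epsilon> * \<nu> x"
    using strict_mono_on_scaled_cancel[OF U(4) U(2) xV(1)] strict_mono_on_scaled_cancel[OF U(4) xV(1) U(2)]
      U(5) u(1) \<sigma> \<epsilon> by (auto simp: x_def split: if_splits)
  have "connected C" using E(3) by (simp add: nondeg_interval_def)
  then have "{b..\<mu> y0} \<subseteq> C" "{\<mu> y0..b} \<subseteq> C"
    using connected_contains_Icc b(1) muy0 by blast+
  then have "\<nu> x \<in> C" using bx xV(2) \<epsilon> by auto
  then obtain y where y: "y \<in> E" "\<mu> y = \<nu> x" using E(4) by (metis imageE)
  have "\<epsilon> * \<mu> e' < \<epsilon> * \<mu> y" "\<epsilon> * \<mu> y < \<epsilon> * \<mu> y0" using bx xV(2) y(2) e'(2) by auto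
  then have "if \<tau> = \<epsilon> then e' < y \<and> y < y0 else y0 < y \<and> y < e'"
    using strict_mono_on_scaled_cancel[OF \<tau>(2) e'(1) y(1)] strict_mono_on_scaled_cancel[OF \<tau>(2) y(1) e'(1)]
      strict_mono_on_scaled_cancel[OF \<tau>(2) y0(1) y(1)] strict_mono_on_scaled_cancel[OF \<tau>(2) y(1) y0(1)]
      \<tau>(1) \<epsilon> by auto
  moreover have "e' \<in> {p..q}" "y0 \<in> {p..q}" using E(1) e'(1) y0(1) by auto
  ultimately have yA: "p < y" "y < q" by (auto split: if_splits)
  have "match g y (\<nu> x) \<tau>"
    using leads_to_via_match[OF L g AI CI \<tau> y(1)] y(2) by simp
  then have "match (inv g) (\<nu> x) y \<tau>"
    using match_inv[OF g _ \<tau>(1)] by simp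
  then have mm: "match (inv g \<otimes> h) x y (\<tau> * \<sigma>)"
    using match_mult[OF h _ U(6)[OF xV(1)] _ \<tau>(1)] g by simp
  show S: "inv g \<otimes> h \<in> S"
  proof (rule free_intervalD[OF free _ mm])
    show "\<tau> * \<sigma> \<in> {1, -1}" using \<tau>(1) \<sigma> by auto
  qed (use g h xA yA in auto)
  have "match \<one> x y (\<tau> * \<sigma>)"
    using mm by (rule match_cong) (use act_one point stab_eq[OF S] in auto)
  then have "\<tau> * \<sigma> \<noteq> -1" using no_reversal by auto
  then show "\<tau> = \<sigma>" using \<tau>(1) \<sigma> by auto
qed

end

section \<open>Decompositions\<close>

lemma alt_sign_minus_power:
  assumes "\<epsilon> \<in> {1, -1}" "n \<ge> 1"
  shows "alt_sign (\<epsilon> * int n) = - (\<epsilon> * (-1) ^ n)"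
proof -
  obtain m where m: "n = Suc m" using assms(2) by (cases n) auto
  from assms(1) consider "\<epsilon> = 1" | "\<epsilon> = -1" by blast
  then show ?thesis
    by cases (simp_all add: alt_sign_def m del: of_nat_Suc, simp_all add: nat_diff_distrib)
qed

lemma scaled_less_iff:
  fixes \<mu> :: "real \<Rightarrow> real"
  assumes \<tau>: "\<tau> \<in> {1, -1}" "strict_mono_on E (\<lambda>x. \<tau> * \<mu> x)" and \<epsilon>: "\<epsilon> \<in> {1, -1}"
    and x: "x \<in> E" and y: "y \<in> E"
  shows "\<epsilon> * \<mu> x < \<epsilon> * \<mu> y \<longleftrightarrow> (if \<tau> = \<epsilon> then x < y else y < x)"
proof (cases "\<tau> = \<epsilon>")
  case True
  then show ?thesis using strict_mono_on_scaled_cancel[OF \<tau>(2) x y] by simp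
next
  case False
  then have "\<epsilon> = - \<tau>" using \<tau>(1) \<epsilon> by auto
  then show ?thesis using strict_mono_on_scaled_cancel[OF \<tau>(2) y x] False by simp
qed

lemma sign_product_eq_1_iff:
  fixes \<epsilon> s :: int and \<tau> :: real
  assumes "\<epsilon> \<in> {1, -1}" "\<tau> \<in> {1, -1}" "of_int \<epsilon> * \<tau> = of_int s"
  shows "\<tau> = of_int \<epsilon> \<longleftrightarrow> s = 1"
proof -
  have "real_of_int s = of_int (\<epsilon> * (if \<tau> = 1 then 1 else -1))"
    unfolding assms(3)[symmetric] using assms(2) by (cases "\<tau> = 1") simp_all
  then have s: "s = \<epsilon> * (if \<tau> = 1 then 1 else -1)" by (simp only: of_int_eq_iff)
  have "\<epsilon> = 1 \<or> \<epsilon> = -1" "\<tau> = 1 \<or> \<tau> = -1" using assms(1,2) by simp_all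
  then show ?thesis unfolding s by (elim disjE) simp_all
qed

lemma (in group) alternating_product_Suc:
  assumes g: "g 1 \<in> carrier G" "g (-1) \<in> carrier G" and \<epsilon>: "\<epsilon> \<in> {1, -1}"
  shows "alternating_product G g (\<epsilon> * int (Suc n)) =
           alternating_product G g (\<epsilon> * int n) \<otimes> g (alt_sign (\<epsilon> * int (Suc n)))"
    and "alternating_product G g (\<epsilon> * int n) \<in> carrier G"
proof -
  let ?f = "\<lambda>k h. g (alt_sign (k * \<epsilon>)) \<otimes> h"
  have "alt_sign k = 1 \<or> alt_sign k = -1" for k
    by (auto simp: alt_sign_def minus_one_power_iff)
  then have gc: "g (alt_sign k) \<in> carrier G" for k using g by metis
  have closed: "foldr ?f xs \<one> \<in> carrier G" for xs
    by (induction xs) (auto simp: gc)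
  have append: "foldr ?f xs h = foldr ?f xs \<one> \<otimes> h" if "h \<in> carrier G" for xs h
    by (induction xs) (use that closed gc in \<open>auto simp: m_assoc\<close>)
  have ap: "alternating_product G g (\<epsilon> * int m) = foldr ?f [1..int m] \<one>" for m
  proof (cases "m = 0")
    case False
    then have "sgn (\<epsilon> * int m) = \<epsilon>" "\<bar>\<epsilon> * int m\<bar> = int m" using \<epsilon> by (auto simp: abs_mult)
    then show ?thesis by (simp add: alternating_product_def)
  qed (simp add: alternating_product_def)
  show "alternating_product G g (\<epsilon> * int n) \<in> carrier G"
    unfolding ap by (rule closed)
  have "[1..int (Suc n)] = [1..int n] @ [int (Suc n)]"
    using upto_rec2[of 1 "int (Suc n)"] by simp
  then show "alternating_product G g (\<epsilon> * int (Suc n)) =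
           alternating_product G g (\<epsilon> * int n) \<otimes> g (alt_sign (\<epsilon> * int (Suc n)))"
    unfolding ap using append[of "g (alt_sign (int (Suc n) * \<epsilon>)) \<otimes> \<one>" "[1..int n]"] gc
    by (simp add: mult.commute)
qed

context analytic_curve_action
begin

text \<open>
  If \<open>h \<otimes> r \<otimes> inv h\<close> fixes \<open>\<gamma>\<close>, then \<open>r\<close> fixes every point that \<open>h\<close> moves to a point of \<open>\<gamma>\<close>;
  a match supplies a whole arc of such points.
\<close>

lemma conjugate_not_stab:
  assumes h: "h \<in> carrier G" and r: "r \<in> carrier G" "r \<notin> S" and m: "match h s t \<sigma>"
  shows "h \<otimes> r \<otimes> inv h \<notin> S"
proof
  assume S: "h \<otimes> r \<otimes> inv h \<in> S"
  from m obtain U \<nu> where U: "open U" "s \<in> U" "U \<subseteq> I" "\<nu> ` U \<subseteq> I"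
    "\<And>x. x \<in> U \<Longrightarrow> \<phi> h (\<gamma> x) = \<gamma> (\<nu> x)"
    by (elim matchE) blast
  have "\<phi> r (\<gamma> x) = \<gamma> x" if x: "x \<in> U" for x
  proof -
    have xI: "x \<in> I" "\<nu> x \<in> I" using U x by auto
    have "h \<otimes> r = h \<otimes> r \<otimes> inv h \<otimes> h" using h r by (simp add: m_assoc)
    then have "\<phi> h (\<phi> r (\<gamma> x)) = \<phi> (h \<otimes> r \<otimes> inv h) (\<phi> h (\<gamma> x))"
      using act_mult[OF h r(1) point[OF xI(1)]] act_mult[OF stab_carrier[OF S] h point[OF xI(1)]] by simp
    also have "\<dots> = \<phi> h (\<gamma> x)" using U(5)[OF x] stab_eq[OF S xI(2)] by simp
    finally show ?thesis
      using act_inv[OF h] act_point[OF r(1) xI(1)] point[OF xI(1)] by metis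
  qed
  moreover have "\<forall>\<^sub>F x in nhds s. x \<in> U" using U(1,2) by (rule eventually_nhds_in_open)
  ultimately have "\<forall>\<^sub>F x in at s. \<phi> r (\<gamma> x) = \<gamma> x"
    by (auto simp: eventually_at_filter elim: eventually_mono)
  then have "\<exists>\<^sub>F x in at s. \<phi> r (\<gamma> x) = \<gamma> x"
    by (rule eventually_frequently[OF trivial_limit_at])
  with r(1) U have "r \<in> S" by (intro stab_agree) auto
  with r(2) show False by simp
qed

text \<open>
  A match of \<open>h\<close> inside \<open>C\<close> becomes a match of \<open>inv g \<otimes> (h \<otimes> g)\<close> inside \<open>A\<close>.
\<close>

lemma leads_to_via_free:
  assumes L: "leads_to_via M A (\<phi> g \<circ> \<gamma>) C \<gamma> E \<mu>" and g: "g \<in> carrier G"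
    and free: "free_interval G M \<phi> I \<gamma> A" and C: "C \<subseteq> I"
  shows "free_interval G M \<phi> I \<gamma> C"
proof -
  note E = leads_to_viaD[OF L]
  have AI: "A \<subseteq> I" using free by (simp add: free_interval_def)
  obtain \<tau> where \<tau>: "\<tau> \<in> {1, -1}" "strict_mono_on E (\<lambda>x. \<tau> * \<mu> x)" using E(8) by blast
  have lift: "\<exists>x\<in>interior A. match g x s \<tau>" if s: "s \<in> interior C" for s
  proof -
    obtain d where d: "d > 0" "\<And>y. \<bar>y - s\<bar> < d \<Longrightarrow> y \<in> C"
      using s unfolding mem_interior subset_iff mem_ball dist_real_def by (metis abs_minus_commute)
    have "s \<in> C" "s - d / 2 \<in> C" "s + d / 2 \<in> C" using d by auto
    then obtain x y z where xyz: "x \<in> E" "y \<in> E" "z \<in> E" "\<mu> x = s" "\<mu> y = s - d / 2" "\<mu> z = s + d / 2"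
      using E(4) by (metis imageE)
    have "min y z < x \<and> x < max y z"
    proof (cases "\<tau> = 1")
      case True
      then have "y < x" "x < z"
        using strict_mono_on_scaled_cancel[OF \<tau>(2) xyz(2,1)] strict_mono_on_scaled_cancel[OF \<tau>(2) xyz(1,3)]
          xyz(4-6) d(1) by simp_all
      then show ?thesis by simp
    next
      case False
      then have "\<tau> = -1" using \<tau>(1) by simp
      then have "x < y" "z < x"
        using strict_mono_on_scaled_cancel[OF \<tau>(2) xyz(1,2)] strict_mono_on_scaled_cancel[OF \<tau>(2) xyz(3,1)]
          xyz(4-6) d(1) by simp_all
      then show ?thesis by simp
    qed
    moreover have "{min y z..max y z} \<subseteq> A"
    proof -
      have "connected E" using E(2) by (simp add: nondeg_interval_def)
      then have "{y..z} \<subseteq> E" "{z..y} \<subseteq> E" using xyz(2,3) connected_contains_Icc by blast+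
      then show ?thesis using E(1) by (auto simp: min_def max_def)
    qed
    ultimately have "x \<in> interior A"
      by (intro interiorI[of "{min y z<..<max y z}"]) (auto simp: subset_iff)
    moreover have "match g x s \<tau>"
      using leads_to_via_match[OF L g AI C \<tau> xyz(1)] xyz(4) by simp
    ultimately show ?thesis by blast
  qed
  have "h \<in> S" if h: "h \<in> carrier G" and st: "s \<in> interior C" "t \<in> interior C"
    and \<sigma>: "\<sigma> \<in> {1, -1}" and m: "match h s t \<sigma>" for h s t \<sigma>
  proof -
    obtain x y where x: "x \<in> interior A" "match g x s \<tau>" and y: "y \<in> interior A" "match g y t \<tau>"
      using lift st by meson
    have "match (h \<otimes> g) x t (\<sigma> * \<tau>)" using match_mult[OF g h x(2) m \<sigma>] .
    moreover have "match (inv g) t y \<tau>" using match_inv[OF g y(2) \<tau>(1)] .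
    ultimately have "match (inv g \<otimes> (h \<otimes> g)) x y (\<tau> * (\<sigma> * \<tau>))"
      by (rule match_mult[OF m_closed[OF h g] inv_closed[OF g] _ _ \<tau>(1)])
    then have k: "inv g \<otimes> (h \<otimes> g) \<in> S"
      by (rule free_intervalD[OF free _ _ _ x(1) y(1), rotated]) (use g h \<tau>(1) \<sigma> in auto)
    show "h \<in> S"
    proof (rule stab_agree_interval[OF h C E(3)])
      fix z assume "z \<in> C"
      then obtain w where w: "w \<in> E" "\<mu> w = z" using E(4) by (metis imageE)
      have wI: "w \<in> I" using w E(1) AI by auto
      have "h \<otimes> g = g \<otimes> (inv g \<otimes> (h \<otimes> g))" using g h by (simp add: m_assoc[symmetric])
      then have "\<phi> h (\<phi> g (\<gamma> w)) = \<phi> g (\<phi> (inv g \<otimes> (h \<otimes> g)) (\<gamma> w))"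
        using act_mult[OF h g point[OF wI]] act_mult[OF g stab_carrier[OF k] point[OF wI]] by simp
      then show "\<phi> h (\<gamma> z) = \<gamma> z"
        using E(6)[OF w(1)] w(2) stab_eq[OF k wI] by simp
    qed
  qed
  then show ?thesis
    using free_interval_iff[OF C E(3)] by blast
qed

end

text \<open>
  The left and the right half of a decomposition are treated simultaneously: indices are written
  \<open>\<epsilon> * n\<close> with \<open>\<epsilon> \<in> {1, -1}\<close> and \<open>n \<ge> 1\<close>, and comparisons are multiplied by \<open>\<epsilon>\<close>.
\<close>

locale curve_decomposition = analytic_curve_action G M \<phi> I \<gamma>
  for G :: "('g, 'z) monoid_scheme" (structure)
    and M :: "'m chart_structure" and \<phi> :: "'g \<Rightarrow> 'm \<Rightarrow> 'm"
    and I :: "real set" and \<gamma> :: "real \<Rightarrow> 'm" +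
  fixes A :: "real set" and nm np :: "int extended" and a :: "int \<Rightarrow> real" and g :: "int \<Rightarrow> 'g"
  assumes decomposition: "A_decomposition G M \<phi> I \<gamma> A nm np a g"
    and free: "free_interval G M \<phi> I \<gamma> A"
begin

abbreviation "idx \<equiv> decomp_index nm np"
abbreviation "D \<equiv> decomp_interval I nm np a"

lemma bounds: "nm < 0" "0 < np"
  using decomposition unfolding A_decomposition_def by blast+

lemma unit_in_idx: "\<epsilon> \<in> {1, -1} \<Longrightarrow> \<epsilon> \<in> idx"
  using bounds by (cases nm; cases np) (auto simp: decomp_index_def zero_extended_def)

lemma in_range_iff: "nm \<le> Fin n \<and> Fin n \<le> np \<longleftrightarrow> n = 0 \<or> n \<in> idx"
  using bounds by (cases nm; cases np) (auto simp: decomp_index_def zero_extended_def)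

lemma idx_down:
  assumes "\<epsilon> \<in> {1, -1}" "\<epsilon> * n \<in> idx" "1 \<le> k" "k \<le> n"
  shows "\<epsilon> * k \<in> idx"
  using assms bounds by (cases nm; cases np) (auto simp: decomp_index_def zero_extended_def)

lemma a_in: "n \<in> idx \<Longrightarrow> a n \<in> I" and g_carrier: "n \<in> idx \<Longrightarrow> g n \<in> carrier G"
  using decomposition unfolding A_decomposition_def by blast+

lemma a_less: "m \<in> idx \<Longrightarrow> n \<in> idx \<Longrightarrow> m < n \<Longrightarrow> a m < a n"
  using decomposition unfolding A_decomposition_def by (blast dest: strict_mono_onD)

lemma D_0: "D 0 = A"
  using decomposition unfolding A_decomposition_def by blast

lemma A_eq: "A = {a (-1)..a 1}"
  using D_0 by (simp add: decomp_interval_def)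

lemma A_less: "a (-1) < a 1"
  using a_less unit_in_idx by simp

lemma A_subset: "A \<subseteq> I"
  using free by (simp add: free_interval_def)

lemma D_eq:
  assumes \<epsilon>: "\<epsilon> \<in> {1, -1}" and n: "n \<ge> 1" "\<epsilon> * n \<in> idx"
  shows "D (\<epsilon> * n) = {x \<in> I. of_int \<epsilon> * a (\<epsilon> * n) \<le> of_int \<epsilon> * x \<and>
           (\<epsilon> * (n + 1) \<in> idx \<longrightarrow> of_int \<epsilon> * x \<le> of_int \<epsilon> * a (\<epsilon> * (n + 1)))}"
proof (cases "\<epsilon> * (n + 1) \<in> idx")
  case True
  have eq: "{l..u} = {x \<in> I. l \<le> x \<and> x \<le> u}" if "l \<in> I" "u \<in> I" for l u
    using I_convex[OF that] by (auto simp: subset_eq)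
  from \<epsilon> consider "\<epsilon> = 1" | "\<epsilon> = -1" by blast
  then show ?thesis
  proof cases
    case 1
    then have "np \<noteq> Fin n" "n \<in> idx" "n + 1 \<in> idx" using True n by (auto simp: decomp_index_def)
    then show ?thesis
      using n(1) 1 eq[OF a_in a_in, of n "n + 1"] by (simp add: decomp_interval_def)
  next
    case 2
    then have "nm \<noteq> Fin (- n)" "- n \<in> idx" "- n - 1 \<in> idx" using True n by (auto simp: decomp_index_def)
    then show ?thesis
      using n(1) 2 eq[OF a_in a_in, of "- n - 1" "- n"]
      by (simp add: decomp_interval_def conj_commute)
  qed
next
  case False
  from \<epsilon> consider "\<epsilon> = 1" | "\<epsilon> = -1" by blast
  then show ?thesis
  proof cases
    case 1
    then have "np = Fin n"
      using n False bounds by (cases nm; cases np) (simp_all add: decomp_index_def zero_extended_def)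
    then show ?thesis using 1 n(1) False by (simp add: decomp_interval_def)
  next
    case 2
    then have "nm = Fin (- n)"
      using n False bounds by (cases nm; cases np) (simp_all add: decomp_index_def zero_extended_def)
    then show ?thesis using 2 n(1) False by (simp add: decomp_interval_def)
  qed
qed

lemma a_step:
  assumes \<epsilon>: "\<epsilon> \<in> {1, -1}" and n: "n \<ge> 1" "\<epsilon> * (n + 1) \<in> idx"
  shows "of_int \<epsilon> * a (\<epsilon> * n) < of_int \<epsilon> * a (\<epsilon> * (n + 1))"
proof -
  have "\<epsilon> * n \<in> idx" using idx_down[OF \<epsilon> n(2), of n] n(1) by simp
  from \<epsilon> consider "\<epsilon> = 1" | "\<epsilon> = -1" by blast
  then show ?thesis
    using a_less[OF \<open>\<epsilon> * n \<in> idx\<close> n(2)] a_less[OF n(2) \<open>\<epsilon> * n \<in> idx\<close>] by cases simp_all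
qed

lemma D_facts:
  assumes \<epsilon>: "\<epsilon> \<in> {1, -1}" and n: "n \<ge> 1" "\<epsilon> * n \<in> idx"
  shows "D (\<epsilon> * n) \<subseteq> I" "a (\<epsilon> * n) \<in> D (\<epsilon> * n)"
    and "\<And>x. x \<in> D (\<epsilon> * n) \<Longrightarrow> of_int \<epsilon> * a (\<epsilon> * n) \<le> of_int \<epsilon> * x"
    and "\<epsilon> * (n + 1) \<in> idx \<Longrightarrow> a (\<epsilon> * (n + 1)) \<in> D (\<epsilon> * n)"
    and "\<And>x. \<epsilon> * (n + 1) \<in> idx \<Longrightarrow> x \<in> D (\<epsilon> * n) \<Longrightarrow> of_int \<epsilon> * x \<le> of_int \<epsilon> * a (\<epsilon> * (n + 1))"
  unfolding D_eq[OF \<epsilon> n] using a_in[OF n(2)] a_in less_imp_le[OF a_step[OF \<epsilon> n(1)]] by simp_all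

lemma leads_to_D:
  assumes "n \<in> idx"
  obtains E \<mu> \<tau> where "leads_to_via M A (\<phi> (g n) \<circ> \<gamma>) (D n) \<gamma> E \<mu>"
    "\<tau> \<in> {1, -1}" "strict_mono_on E (\<lambda>x. \<tau> * \<mu> x)"
proof -
  obtain E \<mu> where "leads_to_via M A (\<phi> (g n) \<circ> \<gamma>) (D n) \<gamma> E \<mu>"
    using decomposition assms unfolding A_decomposition_def leads_to_def by blast
  with leads_to_viaD(8)[OF this] that show thesis by blast
qed

lemma leads_to_D_determined:
  assumes \<epsilon>: "\<epsilon> \<in> {1, -1}" and n: "n \<ge> 1" "\<epsilon> * n \<in> idx"
    and h: "h \<in> carrier G" and \<sigma>: "\<sigma> \<in> {1, -1}"
    and m: "match h (if \<sigma> = of_int \<epsilon> then a (-1) else a 1) (a (\<epsilon> * n)) \<sigma>"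
    and L: "leads_to_via M A (\<phi> (g (\<epsilon> * n)) \<circ> \<gamma>) (D (\<epsilon> * n)) \<gamma> E \<mu>"
    and \<tau>: "\<tau> \<in> {1, -1}" "strict_mono_on E (\<lambda>x. \<tau> * \<mu> x)"
  shows "inv (g (\<epsilon> * n)) \<otimes> h \<in> S" "\<tau> = \<sigma>"
proof -
  note D = D_facts(1-3)[OF \<epsilon> n]
  have \<epsilon>': "of_int \<epsilon> \<in> {1, -1 :: real}" using \<epsilon> by auto
  have "inv (g (\<epsilon> * n)) \<otimes> h \<in> S \<and> \<tau> = \<sigma>"
    using leads_to_via_determined[OF L[unfolded A_eq] A_less free[unfolded A_eq] D(1)
      g_carrier[OF n(2)] h \<tau> \<epsilon>' D(2,3) \<sigma> m] by blast
  then show "inv (g (\<epsilon> * n)) \<otimes> h \<in> S" "\<tau> = \<sigma>" by auto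
qed

lemma idx_cases:
  assumes "m \<in> idx"
  obtains \<epsilon> n where "\<epsilon> \<in> {1, -1}" "n \<ge> 1" "m = \<epsilon> * int n" "\<epsilon> * int n \<in> idx"
proof (cases "m > 0")
  case True
  with assms show thesis by (intro that[of 1 "nat m"]) auto
next
  case False
  moreover have "m \<noteq> 0" using assms by (simp add: decomp_index_def)
  ultimately show thesis using assms by (intro that[of "-1" "nat (- m)"]) auto
qed

lemma D_subset: "n = 0 \<or> n \<in> idx \<Longrightarrow> D n \<subseteq> I"
proof (elim disjE)
  assume "n \<in> idx"
  then obtain \<epsilon> k where "\<epsilon> \<in> {1, -1}" "k \<ge> 1" "n = \<epsilon> * int k" "\<epsilon> * int k \<in> idx"
    by (rule idx_cases)
  then show ?thesis using D_facts(1)[of \<epsilon> "int k"] by simp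
qed (simp add: D_0 A_subset)

lemma D_free:
  assumes "n = 0 \<or> n \<in> idx"
  shows "free_interval G M \<phi> I \<gamma> (D n)"
  using assms
proof
  assume n: "n \<in> idx"
  obtain E \<mu> where "leads_to_via M A (\<phi> (g n) \<circ> \<gamma>) (D n) \<gamma> E \<mu>"
    using leads_to_D[OF n] by metis
  then show ?thesis using leads_to_via_free free g_carrier[OF n] D_subset n by blast
qed (simp add: D_0 free)

text \<open>
  A decreasing reparametrization of \<open>A\<close>, or of a part of \<open>A\<close>, onto the adjacent piece fixes the
  common endpoint.
\<close>

lemma negative_reflections:
  assumes \<epsilon>: "\<epsilon> \<in> {1, -1}" and neg: "leads_to_neg M A (\<phi> (g \<epsilon>) \<circ> \<gamma>) (D \<epsilon>) \<gamma>"
  shows "\<exists>r\<in>carrier G. r \<notin> S \<and> match r (a \<epsilon>) (a \<epsilon>) (-1)"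
proof -
  have idx: "\<epsilon> \<in> idx" using unit_in_idx[OF \<epsilon>] .
  have gc: "g \<epsilon> \<in> carrier G" using g_carrier[OF idx] .
  obtain E \<mu> where L: "leads_to_via M A (\<phi> (g \<epsilon>) \<circ> \<gamma>) (D \<epsilon>) \<gamma> E \<mu>" and "strict_antimono_on E \<mu>"
    using neg by (auto simp: leads_to_neg_def)
  then have mono: "strict_mono_on E (\<lambda>x. -1 * \<mu> x)" by (auto simp: monotone_on_def)
  have \<epsilon>': "real_of_int \<epsilon> \<in> {1, -1}" using \<epsilon> by auto
  have e: "(if -1 = real_of_int \<epsilon> then a (-1) else a 1) = a \<epsilon>" using \<epsilon> by auto
  note D = D_facts(1-3)[OF \<epsilon>, of 1, simplified, OF idx]
  have "a \<epsilon> \<in> E" "\<mu> (a \<epsilon>) = a \<epsilon>"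
    using leads_to_via_endpoint[OF L[unfolded A_eq] A_less _ mono \<epsilon>' D(2,3)] unfolding e by auto
  then have "match (g \<epsilon>) (a \<epsilon>) (a \<epsilon>) (-1)"
    using leads_to_via_match[OF L gc A_subset D(1) _ mono, of "a \<epsilon>"] by simp
  moreover have "g \<epsilon> \<notin> S"
  proof
    assume "g \<epsilon> \<in> S"
    then have "inv (g \<epsilon>) \<otimes> \<one> \<in> S" using subgroup.m_inv_closed[OF stab_subgroup] gc by simp
    then have "g \<epsilon> <# S = \<one> <# S" using same_coset_iff gc by simp
    moreover have "g \<epsilon> <# S \<noteq> \<one> <# S"
      using decomposition \<epsilon> unfolding A_decomposition_def by blast
    ultimately show False by simp
  qed
  ultimately show ?thesis using gc by blast
qed

end

text \<open>
  A reflection at a point is an element outside \<open>S\<close> that matches the point with itself and reverses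
  the direction. Existence of reflections at the two ends of \<open>A\<close> is assumed without relating
  them to the family \<open>g\<close>, so that the results apply to every decomposition of \<open>A\<close>.
\<close>

section \<open>Propagation of reflections\<close>

locale reflected_decomposition = curve_decomposition +
  assumes reflections: "\<epsilon> \<in> {1, -1} \<Longrightarrow> \<exists>r\<in>carrier G. r \<notin> S \<and> match r (a \<epsilon>) (a \<epsilon>) (-1)"
begin

text \<open>
  A reflection at an end of \<open>A\<close> carries \<open>A\<close> to the other side of this end, where the element of the
  decomposition also carries it; so the two agree modulo \<open>S\<close>.
\<close>

lemma g_reflection:
  assumes \<epsilon>: "\<epsilon> \<in> {1, -1}"
  shows "match (g \<epsilon>) (a \<epsilon>) (a \<epsilon>) (-1)" "g \<epsilon> \<notin> S" "g \<epsilon> \<in> carrier G"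
proof -
  show gc: "g \<epsilon> \<in> carrier G" using g_carrier unit_in_idx[OF \<epsilon>] .
  obtain r where r: "r \<in> carrier G" "r \<notin> S" "match r (a \<epsilon>) (a \<epsilon>) (-1)"
    using reflections[OF \<epsilon>] by blast
  obtain E \<mu> \<tau> where L: "leads_to_via M A (\<phi> (g \<epsilon>) \<circ> \<gamma>) (D \<epsilon>) \<gamma> E \<mu>"
    "\<tau> \<in> {1, -1}" "strict_mono_on E (\<lambda>x. \<tau> * \<mu> x)"
    using leads_to_D[OF unit_in_idx[OF \<epsilon>]] .
  have "a \<epsilon> = (if -1 = real_of_int \<epsilon> then a (-1) else a 1)" using \<epsilon> by auto
  then have S: "inv (g \<epsilon>) \<otimes> r \<in> S"
    using leads_to_D_determined(1)[OF \<epsilon>, of 1 r "-1" E \<mu> \<tau>] unit_in_idx[OF \<epsilon>] r L by simp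
  show "match (g \<epsilon>) (a \<epsilon>) (a \<epsilon>) (-1)"
    using r(3) by (rule match_cong) (use same_coset_act[OF gc r(1) S] in simp)
  show "g \<epsilon> \<notin> S"
  proof
    assume "g \<epsilon> \<in> S"
    then have "g \<epsilon> \<otimes> (inv (g \<epsilon>) \<otimes> r) \<in> S"
      using subgroup.m_closed[OF stab_subgroup] S by blast
    with gc r(1,2) show False by (simp add: m_assoc[symmetric])
  qed
qed

abbreviation "alt \<equiv> alternating_product G g"

lemma alt_carrier: "\<epsilon> \<in> {1, -1} \<Longrightarrow> alt (\<epsilon> * int n) \<in> carrier G"
  by (rule alternating_product_Suc(2)[OF g_reflection(3) g_reflection(3)]) auto

lemma alt_Suc:
  "\<epsilon> \<in> {1, -1} \<Longrightarrow> alt (\<epsilon> * int (Suc n)) = alt (\<epsilon> * int n) \<otimes> g (alt_sign (\<epsilon> * int (Suc n)))"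
  by (rule alternating_product_Suc(1)[OF g_reflection(3) g_reflection(3)]) auto

lemma near_endpoint:
  assumes "\<epsilon> \<in> {1, -1}" "n \<ge> 1"
  shows "a (alt_sign (\<epsilon> * int n)) = (if (-1) ^ n = real_of_int \<epsilon> then a (-1) else a 1)"
  unfolding alt_sign_minus_power[OF assms] using assms(1) by (cases "even n") auto

lemma alt_sign_unit:
  assumes "\<epsilon> \<in> {1, -1}" "n \<ge> 1"
  shows "alt_sign (\<epsilon> * int n) \<in> {1, -1}"
  unfolding alt_sign_minus_power[OF assms] using assms(1) by (cases "even n") auto

text \<open>
  If the piece is not the last one it is a compact interval, whereas partially defined
  reparametrizations have a half-open target.
\<close>

lemma compact_index:
  assumes \<epsilon>: "\<epsilon> \<in> {1, -1}" and n: "n \<ge> 1" "\<epsilon> * (n + 1) \<in> idx"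
    and L: "leads_to_via M A (\<phi> (g (\<epsilon> * n)) \<circ> \<gamma>) (D (\<epsilon> * n)) \<gamma> E \<mu>"
  shows "E = A"
proof (rule ccontr)
  assume "E \<noteq> A"
  then have ho: "half_open (D (\<epsilon> * n))" using leads_to_viaD(7)[OF L] by blast
  have n': "\<epsilon> * n \<in> idx" using idx_down[OF \<epsilon> n(2), of n] n(1) by simp
  note D = D_facts[OF \<epsilon> n(1) n']
  have le: "real_of_int \<epsilon> * a (\<epsilon> * n) \<le> real_of_int \<epsilon> * x \<and>
      real_of_int \<epsilon> * x \<le> real_of_int \<epsilon> * a (\<epsilon> * (n + 1))" if "x \<in> D (\<epsilon> * n)" for x
    using D(3)[OF that] D(5)[OF n(2) that] by simp
  from \<epsilon> consider "\<epsilon> = 1" | "\<epsilon> = -1" by blast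
  then show False
  proof cases
    case 1
    then show False using half_open_no_min_max[OF ho D(2) D(4)[OF n(2)]] le by simp
  next
    case 2
    then show False using half_open_no_min_max[OF ho D(4)[OF n(2)] D(2)] le by simp
  qed
qed

text \<open>
  The two claims are proved by simultaneous induction. The end \<open>a (alt_sign (\<epsilon> * int n))\<close> of \<open>A\<close> is
  the one that is mapped to the near end \<open>a (\<epsilon> * int n)\<close> of the piece. The other end
  \<open>a (alt_sign (\<epsilon> * int (Suc n)))\<close> goes to the far end, and composing with the reflection there
  leads into the next piece.
\<close>

lemma propagation:
  assumes \<epsilon>: "\<epsilon> \<in> {1, -1}" and n: "n \<ge> 1" "\<epsilon> * int n \<in> idx"
  shows "match (alt (\<epsilon> * int n)) (a (alt_sign (\<epsilon> * int n))) (a (\<epsilon> * int n)) ((-1) ^ n)"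
    and "\<exists>r\<in>carrier G. r \<notin> S \<and> match r (a (\<epsilon> * int n)) (a (\<epsilon> * int n)) (-1)"
proof -
  have "match (alt (\<epsilon> * int n)) (a (alt_sign (\<epsilon> * int n))) (a (\<epsilon> * int n)) ((-1) ^ n) \<and>
    (\<exists>r\<in>carrier G. r \<notin> S \<and> match r (a (\<epsilon> * int n)) (a (\<epsilon> * int n)) (-1))"
    using n
  proof (induction n rule: nat_induct_at_least)
    case base
    have "alt_sign \<epsilon> = \<epsilon>" using alt_sign_minus_power[OF \<epsilon>, of 1] by simp
    moreover from this have "alt \<epsilon> = g \<epsilon>"
      using alt_Suc[OF \<epsilon>, of 0] g_reflection(3)[OF \<epsilon>] by (simp add: alternating_product_def)
    ultimately show ?case
      using g_reflection[OF \<epsilon>] by auto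
  next
    case (Suc n)
    let ?n = "\<epsilon> * int n" and ?s = "alt_sign (\<epsilon> * int (Suc n))"
    have n: "int n \<ge> 1" using Suc.hyps by simp
    have idx1: "\<epsilon> * (int n + 1) \<in> idx" using Suc.prems by (simp add: algebra_simps)
    have idx: "?n \<in> idx" using idx_down[OF \<epsilon> idx1, of "int n"] n by simp
    have IH: "match (alt ?n) (a (alt_sign ?n)) (a ?n) ((-1) ^ n)" using Suc.IH idx by blast
    have \<sigma>: "(-1) ^ n \<in> {1, -1 :: real}" by (simp add: minus_one_power_iff)
    obtain E \<mu> \<tau> where L: "leads_to_via M A (\<phi> (g ?n) \<circ> \<gamma>) (D ?n) \<gamma> E \<mu>"
      and \<tau>: "\<tau> \<in> {1, -1}" "strict_mono_on E (\<lambda>x. \<tau> * \<mu> x)"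
      using leads_to_D[OF idx] .
    have gn: "g ?n \<in> carrier G" using g_carrier[OF idx] .
    note h = alt_carrier[OF \<epsilon>, of n]
    have det: "inv (g ?n) \<otimes> alt ?n \<in> S" "\<tau> = (-1) ^ n"
      using leads_to_D_determined[OF \<epsilon> n idx h \<sigma> _ L \<tau>] IH near_endpoint[OF \<epsilon> Suc.hyps] by auto
    have EA: "E = A" using compact_index[OF \<epsilon> n idx1 L] .
    have \<mu>A: "\<mu> ` A = D ?n" using leads_to_viaD(4)[OF L] EA by simp
    have s: "?s \<in> {1, -1}" using alt_sign_unit[OF \<epsilon>, of "Suc n"] by simp
    have sA: "a ?s \<in> A" using s A_eq A_less by auto
    have \<epsilon>': "real_of_int \<epsilon> \<in> {1, -1}" using \<epsilon> by auto
    have s_sign: "of_int \<epsilon> * ((-1) ^ n :: real) = of_int ?s"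
      using alt_sign_minus_power[OF \<epsilon>, of "Suc n"] by simp
    note D = D_facts[OF \<epsilon> n idx]
    have DI: "D ?n \<subseteq> I" by (fact D(1))
    have "\<mu> (a ?s) = a (\<epsilon> * int (Suc n))"
    proof -
      have "a (\<epsilon> * (int n + 1)) \<in> D ?n"
        using D(4) idx1 by simp
      then obtain x where x: "x \<in> A" "\<mu> x = a (\<epsilon> * (int n + 1))" using \<mu>A by (metis imageE)
      have "\<not> of_int \<epsilon> * \<mu> (a ?s) < of_int \<epsilon> * \<mu> x"
      proof
        assume less: "of_int \<epsilon> * \<mu> (a ?s) < of_int \<epsilon> * \<mu> x"
        have x1: "a (-1) \<le> x" "x \<le> a 1" using x(1) A_eq by auto
        have "if \<tau> = of_int \<epsilon> then a ?s < x else x < a ?s"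
          using less scaled_less_iff[OF \<tau> \<epsilon>', of "a ?s" x] sA x(1) EA by simp
        moreover have "\<tau> = of_int \<epsilon> \<longleftrightarrow> ?s = 1"
          by (rule sign_product_eq_1_iff[OF \<epsilon> \<tau>(1)]) (unfold det(2), rule s_sign)
        ultimately have "if ?s = 1 then a ?s < x else x < a ?s" by (simp only:)
        moreover have "?s = 1 \<or> ?s = -1" using s by blast
        ultimately show False using x1 by (elim disjE) (metis less_le_not_le one_neq_neg_one)+
      qed
      moreover have "\<mu> (a ?s) \<in> D ?n" using \<mu>A sA by blast
      then have "of_int \<epsilon> * \<mu> (a ?s) \<le> of_int \<epsilon> * a (\<epsilon> * (int n + 1))"
        using D(5) idx1 by simp
      ultimately have "of_int \<epsilon> * \<mu> (a ?s) = of_int \<epsilon> * a (\<epsilon> * (int n + 1))" using x(2) by simp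
      then show ?thesis using \<epsilon> by (auto simp: algebra_simps)
    qed
    then have "match (g ?n) (a ?s) (a (\<epsilon> * int (Suc n))) \<tau>"
      using leads_to_via_match[OF L gn A_subset DI \<tau>, of "a ?s"] sA EA by simp
    then have m: "match (alt ?n) (a ?s) (a (\<epsilon> * int (Suc n))) ((-1) ^ n)"
      using same_coset_act[OF gn h det(1)] unfolding det(2) by (rule match_cong)
    note r = g_reflection[OF s]
    have m2: "match (alt ?n \<otimes> g ?s) (a ?s) (a (\<epsilon> * int (Suc n))) ((-1) ^ n * -1)"
      using match_mult[OF r(3) h r(1) m \<sigma>] .
    have "match (inv (alt ?n)) (a (\<epsilon> * int (Suc n))) (a ?s) ((-1) ^ n)"
      using match_inv[OF h m \<sigma>] .
    then have "match (alt ?n \<otimes> g ?s \<otimes> inv (alt ?n)) (a (\<epsilon> * int (Suc n))) (a (\<epsilon> * int (Suc n)))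
        ((-1) ^ n * -1 * (-1) ^ n)"
      by (rule match_mult[OF inv_closed[OF h] m_closed[OF h r(3)] _ m2]) (use \<sigma> in auto)
    then have "match (alt ?n \<otimes> g ?s \<otimes> inv (alt ?n)) (a (\<epsilon> * int (Suc n))) (a (\<epsilon> * int (Suc n))) (-1)"
      using \<sigma> by auto
    moreover have "alt ?n \<otimes> g ?s \<otimes> inv (alt ?n) \<notin> S"
      using conjugate_not_stab[OF h r(3,2) m] .
    ultimately have "\<exists>r\<in>carrier G. r \<notin> S \<and> match r (a (\<epsilon> * int (Suc n))) (a (\<epsilon> * int (Suc n))) (-1)"
      using h r(3) by (intro bexI[of _ "alt ?n \<otimes> g ?s \<otimes> inv (alt ?n)"]) auto
    moreover have "match (alt (\<epsilon> * int (Suc n))) (a ?s) (a (\<epsilon> * int (Suc n))) ((-1) ^ Suc n)"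
      using m2 alt_Suc[OF \<epsilon>, of n] by simp
    ultimately show ?case by blast
  qed
  then show "match (alt (\<epsilon> * int n)) (a (alt_sign (\<epsilon> * int n))) (a (\<epsilon> * int n)) ((-1) ^ n)"
    and "\<exists>r\<in>carrier G. r \<notin> S \<and> match r (a (\<epsilon> * int n)) (a (\<epsilon> * int n)) (-1)"
    by auto
qed

lemma index_sign_coset:
  assumes \<epsilon>: "\<epsilon> \<in> {1, -1}" and n: "n \<ge> 1" "\<epsilon> * int n \<in> idx"
    and L: "leads_to_via M A (\<phi> (g (\<epsilon> * int n)) \<circ> \<gamma>) (D (\<epsilon> * int n)) \<gamma> E \<mu>"
    and \<tau>: "\<tau> \<in> {1, -1}" "strict_mono_on E (\<lambda>x. \<tau> * \<mu> x)"
  shows "\<tau> = (-1) ^ n" "g (\<epsilon> * int n) <# S = alt (\<epsilon> * int n) <# S"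
proof -
  have \<sigma>: "(-1) ^ n \<in> {1, -1 :: real}" by (simp add: minus_one_power_iff)
  have n': "int n \<ge> 1" using n(1) by simp
  have m: "match (alt (\<epsilon> * int n)) (if (-1) ^ n = real_of_int \<epsilon> then a (-1) else a 1) (a (\<epsilon> * int n)) ((-1) ^ n)"
    using propagation(1)[OF \<epsilon> n] unfolding near_endpoint[OF \<epsilon> n(1)] .
  note * = leads_to_D_determined[OF \<epsilon> n' n(2) alt_carrier[OF \<epsilon>] \<sigma> m L \<tau>]
  show "\<tau> = (-1) ^ n" by (fact *(2))
  show "g (\<epsilon> * int n) <# S = alt (\<epsilon> * int n) <# S"
    by (rule iffD2[OF same_coset_iff[OF g_carrier[OF n(2)] alt_carrier[OF \<epsilon>]] *(1)])
qed

section \<open>The pieces are the maximal intervals\<close>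

lemma index_reflection:
  assumes "m \<in> idx"
  shows "\<exists>r\<in>carrier G. r \<notin> S \<and> match r (a m) (a m) (-1)"
proof -
  obtain \<epsilon> n where "\<epsilon> \<in> {1, -1}" "n \<ge> 1" "m = \<epsilon> * int n" "\<epsilon> * int n \<in> idx"
    using assms by (rule idx_cases)
  then show ?thesis using propagation(2)[of \<epsilon> n] by simp
qed

lemma not_interior_free:
  assumes "free_interval G M \<phi> I \<gamma> B" "m \<in> idx"
  shows "a m \<notin> interior B"
  using index_reflection[OF assms(2)] free_intervalD[OF assms(1)] by blast

text \<open>
  Leaving the piece \<open>D n\<close>, the interval \<open>B\<close> would have an endpoint of \<open>D n\<close> in its interior.
\<close>

lemma free_interval_subset_D:
  assumes B: "free_interval G M \<phi> I \<gamma> B" and t: "t \<in> interior B" and n: "n = 0 \<or> n \<in> idx" "t \<in> D n"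
  shows "B \<subseteq> D n"
proof
  fix x assume x: "x \<in> B"
  have conn: "connected B" and BI: "B \<subseteq> I"
    using B by (auto simp: free_interval_def nondeg_interval_def)
  have between: "c \<in> interior B" if c: "t \<le> c \<and> c < x \<or> x < c \<and> c \<le> t" for c
  proof (cases "c = t")
    case False
    have "t \<in> B" using t interior_subset by blast
    then have "{t..x} \<subseteq> B" "{x..t} \<subseteq> B" using x conn connected_contains_Icc by blast+
    then have "{min t x<..<max t x} \<subseteq> B" by (auto simp: min_def max_def subset_iff)
    moreover have "c \<in> {min t x<..<max t x}" using c False by auto
    ultimately show ?thesis by (intro interiorI) auto
  qed (use t in simp)
  show "x \<in> D n"
  proof (cases "n = 0")
    case True
    have u: "1 \<in> idx" "-1 \<in> idx" using unit_in_idx by auto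
    have t': "a (-1) \<le> t" "t \<le> a 1" using n(2) True D_0 A_eq by auto
    show ?thesis
    proof (rule ccontr)
      assume "x \<notin> D n"
      then have "a 1 < x \<or> x < a (-1)" using True D_0 A_eq by auto
      then show False
        using between[of "a 1"] between[of "a (-1)"] t' not_interior_free[OF B u(1)]
          not_interior_free[OF B u(2)] by auto
    qed
  next
    case False
    then obtain \<epsilon> k where \<epsilon>: "\<epsilon> \<in> {1, -1}" "k \<ge> 1" "n = \<epsilon> * int k" "\<epsilon> * int k \<in> idx"
      using n(1) idx_cases by metis
    have k: "int k \<ge> 1" using \<epsilon>(2) by simp
    note D = D_eq[OF \<epsilon>(1) k \<epsilon>(4)]
    show ?thesis
    proof (rule ccontr)
      assume "x \<notin> D n"
      then consider "of_int \<epsilon> * x < of_int \<epsilon> * a (\<epsilon> * int k)"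
        | "\<epsilon> * (int k + 1) \<in> idx" "of_int \<epsilon> * a (\<epsilon> * (int k + 1)) < of_int \<epsilon> * x"
        unfolding \<epsilon>(3) D using x BI by fastforce
      then show False
      proof cases
        case 1
        moreover have "of_int \<epsilon> * a (\<epsilon> * int k) \<le> of_int \<epsilon> * t" using n(2) unfolding \<epsilon>(3) D by simp
        ultimately have "a (\<epsilon> * int k) \<in> interior B" using \<epsilon>(1) by (intro between) auto
        then show False using not_interior_free[OF B \<epsilon>(4)] by simp
      next
        case 2
        moreover have "of_int \<epsilon> * t \<le> of_int \<epsilon> * a (\<epsilon> * (int k + 1))" using n(2) 2(1) unfolding \<epsilon>(3) D by simp
        ultimately have "a (\<epsilon> * (int k + 1)) \<in> interior B" using \<epsilon>(1) by (intro between) auto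
        then show False using not_interior_free[OF B 2(1)] by simp
      qed
    qed
  qed
qed

lemma D_maximal:
  assumes n: "n = 0 \<or> n \<in> idx"
  shows "maximal_interval G M \<phi> I \<gamma> (D n)"
  unfolding maximal_interval_def
proof (intro conjI notI)
  show free_D: "free_interval G M \<phi> I \<gamma> (D n)" using D_free[OF n] .
  assume "\<exists>B. free_interval G M \<phi> I \<gamma> B \<and> D n \<subset> B"
  then obtain B where B: "free_interval G M \<phi> I \<gamma> B" "D n \<subset> B" by blast
  obtain t where t: "t \<in> interior (D n)" using free_D by (auto simp: free_interval_def nondeg_interval_def)
  moreover have "interior (D n) \<subseteq> interior B" "interior (D n) \<subseteq> D n"
    using interior_mono[of "D n" B] B(2) interior_subset[of "D n"] by auto
  ultimately have "B \<subseteq> D n" using free_interval_subset_D[OF B(1) _ n] by blast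
  with B(2) show False by blast
qed

text \<open>
  The pieces shrink to the accumulation point, so all translates of a point \<open>\<gamma> y\<close> are squeezed
  towards \<open>\<gamma> x\<close>.
\<close>

lemma accumulation_limit:
  assumes \<epsilon>: "\<epsilon> \<in> {1, -1}" and all: "\<And>n. n \<ge> 1 \<Longrightarrow> \<epsilon> * int n \<in> idx"
    and x: "(\<lambda>n. a (\<epsilon> * int (Suc n))) \<longlonglongrightarrow> x" "x \<in> I" and y: "y \<in> A"
  shows "limitin (mtop M) (\<lambda>n. \<phi> (g (\<epsilon> * int (Suc n))) (\<gamma> y)) (\<gamma> x) sequentially"
proof -
  have "\<exists>c\<in>D (\<epsilon> * int (Suc n)). \<phi> (g (\<epsilon> * int (Suc n))) (\<gamma> y) = \<gamma> c" for n
  proof -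
    have i: "\<epsilon> * int (Suc n) \<in> idx" and i2: "\<epsilon> * (int (Suc n) + 1) \<in> idx"
      using all[of "Suc n"] all[of "Suc (Suc n)"] by (simp_all add: algebra_simps)
    obtain E \<mu> where L: "leads_to_via M A (\<phi> (g (\<epsilon> * int (Suc n))) \<circ> \<gamma>) (D (\<epsilon> * int (Suc n))) \<gamma> E \<mu>"
      using leads_to_D[OF i] by metis
    have "E = A" using compact_index[OF \<epsilon> _ i2 L] by simp
    with y leads_to_viaD(4,6)[OF L] show ?thesis by blast
  qed
  then obtain c where c: "\<And>n. c n \<in> D (\<epsilon> * int (Suc n))"
    "\<And>n. \<phi> (g (\<epsilon> * int (Suc n))) (\<gamma> y) = \<gamma> (c n)" by metis
  have between: "of_int \<epsilon> * a (\<epsilon> * int (Suc n)) \<le> of_int \<epsilon> * c n"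
    "of_int \<epsilon> * c n \<le> of_int \<epsilon> * a (\<epsilon> * int (Suc (Suc n)))" for n
    using D_facts(3,5)[OF \<epsilon>, of "int (Suc n)" "c n"] all[of "Suc n"] all[of "Suc (Suc n)"] c(1)[of n]
    by (simp_all add: algebra_simps)
  have lim: "(\<lambda>n. of_int \<epsilon> * a (\<epsilon> * int (Suc n))) \<longlonglongrightarrow> of_int \<epsilon> * x"
    by (intro tendsto_intros x)
  have "(\<lambda>n. of_int \<epsilon> * c n) \<longlonglongrightarrow> of_int \<epsilon> * x"
    by (rule tendsto_sandwich[OF _ _ lim LIMSEQ_Suc[OF lim]]) (use between in auto)
  then have "(\<lambda>n. of_int \<epsilon> * (of_int \<epsilon> * c n)) \<longlonglongrightarrow> of_int \<epsilon> * (of_int \<epsilon> * x)"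
    by (rule tendsto_mult_left)
  moreover have "real_of_int \<epsilon> * (real_of_int \<epsilon> * z) = z" for z using \<epsilon> by auto
  ultimately have cx: "c \<longlonglongrightarrow> x" by simp
  show ?thesis
    unfolding limitin_def
  proof (intro conjI allI impI)
    show "\<gamma> x \<in> topspace (mtop M)" using point[OF x(2)] .
    fix V assume V: "openin (mtop M) V \<and> \<gamma> x \<in> V"
    then have "\<forall>\<^sub>F s in nhds x. s \<in> I \<and> \<gamma> s \<in> V"
      using open_immersion_eventually_in[OF immersion x(2)] by blast
    then have "\<forall>\<^sub>F n in sequentially. c n \<in> I \<and> \<gamma> (c n) \<in> V"
      using cx by (rule eventually_compose_filterlim)
    then show "\<forall>\<^sub>F n in sequentially. \<phi> (g (\<epsilon> * int (Suc n))) (\<gamma> y) \<in> V"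
      by eventually_elim (simp only: c(2))
  qed
qed

lemma infinite_image_A: "infinite (\<gamma> ` A)"
proof -
  have "a (-1) \<in> I" using a_in unit_in_idx by blast
  then obtain r where r: "r > 0" "inj_on \<gamma> {a (-1) - r<..<a (-1) + r}"
    using locally_inj by blast
  define u where "u = min (a 1) (a (-1) + r)"
  have "infinite {a (-1)<..<u}" using r(1) A_less by (simp add: u_def)
  moreover have "inj_on \<gamma> {a (-1)<..<u}"
    using r(1) by (intro inj_on_subset[OF r(2)]) (auto simp: u_def)
  ultimately have "infinite (\<gamma> ` {a (-1)<..<u})" using finite_image_iff by blast
  then show ?thesis
    by (rule contrapos_nn) (erule finite_subset[rotated], auto simp: u_def A_eq)
qed

text \<open>
  A point of \<open>I\<close> outside all pieces bounds one of the two sequences of division points, which then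
  converges to some \<open>x\<close> in \<open>I\<close>. The corresponding \<open>g (\<epsilon> * int n)\<close> contract two further points of
  \<open>\<gamma> ` A\<close> to \<open>\<gamma> x\<close>, which satedness forbids.
\<close>

lemma D_cover:
  assumes sated: "sated G M \<phi>" and t: "t \<in> I"
  shows "\<exists>n. (n = 0 \<or> n \<in> idx) \<and> t \<in> D n"
proof (rule ccontr)
  assume "\<not> ?thesis"
  then have tD: "t \<notin> D n" if "n = 0 \<or> n \<in> idx" for n using that by blast
  have "t \<notin> A" using tD[of 0] D_0 by simp
  then have "t > a 1 \<or> t < a (-1)" using A_eq by auto
  then obtain \<epsilon> :: int where \<epsilon>: "\<epsilon> \<in> {1, -1}" "of_int \<epsilon> * a \<epsilon> < of_int \<epsilon> * t"
    by (metis insertCI mult_1 mult_minus_left neg_less_iff_less of_int_1 of_int_minus)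
  have all: "\<epsilon> * int n \<in> idx \<and> of_int \<epsilon> * a (\<epsilon> * int n) < of_int \<epsilon> * t" if "n \<ge> 1" for n
    using that
  proof (induction n rule: nat_induct_at_least)
    case base
    then show ?case using \<epsilon> unit_in_idx[OF \<epsilon>(1)] by simp
  next
    case (Suc n)
    have n: "int n \<ge> 1" "\<epsilon> * int n \<in> idx" using Suc by auto
    have "t \<notin> D (\<epsilon> * int n)" using tD n(2) by blast
    then have "\<epsilon> * (int n + 1) \<in> idx" "\<not> of_int \<epsilon> * t \<le> of_int \<epsilon> * a (\<epsilon> * (int n + 1))"
      unfolding D_eq[OF \<epsilon>(1) n] using t Suc.IH by auto
    then show ?case by (simp add: algebra_simps)
  qed
  have idx: "\<epsilon> * int n \<in> idx" if "n \<ge> 1" for n using all[OF that] by simp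
  define b where "b n = of_int \<epsilon> * a (\<epsilon> * int (Suc n))" for n
  have "incseq b"
  proof (rule incseq_SucI)
    fix n
    show "b n \<le> b (Suc n)"
      unfolding b_def using a_step[OF \<epsilon>(1), of "int (Suc n)"] idx[of "Suc (Suc n)"]
      by (simp add: algebra_simps)
  qed
  moreover have bt: "b n \<le> of_int \<epsilon> * t" for n
    unfolding b_def using all[of "Suc n"] by simp
  ultimately obtain L where L: "b \<longlonglongrightarrow> L" "\<And>n. b n \<le> L"
    using incseq_convergent by metis
  define x where "x = of_int \<epsilon> * L"
  have eps2: "real_of_int \<epsilon> * (real_of_int \<epsilon> * z) = z" for z using \<epsilon>(1) by auto
  have ax: "(\<lambda>n. a (\<epsilon> * int (Suc n))) \<longlonglongrightarrow> x"
  proof -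
    have "(\<lambda>n. of_int \<epsilon> * b n) \<longlonglongrightarrow> of_int \<epsilon> * L" by (intro tendsto_intros L)
    then show ?thesis by (simp add: x_def b_def eps2)
  qed
  have "b 0 \<le> L" "L \<le> of_int \<epsilon> * t" using L bt LIMSEQ_le_const2 by blast+
  then have "a \<epsilon> \<le> x \<and> x \<le> t \<or> t \<le> x \<and> x \<le> a \<epsilon>"
    using \<epsilon>(1) by (auto simp: x_def b_def)
  moreover have "a \<epsilon> \<in> I" using a_in unit_in_idx[OF \<epsilon>(1)] by blast
  ultimately have x: "x \<in> I" using I_convex[OF _ t, of "a \<epsilon>"] I_convex[OF t, of "a \<epsilon>"] by auto
  have "infinite (\<gamma> ` A - {\<gamma> x})" using infinite_image_A by simp
  then obtain p where p: "p \<in> \<gamma> ` A - {\<gamma> x}" by (metis ex_in_conv finite.emptyI)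
  then have "infinite (\<gamma> ` A - {\<gamma> x} - {p})" using infinite_image_A by simp
  then obtain q where q: "q \<in> \<gamma> ` A - {\<gamma> x} - {p}" by (metis ex_in_conv finite.emptyI)
  obtain y z where yz: "y \<in> A" "p = \<gamma> y" "z \<in> A" "q = \<gamma> z" using p q by auto
  have pts: "\<gamma> x \<in> topspace (mtop M)" "p \<in> topspace (mtop M)" "q \<in> topspace (mtop M)"
    using point x yz A_subset by auto
  let ?h = "\<lambda>n. g (\<epsilon> * int (Suc n))"
  have "?h n \<in> carrier G" for n using g_carrier idx[of "Suc n"] by simp
  then have "range ?h \<subseteq> carrier G" by (rule image_subsetI)
  moreover have "limitin (mtop M) (\<lambda>n. \<phi> (?h n) p) (\<gamma> x) sequentially"
    "limitin (mtop M) (\<lambda>n. \<phi> (?h n) q) (\<gamma> x) sequentially"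
    unfolding yz(2,4) using accumulation_limit[OF \<epsilon>(1) idx ax x] yz(1,3) by blast+
  moreover have "\<gamma> x \<noteq> p \<and> p \<noteq> q \<and> \<gamma> x \<noteq> q" using p q by auto
  ultimately show False
    using sated pts unfolding sated_def by blast
qed

lemma maximal_interval_iff:
  assumes sated: "sated G M \<phi>"
  shows "maximal_interval G M \<phi> I \<gamma> B \<longleftrightarrow> (\<exists>n. (n = 0 \<or> n \<in> idx) \<and> B = D n)"
proof
  assume B: "maximal_interval G M \<phi> I \<gamma> B"
  then have freeB: "free_interval G M \<phi> I \<gamma> B" by (simp add: maximal_interval_def)
  obtain t where t: "t \<in> interior B" using freeB by (auto simp: free_interval_def nondeg_interval_def)
  moreover have "interior B \<subseteq> I" using freeB interior_subset by (force simp: free_interval_def)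
  ultimately obtain n where n: "n = 0 \<or> n \<in> idx" "t \<in> D n" using D_cover[OF sated] by blast
  have "B \<subseteq> D n" using free_interval_subset_D[OF freeB t n] .
  with B D_free[OF n(1)] have "B = D n" by (auto simp: maximal_interval_def)
  with n(1) show "\<exists>n. (n = 0 \<or> n \<in> idx) \<and> B = D n" by blast
qed (auto intro: D_maximal)

text \<open>
  The last piece on either side is not compact, because \<open>I\<close> is open; every other piece ends at
  division points.
\<close>

lemma compact_D_endpoints:
  assumes n: "n = 0 \<or> n \<in> idx" and D: "D n = {p..q}" "p < q"
  shows "\<exists>m\<in>idx. p = a m" "\<exists>m\<in>idx. q = a m"
proof -
  have "(\<exists>m\<in>idx. p = a m) \<and> (\<exists>m\<in>idx. q = a m)"
  proof (cases "n = 0")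
    case True
    then have "p = a (-1)" "q = a 1" using D D_0 A_eq A_less by (auto simp: Icc_eq_Icc)
    then show ?thesis using unit_in_idx by blast
  next
    case False
    then obtain \<epsilon> k where \<epsilon>: "\<epsilon> \<in> {1, -1}" "k \<ge> 1" "n = \<epsilon> * int k" "\<epsilon> * int k \<in> idx"
      using n idx_cases by metis
    have k: "int k \<ge> 1" using \<epsilon>(2) by simp
    note Dn = D_eq[OF \<epsilon>(1) k \<epsilon>(4)]
    have pqI: "p \<in> I" "q \<in> I" using D_subset[OF n] D by auto
    have next_idx: "\<epsilon> * (int k + 1) \<in> idx"
    proof (rule ccontr)
      assume "\<not> ?thesis"
      then have Dk: "x \<in> {p..q} \<longleftrightarrow> x \<in> I \<and> of_int \<epsilon> * a (\<epsilon> * int k) \<le> of_int \<epsilon> * x" for x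
        using Dn D(1) \<epsilon>(3) by auto
      define f where "f = (if \<epsilon> = 1 then q else p)"
      have "f \<in> I" using pqI by (simp add: f_def)
      then obtain d where d: "d > 0" "\<And>x. \<bar>x - f\<bar> < d \<Longrightarrow> x \<in> I"
        using I_open unfolding open_dist dist_real_def by metis
      have "f \<in> {p..q}" using D(2) by (simp add: f_def)
      then have "of_int \<epsilon> * a (\<epsilon> * int k) \<le> of_int \<epsilon> * f" using Dk by blast
      moreover have "of_int \<epsilon> * f \<le> of_int \<epsilon> * (f + of_int \<epsilon> * (d / 2))" using \<epsilon>(1) d(1) by auto
      ultimately have "f + of_int \<epsilon> * (d / 2) \<in> {p..q}"
        unfolding Dk using d \<epsilon>(1) by auto
      then show False using \<epsilon>(1) d(1) by (auto simp: f_def)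
    qed
    have l: "a (\<epsilon> * int k) \<in> I" "a (\<epsilon> * (int k + 1)) \<in> I" using a_in \<epsilon>(4) next_idx by auto
    have less: "of_int \<epsilon> * a (\<epsilon> * int k) < of_int \<epsilon> * a (\<epsilon> * (int k + 1))"
      using a_step[OF \<epsilon>(1) k next_idx] .
    have mem: "x \<in> {p..q} \<longleftrightarrow> x \<in> I \<and> of_int \<epsilon> * a (\<epsilon> * int k) \<le> of_int \<epsilon> * x \<and>
        of_int \<epsilon> * x \<le> of_int \<epsilon> * a (\<epsilon> * (int k + 1))" for x
      using Dn D(1) \<epsilon>(3) next_idx by auto
    have inside: "a (\<epsilon> * int k) \<in> {p..q}" "a (\<epsilon> * (int k + 1)) \<in> {p..q}"
      unfolding mem using l less by auto
    have "p \<in> {p..q}" "q \<in> {p..q}" using D(2) by auto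
    then have *: "of_int \<epsilon> * a (\<epsilon> * int k) \<le> of_int \<epsilon> * p" "of_int \<epsilon> * p \<le> of_int \<epsilon> * a (\<epsilon> * (int k + 1))"
      "of_int \<epsilon> * a (\<epsilon> * int k) \<le> of_int \<epsilon> * q" "of_int \<epsilon> * q \<le> of_int \<epsilon> * a (\<epsilon> * (int k + 1))"
      unfolding mem by blast+
    from \<epsilon>(1) consider "\<epsilon> = 1" | "\<epsilon> = -1" by blast
    then show ?thesis
    proof cases
      case 1
      with * inside have "p = a (\<epsilon> * int k)" "q = a (\<epsilon> * (int k + 1))" by auto
      then show ?thesis using \<epsilon>(4) next_idx by blast
    next
      case 2
      with * inside have "q = a (\<epsilon> * int k)" "p = a (\<epsilon> * (int k + 1))" by auto
      then show ?thesis using \<epsilon>(4) next_idx by blast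
    qed
  qed
  then show "\<exists>m\<in>idx. p = a m" "\<exists>m\<in>idx. q = a m" by auto
qed

lemma signs_and_cosets:
  assumes n: "n \<in> idx"
  shows "even \<bar>n\<bar> \<longrightarrow> leads_to_pos M A (\<phi> (g n) \<circ> \<gamma>) (D n) \<gamma>"
    and "odd \<bar>n\<bar> \<longrightarrow> leads_to_neg M A (\<phi> (g n) \<circ> \<gamma>) (D n) \<gamma>"
    and "g n <# S = alt n <# S"
proof -
  obtain \<epsilon> k where \<epsilon>: "\<epsilon> \<in> {1, -1}" "k \<ge> 1" "n = \<epsilon> * int k" "\<epsilon> * int k \<in> idx"
    using n by (rule idx_cases)
  obtain E \<mu> \<tau> where L: "leads_to_via M A (\<phi> (g n) \<circ> \<gamma>) (D n) \<gamma> E \<mu>"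
    "\<tau> \<in> {1, -1}" "strict_mono_on E (\<lambda>x. \<tau> * \<mu> x)"
    using leads_to_D[OF n] .
  have *: "\<tau> = (-1) ^ k" "g n <# S = alt n <# S"
    using index_sign_coset[OF \<epsilon>(1,2,4) L(1)[unfolded \<epsilon>(3)] L(2,3)] \<epsilon>(3) by auto
  show "g n <# S = alt n <# S" by (fact *(2))
  have par: "even \<bar>n\<bar> \<longleftrightarrow> even k" using \<epsilon>(1,3) by (auto simp: abs_mult)
  show "even \<bar>n\<bar> \<longrightarrow> leads_to_pos M A (\<phi> (g n) \<circ> \<gamma>) (D n) \<gamma>"
  proof
    assume "even \<bar>n\<bar>"
    then have "\<tau> = 1" using par * by simp
    then have "strict_mono_on E \<mu>" using L(3) by simp
    then show "leads_to_pos M A (\<phi> (g n) \<circ> \<gamma>) (D n) \<gamma>"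
      unfolding leads_to_pos_def using L(1) by blast
  qed
  show "odd \<bar>n\<bar> \<longrightarrow> leads_to_neg M A (\<phi> (g n) \<circ> \<gamma>) (D n) \<gamma>"
  proof
    assume "odd \<bar>n\<bar>"
    then have "\<tau> = -1" using par * by simp
    then have "strict_antimono_on E \<mu>" using L(3) by (auto simp: monotone_on_def)
    then show "leads_to_neg M A (\<phi> (g n) \<circ> \<gamma>) (D n) \<gamma>" unfolding leads_to_neg_def using L(1) by blast
  qed
qed

text \<open>
  Two reflections at the same point compose to an orientation preserving match of \<open>a \<epsilon>\<close> with itself.
  It moves nearby interior points of \<open>A\<close> to interior points of \<open>A\<close>, so the square lies in \<open>S\<close> by
  freeness.
\<close>

lemma reflection_coset:
  assumes \<epsilon>: "\<epsilon> \<in> {1, -1}"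
  shows "g \<epsilon> <# S \<subseteq> stabilizer G \<phi> (\<gamma> (a \<epsilon>)) - S"
    and "inv (g \<epsilon>) <# S = g \<epsilon> <# S"
proof -
  note g = g_reflection[OF \<epsilon>]
  have aI: "a \<epsilon> \<in> I" using match_in[OF g(1)] by simp
  show "g \<epsilon> <# S \<subseteq> stabilizer G \<phi> (\<gamma> (a \<epsilon>)) - S"
  proof
    fix h assume "h \<in> g \<epsilon> <# S"
    then obtain k where k: "k \<in> S" "h = g \<epsilon> \<otimes> k" by (auto simp: l_coset_def)
    have kc: "k \<in> carrier G" using stab_carrier[OF k(1)] .
    have "\<phi> h (\<gamma> (a \<epsilon>)) = \<gamma> (a \<epsilon>)"
      using act_mult[OF g(3) kc point[OF aI]] stab_eq[OF k(1) aI] match_eq[OF g(1)] k(2) by simp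
    moreover have "h \<notin> S"
    proof
      assume "h \<in> S"
      then have "h \<otimes> inv k \<in> S"
        using k(1) subgroup.m_closed[OF stab_subgroup] subgroup.m_inv_closed[OF stab_subgroup] by blast
      then show False using k(2) kc g(2,3) by (simp add: m_assoc)
    qed
    ultimately show "h \<in> stabilizer G \<phi> (\<gamma> (a \<epsilon>)) - S"
      using k kc g(3) by (simp add: stabilizer_def)
  qed
  have m: "match (g \<epsilon> \<otimes> g \<epsilon>) (a \<epsilon>) (a \<epsilon>) (-1 * -1)"
    using match_mult[OF g(3,3,1,1)] by simp
  then obtain U \<nu> where U: "open U" "a \<epsilon> \<in> U" "continuous_on U \<nu>" "strict_mono_on U (\<lambda>x. -1 * -1 * \<nu> x)"
    "\<nu> (a \<epsilon>) = a \<epsilon>" "\<And>x. x \<in> U \<Longrightarrow> match (g \<epsilon> \<otimes> g \<epsilon>) x (\<nu> x) (-1 * -1)"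
    by (elim matchE) blast
  have less: "of_int \<epsilon> * a (- \<epsilon>) < of_int \<epsilon> * a \<epsilon>" using \<epsilon> A_less by auto
  define V where "V = U \<inter> \<nu> -` {y. of_int \<epsilon> * a (- \<epsilon>) < of_int \<epsilon> * y}"
  have "open {y. of_int \<epsilon> * a (- \<epsilon>) < of_int \<epsilon> * y}"
    by (intro open_Collect_less continuous_intros)
  then have "open V"
    unfolding V_def by (rule continuous_open_preimage[OF U(3,1)])
  moreover have "a \<epsilon> \<in> V" using U(2,5) less by (simp add: V_def)
  ultimately obtain d where d: "d > 0" "\<And>x. \<bar>x - a \<epsilon>\<bar> < d \<Longrightarrow> x \<in> V"
    unfolding open_dist dist_real_def by metis
  define u where "u = min d (of_int \<epsilon> * a \<epsilon> - of_int \<epsilon> * a (- \<epsilon>)) / 2"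
  have u: "0 < u" "u < d" "u < of_int \<epsilon> * a \<epsilon> - of_int \<epsilon> * a (- \<epsilon>)"
    using d(1) less by (auto simp: u_def)
  define x where "x = a \<epsilon> - of_int \<epsilon> * u"
  have "x \<in> V" using d(2)[of x] u \<epsilon> by (auto simp: x_def)
  then have xU: "x \<in> U" and \<nu>x: "of_int \<epsilon> * a (- \<epsilon>) < of_int \<epsilon> * \<nu> x" by (auto simp: V_def)
  have x: "of_int \<epsilon> * a (- \<epsilon>) < of_int \<epsilon> * x" "of_int \<epsilon> * x < of_int \<epsilon> * a \<epsilon>"
    using u \<epsilon> by (auto simp: x_def)
  have "of_int \<epsilon> * \<nu> x < of_int \<epsilon> * a \<epsilon>"
    using strict_mono_on_scaled_cancel[OF U(4) xU U(2)] strict_mono_on_scaled_cancel[OF U(4) U(2) xU]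
      x(2) U(5) \<epsilon> by auto
  with \<nu>x x have "x \<in> interior A" "\<nu> x \<in> interior A" using \<epsilon> by (auto simp: A_eq)
  then have sq: "g \<epsilon> \<otimes> g \<epsilon> \<in> S"
    using free_intervalD[OF free _ U(6)[OF xU]] g(3) by simp
  then show "inv (g \<epsilon>) <# S = g \<epsilon> <# S"
    using same_coset_iff[of "inv (g \<epsilon>)" "g \<epsilon>"] g(3) by simp
qed

end

section \<open>Negative curves\<close>

theorem proposition7:
  fixes G :: "('g, 'z) monoid_scheme"
    and L :: "'g chart_structure"
    and M :: "'m chart_structure"
    and \<phi> :: "'g \<Rightarrow> 'm \<Rightarrow> 'm"
    and I A :: "real set"
    and \<gamma> :: "real \<Rightarrow> 'm"
    and nm np :: "int extended"
    and a :: "int \<Rightarrow> real"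
    and g :: "int \<Rightarrow> 'g"
  assumes "lie_group G L"
    and "analytic_manifold M"
    and "group_action G (topspace (mtop M)) \<phi>"
    and "continuous_in_group L M \<phi>"
    and "sated G M \<phi>"
    and "analytic_in_space G M \<phi>"
    and "nondeg_interval I" and "open I"
    and "analytic_immersion M I \<gamma>"
    and "free_curve G M \<phi> I \<gamma>"
    and "negative_curve G M \<phi> I \<gamma>"
    and "compact A" and "maximal_interval G M \<phi> I \<gamma> A"
    and "A_decomposition G M \<phi> I \<gamma> A nm np a g"
  shows
    "(\<forall>n. nm \<le> Fin n \<and> Fin n \<le> np \<longrightarrow>
        maximal_interval G M \<phi> I \<gamma> (decomp_interval I nm np a n)) \<and>
     (\<forall>B. maximal_interval G M \<phi> I \<gamma> B \<longrightarrow>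
        (\<exists>n. nm \<le> Fin n \<and> Fin n \<le> np \<and> B = decomp_interval I nm np a n)) \<and>
     (\<forall>n \<in> decomp_index nm np.
        (even \<bar>n\<bar> \<longrightarrow> leads_to_pos M A (\<phi> (g n) \<circ> \<gamma>) (decomp_interval I nm np a n) \<gamma>) \<and>
        (odd \<bar>n\<bar> \<longrightarrow> leads_to_neg M A (\<phi> (g n) \<circ> \<gamma>) (decomp_interval I nm np a n) \<gamma>) \<and>
        g n <#\<^bsub>G\<^esub> curve_stabilizer G \<phi> I \<gamma> =
          alternating_product G g n <#\<^bsub>G\<^esub> curve_stabilizer G \<phi> I \<gamma>) \<and>
     (\<forall>n \<in> {-1, 1}.
        g n <#\<^bsub>G\<^esub> curve_stabilizer G \<phi> I \<gamma>
          \<subseteq> stabilizer G \<phi> (\<gamma> (a n)) - curve_stabilizer G \<phi> I \<gamma> \<and>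
        inv\<^bsub>G\<^esub> (g n) <#\<^bsub>G\<^esub> curve_stabilizer G \<phi> I \<gamma> = g n <#\<^bsub>G\<^esub> curve_stabilizer G \<phi> I \<gamma>)"
proof -
  have imm: "open_immersion M I \<gamma>"
    using \<open>analytic_immersion M I \<gamma>\<close> \<open>open I\<close> by (rule analytic_immersion_open)
  interpret analytic_curve_action G M \<phi> I \<gamma>
    by (rule analytic_curve_action.intro) (fact assms imm)+
  have freeA: "free_interval G M \<phi> I \<gamma> A"
    using \<open>maximal_interval G M \<phi> I \<gamma> A\<close> by (simp add: maximal_interval_def)
  interpret A: curve_decomposition G M \<phi> I \<gamma> A nm np a g
    by unfold_locales (fact assms freeA)+
  obtain B where B: "negative_interval G M \<phi> I \<gamma> B"
    using \<open>negative_curve G M \<phi> I \<gamma>\<close> by (auto simp: negative_curve_def)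
  then have freeB: "free_interval G M \<phi> I \<gamma> B"
    by (simp add: negative_interval_def maximal_interval_def)
  obtain bm bp b k where bdec: "A_decomposition G M \<phi> I \<gamma> B bm bp b k"
    and neg: "\<And>n. n \<in> {-1, 1} \<Longrightarrow>
      leads_to_neg M B (\<phi> (k n) \<circ> \<gamma>) (decomp_interval I bm bp b n) \<gamma>"
    using B unfolding negative_interval_def by blast
  interpret B: curve_decomposition G M \<phi> I \<gamma> B bm bp b k
    by unfold_locales (fact bdec freeB)+
  interpret B: reflected_decomposition G M \<phi> I \<gamma> B bm bp b k
    by unfold_locales (rule B.negative_reflections, use neg in auto)
  \<comment> \<open>\<open>A\<close> is one of the intervals of the negative decomposition, so both its endpoints carry reflections.\<close>
  obtain n where n: "n = 0 \<or> n \<in> decomp_index bm bp" "A = decomp_interval I bm bp b n"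
    using B.maximal_interval_iff[OF \<open>sated G M \<phi>\<close>] \<open>maximal_interval G M \<phi> I \<gamma> A\<close> by blast
  have D: "decomp_interval I bm bp b n = {a (-1)..a 1}"
    using n(2) A.A_eq by simp
  interpret A: reflected_decomposition G M \<phi> I \<gamma> A nm np a g
  proof
    fix \<epsilon> :: int assume "\<epsilon> \<in> {1, -1}"
    then obtain m where "m \<in> decomp_index bm bp" "a \<epsilon> = b m"
      using B.compact_D_endpoints[OF n(1) D A.A_less] by blast
    then show "\<exists>r\<in>carrier G. r \<notin> S \<and> match r (a \<epsilon>) (a \<epsilon>) (-1)"
      using B.index_reflection by simp
  qed
  show ?thesis
  proof (intro conjI allI ballI impI)
    fix n assume "nm \<le> Fin n \<and> Fin n \<le> np"
    then show "maximal_interval G M \<phi> I \<gamma> (decomp_interval I nm np a n)"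
      using A.D_maximal A.in_range_iff by blast
  next
    fix B assume "maximal_interval G M \<phi> I \<gamma> B"
    then obtain n where "n = 0 \<or> n \<in> decomp_index nm np" "B = decomp_interval I nm np a n"
      using A.maximal_interval_iff[OF \<open>sated G M \<phi>\<close>] by blast
    then show "\<exists>n. nm \<le> Fin n \<and> Fin n \<le> np \<and> B = decomp_interval I nm np a n"
      using A.in_range_iff by blast
  next
    fix n assume n: "n \<in> decomp_index nm np"
    note * = A.signs_and_cosets[OF n]
    show "leads_to_pos M A (\<phi> (g n) \<circ> \<gamma>) (decomp_interval I nm np a n) \<gamma>" if "even \<bar>n\<bar>"
      using *(1) that by blast
    show "leads_to_neg M A (\<phi> (g n) \<circ> \<gamma>) (decomp_interval I nm np a n) \<gamma>" if "odd \<bar>n\<bar>"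
      using *(2) that by blast
    show "g n <#\<^bsub>G\<^esub> curve_stabilizer G \<phi> I \<gamma> =
        alternating_product G g n <#\<^bsub>G\<^esub> curve_stabilizer G \<phi> I \<gamma>"
      by (rule *(3))
  next
    fix n :: int assume "n \<in> {-1, 1}"
    then have n: "n \<in> {1, -1}" by blast
    show "g n <#\<^bsub>G\<^esub> curve_stabilizer G \<phi> I \<gamma>
        \<subseteq> stabilizer G \<phi> (\<gamma> (a n)) - curve_stabilizer G \<phi> I \<gamma>"
      by (rule A.reflection_coset(1)[OF n])
    show "inv\<^bsub>G\<^esub> (g n) <#\<^bsub>G\<^esub> curve_stabilizer G \<phi> I \<gamma> = g n <#\<^bsub>G\<^esub> curve_stabilizer G \<phi> I \<gamma>"
      by (rule A.reflection_coset(2)[OF n])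
  qed
qed

end
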